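(* Let $\Omega\subset\mathbb R^2$ be a bounded domain and let $u$ be a (sufficiently smooth) solution of $-\nabla\cdot(a\nabla u)=f$ in $\Omega$ with $a>0$ and $a,f$ sufficiently smooth. Let $M\in\mathbb N$, $h>0$, and let $c^*\in\Omega\cap h\mathbb Z^2$ be such that $c^*+[-h,h]^2\subseteq\Omega$. Let $\mathcal S=[-1,1]^2\cap\mathbb Z^2$ and use the base point $b=c^*$. For real unknowns $c_{p,j}$ ($p\in\mathcal S$, $0\le j\le M+1$), write $\vec c_j=(c_{p,j})_{p\in\mathcal S}$ and consider the linear system $$\sum_{p\in\mathcal S}A^m_{m,0}(p)\,c_{p,j}=-\sum_{k=0}^{j-1}\sum_{p\in\mathcal S}A^{m+j-k}_{m,0}(p)\,c_{p,k},\qquad 0\le j\le M+1,\ 0\le m\le M+1-j \qquad(\ast)$$ (equivalently, its real and imaginary parts). Then the part $j=0$ of $(\ast)$ has a solution $\vec c_0\ne0$ if and only if $M\le6$. Moreover, for $M=6$ there always exist real coefficients $c_{p,j}$, $p\in\mathcal S$, $0\le j\le7$, such that: (i) $\{c_{p,j}\}$ solves $(\ast)$ with $M=6$, $\vec c_0\ne0$, and all $c_{p,j}$ are bounded by a constant depending only on $\tilde a=-\ln a$ (bounds on its derivatives); and with $C_p(h):=\sum_{j=0}^7c_{p,j}h^j$, $$\sum_{p\in\mathcal S}C_p(h)u(c^*+ph)=\sum_{p\in\mathcal S}C_p(h)F^{[6]}(p)+O(h^8),$$ where the implied constant depends only on $\tilde a$ and $u$ (bounds on their derivatives); (ii) $c_{(0,0),0}>0$,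 $c_{p,0}<0$ for $p\in\mathcal S\setminus\{(0,0)\}$, and for $1\le j\le7$: $c_{(0,0),j}\ge0$ and $c_{p,j}\le0$ for $p\in\mathcal S\setminus\{(0,0)\}$; in particular $C_{(0,0)}(h)>0$ and $C_p(h)<0$ for all $p\in\mathcal S\setminus\{(0,0)\}$; (iii) $\sum_{p\in\mathcal S}c_{p,j}=0$ for all $0\le j\le7$.
   Context: **Notation.** $\mathbb N_0=\{0,1,2,\dots\}$; $\mathrm i$ is the imaginary unit; $\partial_{\mathbb C}^{(k,\ell)}v:=2^{-(k+\ell)}(\partial_x-\mathrm i\partial_y)^k(\partial_x+\mathrm i\partial_y)^\ell v$; $\delta(0)=1$, $\delta(k)=0$ for $k\ne0$; $\tilde a:=-\ln a$, $\tilde f:=-f/a$ (so the PDE reads $\Delta u=\nabla\tilde a\cdot\nabla u+\tilde f$). For $p=(p_r,p_i)\in\mathbb R^2$, $N^{k,\ell}(p):=\frac{(p_r+\mathrm i p_i)^k(p_r-\mathrm i p_i)^\ell}{k!\,\ell!}$. The following depend on a base point $b$ at which all derivatives are evaluated. For $k,\ell\ge1$, $0\le m\le k$, $0\le n\le\ell$: $\tilde a^{k,\ell}_{m,n}:=\big(\frac m{2k}+\frac n{2\ell}-\frac{mn}{k\ell}\big)\binom km\binom\ell n\,\partial_{\mathbb C}^{(k-m,\ell-n)}\tilde a$. For $mn=0$: if $k\ell=0$, $\tilde A^{k,\ell}_{m,n}:=\delta(k-m)\delta(\ell-n)$ and $\tilde F_{k,\ell}:=0$; if $k\ell\ne0$,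 recursively $\tilde A^{k,\ell}_{m,n}:=\sum\tilde a^{k,\ell}_{i,j}\tilde A^{i,j}_{m,n}$, summed over $m\le i\le k$, $n\le j\le\ell$, $(i,j)\ne(k,\ell)$, and $\tilde F_{k,\ell}:=\sum\tilde a^{k,\ell}_{i,j}\tilde F_{i,j}+\frac14\partial_{\mathbb C}^{(k-1,\ell-1)}\tilde f$, summed over $0\le i\le k$, $0\le j\le\ell$, $(i,j)\ne(k,\ell)$. Put $A^k_{m,n}(p):=\sum_{j=m}^{k-n}N^{j,k-j}(p)\tilde A^{j,k-j}_{m,n}$ (empty sums are $0$; in particular $A^m_{m,0}(p)=(p_r+\mathrm i p_i)^m/m!$ and $A^k_{0,0}=\delta(k)$) and $F^{[M]}(p):=\sum_{0\le k+\ell\le M+1}N^{k,\ell}(p)\tilde F_{k,\ell}h^{k+\ell}$. "Sufficiently smooth" means all derivatives occurring exist and are continuous and bounded. *)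

theory Defs
  imports "HOL-Analysis.Analysis"
begin

type_synonym plane = "real \<times> real"

definition partial_x :: "(plane \<Rightarrow> 'v::real_normed_vector) \<Rightarrow> plane \<Rightarrow> 'v" where
  "partial_x v z = vector_derivative (\<lambda>t. v (t, snd z)) (at (fst z))"

definition partial_y :: "(plane \<Rightarrow> 'v::real_normed_vector) \<Rightarrow> plane \<Rightarrow> 'v" where
  "partial_y v z = vector_derivative (\<lambda>t. v (fst z, t)) (at (snd z))"

text \<open>All partial derivatives of order at most \<open>n\<close>, the function itself included,
  exist and are continuous and bounded on \<open>\<Omega>\<close>.\<close>

fun Ck_bounded :: "nat \<Rightarrow> plane set \<Rightarrow> (plane \<Rightarrow> real) \<Rightarrow> bool" where
  "Ck_bounded 0 \<Omega> v \<longleftrightarrow> continuous_on \<Omega> v \<and> bounded (v ` \<Omega>)"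
| "Ck_bounded (Suc n) \<Omega> v \<longleftrightarrow>
     continuous_on \<Omega> v \<and> bounded (v ` \<Omega>) \<and>
     (\<forall>z\<in>\<Omega>. (\<lambda>t. v (t, snd z)) differentiable (at (fst z)) \<and>
             (\<lambda>t. v (fst z, t)) differentiable (at (snd z))) \<and>
     Ck_bounded n \<Omega> (partial_x v) \<and> Ck_bounded n \<Omega> (partial_y v)"

text \<open>A common bound for the derivatives of orders \<open>1, \<dots>, n\<close>; the values of the function
  itself are not bounded here.\<close>

definition deriv_bound :: "nat \<Rightarrow> plane set \<Rightarrow> (plane \<Rightarrow> real) \<Rightarrow> real \<Rightarrow> bool" where
  "deriv_bound n \<Omega> v B \<longleftrightarrow>
     (\<forall>k l. 1 \<le> k + l \<and> k + l \<le> n \<longrightarrow>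
        (\<forall>z\<in>\<Omega>. \<bar>(partial_x ^^ k) ((partial_y ^^ l) v) z\<bar> \<le> B))"

definition cderiv :: "nat \<Rightarrow> nat \<Rightarrow> (plane \<Rightarrow> real) \<Rightarrow> plane \<Rightarrow> complex" where
  "cderiv k l v z =
     ((\<lambda>g w. partial_x g w - \<i> * partial_y g w) ^^ k)
       (((\<lambda>g w. partial_x g w + \<i> * partial_y g w) ^^ l) (\<lambda>w. complex_of_real (v w))) z
     / 2 ^ (k + l)"

definition solves_pde ::
  "plane set \<Rightarrow> (plane \<Rightarrow> real) \<Rightarrow> (plane \<Rightarrow> real) \<Rightarrow> (plane \<Rightarrow> real) \<Rightarrow> bool" where
  "solves_pde \<Omega> a f u \<longleftrightarrow>
     (\<forall>z\<in>\<Omega>. - (partial_x (\<lambda>w. a w * partial_x u w) z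
               + partial_y (\<lambda>w. a w * partial_y u w) z) = f z)"

text \<open>The smoothness orders are those of the derivatives that occur for the parameter \<open>M\<close>:
  orders up to \<open>M + 1\<close> of \<open>- ln a\<close> and up to \<open>M - 1\<close> of \<open>- f / a\<close>
  enter the coefficients, and a Taylor expansion of \<open>u\<close> with remainder of
  order \<open>M + 2\<close> is used.\<close>

definition setting ::
  "nat \<Rightarrow> plane set \<Rightarrow> (plane \<Rightarrow> real) \<Rightarrow> (plane \<Rightarrow> real) \<Rightarrow> (plane \<Rightarrow> real)
     \<Rightarrow> real \<Rightarrow> plane \<Rightarrow> bool" where
  "setting M \<Omega> a f u h c \<longleftrightarrow>
     open \<Omega> \<and> connected \<Omega> \<and> bounded \<Omega> \<and>
     (\<forall>z\<in>\<Omega>. a z > 0) \<and>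
     Ck_bounded (M + 1) \<Omega> a \<and> Ck_bounded (M - 1) \<Omega> f \<and> Ck_bounded (M + 2) \<Omega> u \<and>
     solves_pde \<Omega> a f u \<and>
     h > 0 \<and> c \<in> \<Omega> \<and> c \<in> (\<lambda>q. h *\<^sub>R q) ` (\<int> \<times> \<int>) \<and>
     (\<lambda>q. c + q) ` ({-h..h} \<times> {-h..h}) \<subseteq> \<Omega>"

definition log_coeff :: "(plane \<Rightarrow> real) \<Rightarrow> plane \<Rightarrow> real" where
  "log_coeff a z = - ln (a z)"

definition scaled_source :: "(plane \<Rightarrow> real) \<Rightarrow> (plane \<Rightarrow> real) \<Rightarrow> plane \<Rightarrow> real" where
  "scaled_source a f z = - (f z / a z)"

text \<open>Below, \<open>\<alpha>\<close> and \<open>\<phi>\<close> stand for the functions \<open>- ln a\<close>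
  and \<open>- f / a\<close>, and \<open>b\<close> is the base point.\<close>

definition N_mono :: "nat \<Rightarrow> nat \<Rightarrow> plane \<Rightarrow> complex" where
  "N_mono k l p = Complex (fst p) (snd p) ^ k * Complex (fst p) (- snd p) ^ l
                / (fact k * fact l)"

definition a_coeff ::
  "(plane \<Rightarrow> real) \<Rightarrow> plane \<Rightarrow> nat \<Rightarrow> nat \<Rightarrow> nat \<Rightarrow> nat \<Rightarrow> complex" where
  "a_coeff \<alpha> b k l m n =
     (of_nat m / (2 * of_nat k) + of_nat n / (2 * of_nat l)
        - of_nat (m * n) / of_nat (k * l))
     * of_nat (k choose m) * of_nat (l choose n) * cderiv (k - m) (l - n) \<alpha> b"

text \<open>Argument order: \<open>A_coeff \<alpha> b m n k l\<close> has lower indices \<open>m, n\<close> (with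
  \<open>m * n = 0\<close> in all intended uses) and upper indices \<open>k, l\<close>.\<close>

function A_coeff ::
  "(plane \<Rightarrow> real) \<Rightarrow> plane \<Rightarrow> nat \<Rightarrow> nat \<Rightarrow> nat \<Rightarrow> nat \<Rightarrow> complex" where
  "A_coeff \<alpha> b m n k l =
     (if k * l = 0 then (if k = m \<and> l = n then 1 else 0)
      else \<Sum>(i, j)\<in>{m..k} \<times> {n..l} - {(k, l)}.
             a_coeff \<alpha> b k l i j * A_coeff \<alpha> b m n i j)"
  by pat_completeness auto
termination
  by (relation "Wellfounded.measure (\<lambda>(\<alpha>, b, m, n, k, l). k + l)") auto

function F_coeff ::
  "(plane \<Rightarrow> real) \<Rightarrow> (plane \<Rightarrow> real) \<Rightarrow> plane \<Rightarrow> nat \<Rightarrow> nat \<Rightarrow> complex" where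
  "F_coeff \<alpha> \<phi> b k l =
     (if k * l = 0 then 0
      else (\<Sum>(i, j)\<in>{0..k} \<times> {0..l} - {(k, l)}.
              a_coeff \<alpha> b k l i j * F_coeff \<alpha> \<phi> b i j)
           + cderiv (k - 1) (l - 1) \<phi> b / 4)"
  by pat_completeness auto
termination
  by (relation "Wellfounded.measure (\<lambda>(\<alpha>, \<phi>, b, k, l). k + l)") auto

declare A_coeff.simps [simp del] F_coeff.simps [simp del]

text \<open>The index set below is \<open>{m..k - n}\<close> with the convention that it is empty
  if \<open>k < m + n\<close>, which truncated subtraction would not respect.\<close>

definition A_poly ::
  "(plane \<Rightarrow> real) \<Rightarrow> plane \<Rightarrow> nat \<Rightarrow> nat \<Rightarrow> nat \<Rightarrow> plane \<Rightarrow> complex" where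
  "A_poly \<alpha> b k m n p =
     (\<Sum>j | m \<le> j \<and> j + n \<le> k. N_mono j (k - j) p * A_coeff \<alpha> b m n j (k - j))"

definition F_poly ::
  "nat \<Rightarrow> (plane \<Rightarrow> real) \<Rightarrow> (plane \<Rightarrow> real) \<Rightarrow> plane \<Rightarrow> real \<Rightarrow> plane \<Rightarrow> complex" where
  "F_poly M \<alpha> \<phi> b h p =
     (\<Sum>(k, l)\<in>{(k, l). k + l \<le> M + 1}.
        N_mono k l p * F_coeff \<alpha> \<phi> b k l * of_real h ^ (k + l))"

definition stencil :: "plane set" where
  "stencil = ({-1..1} \<inter> \<int>) \<times> ({-1..1} \<inter> \<int>)"

text \<open>The equations with fixed \<open>j\<close> and \<open>0 \<le> m \<le> M + 1 - j\<close>.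
  The unknown \<open>c p j\<close> is only relevant for \<open>p \<in> stencil\<close> and \<open>j \<le> M + 1\<close>.\<close>

definition system_part ::
  "(plane \<Rightarrow> real) \<Rightarrow> plane \<Rightarrow> nat \<Rightarrow> nat \<Rightarrow> (plane \<Rightarrow> nat \<Rightarrow> real) \<Rightarrow> bool" where
  "system_part \<alpha> b M j c \<longleftrightarrow>
     (\<forall>m \<le> M + 1 - j.
        (\<Sum>p\<in>stencil. A_poly \<alpha> b m m 0 p * of_real (c p j))
        = - (\<Sum>k<j. \<Sum>p\<in>stencil. A_poly \<alpha> b (m + j - k) m 0 p * of_real (c p k)))"

definition full_system ::
  "(plane \<Rightarrow> real) \<Rightarrow> plane \<Rightarrow> nat \<Rightarrow> (plane \<Rightarrow> nat \<Rightarrow> real) \<Rightarrow> bool" where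
  "full_system \<alpha> b M c \<longleftrightarrow> (\<forall>j \<le> M + 1. system_part \<alpha> b M j c)"

definition scheme_coeff :: "nat \<Rightarrow> (plane \<Rightarrow> nat \<Rightarrow> real) \<Rightarrow> plane \<Rightarrow> real \<Rightarrow> real" where
  "scheme_coeff M c p h = (\<Sum>j\<le>M + 1. c p j * h ^ j)"

end

theory Submission
  imports Defs
begin

text \<open>Identify the stencil point \<open>p\<close> with a complex number \<open>z\<close>. For \<open>j = 0\<close> the system says that the
  moments \<open>\<Sum> c\<^sub>p z\<^sup>m\<close>, \<open>m \<le> M + 1\<close>, vanish. For \<open>M \<ge> 7\<close> the Vandermonde matrix of the nine points
  forces \<open>c = 0\<close>; for \<open>M \<le> 6\<close> the weights \<open>20, -4, -1\<close> solve the system. For \<open>j \<ge> 1\<close> the moments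
  \<open>s\<^sub>m\<close> are prescribed. On the stencil those with \<open>m = 1, 2, 3\<close> can be chosen freely, \<open>s\<^sub>4\<close> must be
  real, \<open>s\<^sub>5 = (-2 s\<^sub>1 + 5 cnj s\<^sub>3) / 3\<close>, and \<open>s\<^sub>6\<close> is a function of \<open>s\<^sub>2\<close>. These compatibility
  conditions hold: as long as no multiples of the weights \<open>20, -4, -1\<close> are added, the \<open>j\<close>-th solution,
  \<open>j \<le> 2\<close>, has parity \<open>j\<close> under \<open>p \<mapsto> -p\<close>, and the remaining nonzero moments are computed explicitly.
  Adding large multiples of the weights \<open>20, -4, -1\<close> afterwards yields the signs. Finally, the
  differential equation expresses all derivatives of \<open>u\<close> by the derivatives
  \<open>(m, 0)\<close>, \<open>(0, n)\<close> and the source, so in the Taylor expansion of the scheme the system makes the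
  coefficient of every such derivative of \<open>u\<close> of order \<open>h\<^sup>8\<close>.\<close>

section \<open>Derivatives of functions on the plane\<close>

text \<open>On the nonzero stencil points \<open>z ^ 4\<close> is real, and it is the fourth power
  of the modulus up to a sign. Hence the moments up to order 7 amount to only eight real functionals
  on the nine weights; their kernel is the line through the weights 20, -4, -1, and
  \<open>z ^ 8\<close> is the first power to break it. The same loss of rank is the obstacle for
  \<open>j \<ge> 1\<close>: more moments are prescribed than can be chosen, but only for
  \<open>j \<le> 3\<close>, since from \<open>j = 4\<close> on only \<open>m \<le> 3\<close> occurs.
  The bounds for \<open>\<alpha>\<close> and \<open>u\<close> start at order one, so the values of
  both have to drop out exactly and not just up to a small error: the weight of
  \<open>\<alpha>\<close> itself in \<open>a_coeff\<close> is zero, and the coefficient of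
  \<open>u\<close> at the base point is the sum of the weights, which the equations with
  \<open>m = 0\<close> annihilate. The system mentions the derivatives \<open>(m, 0)\<close> only.
  Since \<open>\<alpha>\<close> and the weights are real, conjugation carries the estimates over to
  \<open>(0, n)\<close>.\<close>

abbreviation has_px :: "(plane \<Rightarrow> 'v::real_normed_vector) \<Rightarrow> 'v \<Rightarrow> plane \<Rightarrow> bool" where
  "has_px v d z \<equiv> ((\<lambda>t. v (t, snd z)) has_vector_derivative d) (at (fst z))"

abbreviation has_py :: "(plane \<Rightarrow> 'v::real_normed_vector) \<Rightarrow> 'v \<Rightarrow> plane \<Rightarrow> bool" where
  "has_py v d z \<equiv> ((\<lambda>t. v (fst z, t)) has_vector_derivative d) (at (snd z))"

lemma partial_x_eqI: "has_px v d z \<Longrightarrow> partial_x v z = d"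
  unfolding partial_x_def by (rule vector_derivative_at)

lemma partial_y_eqI: "has_py v d z \<Longrightarrow> partial_y v z = d"
  unfolding partial_y_def by (rule vector_derivative_at)

text \<open>Schwarz's theorem for iterated one-variable derivatives. The second difference over a
  small square, evaluated by the mean value theorem in either order, is \<open>h * h\<close> times a
  value of \<open>fxy\<close> and also \<open>h * h\<close> times a value of \<open>fyx\<close>;
  continuity at \<open>z\<close> compares both values with those at \<open>z\<close>.\<close>

lemma mixed_partials_commute_real:
  fixes f :: "plane \<Rightarrow> real"
  assumes "open \<Omega>" "z \<in> \<Omega>"
    and fx: "\<And>w. w \<in> \<Omega> \<Longrightarrow> has_px f (fx w) w"
    and fy: "\<And>w. w \<in> \<Omega> \<Longrightarrow> has_py f (fy w) w"
    and fxy: "\<And>w. w \<in> \<Omega> \<Longrightarrow> has_py fx (fxy w) w"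
    and fyx: "\<And>w. w \<in> \<Omega> \<Longrightarrow> has_px fy (fyx w) w"
    and cont: "continuous_on \<Omega> fxy" "continuous_on \<Omega> fyx"
  shows "fxy z = fyx z"
proof -
  have *: "\<bar>fxy z - fyx z\<bar> \<le> 2 * e" if e: "e > 0" for e
  proof -
    obtain x y where z: "z = (x, y)" by (cases z)
    have "(fxy \<longlongrightarrow> fxy z) (nhds z)" "(fyx \<longlongrightarrow> fyx z) (nhds z)"
      using cont assms(1,2)
      by (auto simp: continuous_on_eq_continuous_at isCont_def tendsto_at_iff_tendsto_nhds)
    then have "\<forall>\<^sub>F w in nhds z. \<bar>fxy w - fxy z\<bar> < e \<and> \<bar>fyx w - fyx z\<bar> < e \<and> w \<in> \<Omega>"
      using e eventually_nhds_in_open[OF assms(1,2)]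
      by (intro eventually_conj)
         (auto simp: tendsto_iff dist_real_def)
    then obtain d where d: "d > 0"
      and near: "\<And>w. dist w z < d \<Longrightarrow> \<bar>fxy w - fxy z\<bar> < e \<and> \<bar>fyx w - fyx z\<bar> < e \<and> w \<in> \<Omega>"
      unfolding eventually_nhds_metric by auto
    \<comment> \<open>The offsets in the square have sum norm at most \<open>2 * h\<close>, which is
      below \<open>d\<close>.\<close>
    define h where "h = d / 3"
    have h: "h > 0" using d by (simp add: h_def)
    have box: "\<bar>fxy (s, t) - fxy z\<bar> < e \<and> \<bar>fyx (s, t) - fyx z\<bar> < e \<and> (s, t) \<in> \<Omega>"
      if "x \<le> s" "s \<le> x + h" "y \<le> t" "t \<le> y + h" for s t
    proof (rule near)
      have "dist (s, t) z \<le> \<bar>s - x\<bar> + \<bar>t - y\<bar>"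
        using sqrt_sum_squares_le_sum_abs[of "s - x" "t - y"]
        by (simp add: z dist_Pair_Pair dist_real_def)
      also have "\<dots> \<le> h + h" using that by auto
      also have "\<dots> < d" using d by (simp add: h_def)
      finally show "dist (s, t) z < d" .
    qed
    define \<Delta> where "\<Delta> = f (x + h, y + h) - f (x + h, y) - f (x, y + h) + f (x, y)"
    have "\<exists>\<xi>>x. \<xi> < x + h \<and>
        (f (x + h, y + h) - f (x + h, y)) - (f (x, y + h) - f (x, y))
          = (x + h - x) * (fx (\<xi>, y + h) - fx (\<xi>, y))"
    proof (rule MVT2)
      fix s assume s: "x \<le> s" "s \<le> x + h"
      show "((\<lambda>s. f (s, y + h) - f (s, y)) has_real_derivative fx (s, y + h) - fx (s, y)) (at s)"
        using fx[of "(s, y + h)"] fx[of "(s, y)"] box[of s "y+h"] box[of s y] s h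
        by (auto simp: has_real_derivative_iff_has_vector_derivative intro!: derivative_intros)
    qed (use h in auto)
    then obtain \<xi> where \<xi>: "x < \<xi>" "\<xi> < x + h" "\<Delta> = h * (fx (\<xi>, y + h) - fx (\<xi>, y))"
      by (auto simp: \<Delta>_def algebra_simps)
    have "\<exists>\<eta>>y. \<eta> < y + h \<and> fx (\<xi>, y + h) - fx (\<xi>, y) = (y + h - y) * fxy (\<xi>, \<eta>)"
    proof (rule MVT2)
      fix t assume t: "y \<le> t" "t \<le> y + h"
      show "((\<lambda>t. fx (\<xi>, t)) has_real_derivative fxy (\<xi>, t)) (at t)"
        using fxy[of "(\<xi>, t)"] box[of \<xi> t] t \<xi>
        by (auto simp: has_real_derivative_iff_has_vector_derivative)
    qed (use h in auto)
    then obtain \<eta> where \<eta>: "y < \<eta>" "\<eta> < y + h" "\<Delta> = h * (h * fxy (\<xi>, \<eta>))"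
      using \<xi> by auto
    have "\<exists>\<eta>>y. \<eta> < y + h \<and>
        (f (x + h, y + h) - f (x, y + h)) - (f (x + h, y) - f (x, y))
          = (y + h - y) * (fy (x + h, \<eta>) - fy (x, \<eta>))"
    proof (rule MVT2)
      fix t assume t: "y \<le> t" "t \<le> y + h"
      show "((\<lambda>t. f (x + h, t) - f (x, t)) has_real_derivative fy (x + h, t) - fy (x, t)) (at t)"
        using fy[of "(x + h, t)"] fy[of "(x, t)"] box[of "x + h" t] box[of x t] t h
        by (auto simp: has_real_derivative_iff_has_vector_derivative intro!: derivative_intros)
    qed (use h in auto)
    then obtain \<eta>' where \<eta>': "y < \<eta>'" "\<eta>' < y + h" "\<Delta> = h * (fy (x + h, \<eta>') - fy (x, \<eta>'))"
      by (auto simp: \<Delta>_def algebra_simps)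
    have "\<exists>\<xi>'>x. \<xi>' < x + h \<and> fy (x + h, \<eta>') - fy (x, \<eta>') = (x + h - x) * fyx (\<xi>', \<eta>')"
    proof (rule MVT2)
      fix s assume s: "x \<le> s" "s \<le> x + h"
      show "((\<lambda>s. fy (s, \<eta>')) has_real_derivative fyx (s, \<eta>')) (at s)"
        using fyx[of "(s, \<eta>')"] box[of s \<eta>'] s \<eta>'
        by (auto simp: has_real_derivative_iff_has_vector_derivative)
    qed (use h in auto)
    then obtain \<xi>' where \<xi>': "x < \<xi>'" "\<xi>' < x + h" "\<Delta> = h * (h * fyx (\<xi>', \<eta>'))"
      using \<eta>' by auto
    have "fxy (\<xi>, \<eta>) = fyx (\<xi>', \<eta>')" using \<eta>(3) \<xi>'(3) h by simp
    moreover have "\<bar>fxy (\<xi>, \<eta>) - fxy z\<bar> < e" using box[of \<xi> \<eta>] \<xi> \<eta> by auto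
    moreover have "\<bar>fyx (\<xi>', \<eta>') - fyx z\<bar> < e" using box[of \<xi>' \<eta>'] \<xi>' \<eta>' by auto
    ultimately show ?thesis by linarith
  qed
  show ?thesis
  proof (rule ccontr)
    assume "fxy z \<noteq> fyx z"
    with *[of "\<bar>fxy z - fyx z\<bar> / 4"] show False by auto
  qed
qed

section \<open>Continuously differentiable functions on an open set\<close>

locale open_plane =
  fixes \<Omega> :: "plane set"
  assumes open_dom: "open \<Omega>"
begin

text \<open>Boundedness is left out because \<open>- ln a\<close> and \<open>- f / a\<close> need
  not inherit it: \<open>a\<close> is positive but may tend to zero at the boundary. Complex values
  allow the Wirtinger operators to be iterated.\<close>

fun Ck :: "nat \<Rightarrow> (plane \<Rightarrow> complex) \<Rightarrow> bool" where
  "Ck 0 v \<longleftrightarrow> continuous_on \<Omega> v"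
| "Ck (Suc n) v \<longleftrightarrow>
     continuous_on \<Omega> v \<and>
     (\<forall>z\<in>\<Omega>. has_px v (partial_x v z) z \<and> has_py v (partial_y v z) z) \<and>
     Ck n (partial_x v) \<and> Ck n (partial_y v)"

lemma has_px_cong:
  assumes "\<And>w. w \<in> \<Omega> \<Longrightarrow> f w = g w" "z \<in> \<Omega>" "has_px f d z"
  shows "has_px g d z"
proof (rule has_vector_derivative_transform_within_open[OF assms(3)])
  show "open ((\<lambda>t. (t, snd z)) -` \<Omega>)"
    by (rule open_vimage[OF open_dom]) (auto intro!: continuous_intros)
qed (use assms in auto)

lemma has_py_cong:
  assumes "\<And>w. w \<in> \<Omega> \<Longrightarrow> f w = g w" "z \<in> \<Omega>" "has_py f d z"
  shows "has_py g d z"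
proof (rule has_vector_derivative_transform_within_open[OF assms(3)])
  show "open ((\<lambda>t. (fst z, t)) -` \<Omega>)"
    by (rule open_vimage[OF open_dom]) (auto intro!: continuous_intros)
qed (use assms in auto)

lemma partial_x_cong:
  assumes "\<And>w. w \<in> \<Omega> \<Longrightarrow> f w = g w" "z \<in> \<Omega>"
  shows "partial_x f z = partial_x g z"
proof -
  have "has_px f d z \<longleftrightarrow> has_px g d z" for d
    using has_px_cong[of f g z d] has_px_cong[of g f z d] assms by auto
  then show ?thesis unfolding partial_x_def vector_derivative_def by simp
qed

lemma partial_y_cong:
  assumes "\<And>w. w \<in> \<Omega> \<Longrightarrow> f w = g w" "z \<in> \<Omega>"
  shows "partial_y f z = partial_y g z"
proof -
  have "has_py f d z \<longleftrightarrow> has_py g d z" for d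
    using has_py_cong[of f g z d] has_py_cong[of g f z d] assms by auto
  then show ?thesis unfolding partial_y_def vector_derivative_def by simp
qed

text \<open>Outside the domain the partial derivatives are arbitrary values, so at every order
  agreement on the domain has to suffice. Openness keeps nearby points of each coordinate line
  inside.\<close>

lemma Ck_cong:
  assumes "Ck n f" "\<And>w. w \<in> \<Omega> \<Longrightarrow> f w = g w"
  shows "Ck n g"
  using assms
proof (induction n arbitrary: f g)
  case 0
  then show ?case using continuous_on_cong[of \<Omega> \<Omega> f g] by auto
next
  case (Suc n)
  have x: "partial_x f z = partial_x g z" and y: "partial_y f z = partial_y g z" if "z \<in> \<Omega>" for z
    using partial_x_cong[OF Suc.prems(2) that] partial_y_cong[OF Suc.prems(2) that] by auto
  have "has_px g (partial_x g z) z" if z: "z \<in> \<Omega>" for z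
    by (rule has_px_cong[where f = f, OF Suc.prems(2) z]) (use x[OF z] Suc.prems(1) z in auto)
  moreover have "has_py g (partial_y g z) z" if z: "z \<in> \<Omega>" for z
    by (rule has_py_cong[where f = f, OF Suc.prems(2) z]) (use y[OF z] Suc.prems(1) z in auto)
  moreover have "continuous_on \<Omega> g"
    using Suc.prems continuous_on_cong[of \<Omega> \<Omega> f g] by auto
  moreover have "Ck n (partial_x g)"
    by (rule Suc.IH[of "partial_x f"]) (use Suc.prems x in auto)
  moreover have "Ck n (partial_y g)"
    by (rule Suc.IH[of "partial_y f"]) (use Suc.prems y in auto)
  ultimately show ?case by auto
qed

lemma Ck_SucI:
  assumes "continuous_on \<Omega> v"
    and "\<And>z. z \<in> \<Omega> \<Longrightarrow> has_px v (f z) z" "\<And>z. z \<in> \<Omega> \<Longrightarrow> has_py v (g z) z"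
    and "Ck n f" "Ck n g"
  shows "Ck (Suc n) v"
proof -
  have x: "partial_x v z = f z" and y: "partial_y v z = g z" if "z \<in> \<Omega>" for z
    using assms(2,3)[OF that] by (simp_all add: partial_x_eqI partial_y_eqI)
  have "Ck n (partial_x v)" by (rule Ck_cong[OF assms(4)]) (simp add: x)
  moreover have "Ck n (partial_y v)" by (rule Ck_cong[OF assms(5)]) (simp add: y)
  ultimately show ?thesis using assms x y by auto
qed

lemma Ck_continuous: "Ck n v \<Longrightarrow> continuous_on \<Omega> v"
  by (cases n) auto

lemma Ck_px: "Ck (Suc n) v \<Longrightarrow> z \<in> \<Omega> \<Longrightarrow> has_px v (partial_x v z) z"
  and Ck_py: "Ck (Suc n) v \<Longrightarrow> z \<in> \<Omega> \<Longrightarrow> has_py v (partial_y v z) z"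
  by auto

lemma Ck_SucD: "Ck (Suc n) v \<Longrightarrow> Ck n v"
proof (induction n arbitrary: v)
  case (Suc n)
  then show ?case by (metis Ck.simps(2))
qed auto

lemma Ck_mono: "Ck m v \<Longrightarrow> n \<le> m \<Longrightarrow> Ck n v"
  by (induction m) (auto simp: le_Suc_eq simp del: Ck.simps dest: Ck_SucD)

lemma Ck_const: "Ck n (\<lambda>_. c)"
proof (induction n arbitrary: c)
  case (Suc n)
  show ?case by (rule Ck_SucI[of _ "\<lambda>_. 0" "\<lambda>_. 0"]) (auto simp: Suc)
qed auto

lemma Ck_add: "Ck n f \<Longrightarrow> Ck n g \<Longrightarrow> Ck n (\<lambda>z. f z + g z)"
proof (induction n arbitrary: f g)
  case (Suc n)
  show ?case
    by (rule Ck_SucI[of _ "\<lambda>z. partial_x f z + partial_x g z" "\<lambda>z. partial_y f z + partial_y g z"])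
      (use Suc in \<open>auto intro!: continuous_intros derivative_intros Suc.IH\<close>)
qed (auto intro!: continuous_intros)

lemma Ck_mult: "Ck n f \<Longrightarrow> Ck n g \<Longrightarrow> Ck n (\<lambda>z. f z * g z)"
proof (induction n arbitrary: f g)
  case (Suc n)
  have fg: "Ck n f" "Ck n g" using Suc.prems by (blast intro: Ck_SucD)+
  have "continuous_on \<Omega> (\<lambda>z. f z * g z)"
    using Suc.prems by (auto intro!: continuous_intros)
  then show ?case
  proof (rule Ck_SucI)
    show "has_px (\<lambda>z. f z * g z) (f z * partial_x g z + partial_x f z * g z) z" if "z \<in> \<Omega>" for z
      using has_vector_derivative_mult[OF Ck_px[OF Suc.prems(1) that] Ck_px[OF Suc.prems(2) that]] by simp
    show "has_py (\<lambda>z. f z * g z) (f z * partial_y g z + partial_y f z * g z) z" if "z \<in> \<Omega>" for z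
      using has_vector_derivative_mult[OF Ck_py[OF Suc.prems(1) that] Ck_py[OF Suc.prems(2) that]] by simp
  qed (use Suc.prems fg in \<open>simp_all add: Suc.IH Ck_add\<close>)
qed (auto intro!: continuous_intros)

lemma Ck_uminus: "Ck n f \<Longrightarrow> Ck n (\<lambda>z. - f z)"
  using Ck_mult[of n "\<lambda>_. -1" f] Ck_const by auto

lemma Ck_sum: "(\<And>i. i \<in> I \<Longrightarrow> Ck n (f i)) \<Longrightarrow> Ck n (\<lambda>z. \<Sum>i\<in>I. f i z)"
  by (induction I rule: infinite_finite_induct) (auto intro: Ck_const Ck_add)

text \<open>The derivative of \<open>1 / f\<close> contains \<open>1 / f\<close> again, but it is
  needed there only with one order less, so the induction closes.\<close>

lemma Ck_inverse:
  assumes "Ck n f" "\<And>z. z \<in> \<Omega> \<Longrightarrow> f z \<noteq> 0"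
  shows "Ck n (\<lambda>z. inverse (f z))"
  using assms
proof (induction n)
  case (Suc n)
  have d: "(inverse has_field_derivative - (inverse x * inverse x)) (at x)" if "x \<noteq> 0" for x :: complex
    using DERIV_inverse[OF that, of UNIV] by (simp add: power2_eq_square numeral_2_eq_2)
  have inv: "Ck n (\<lambda>z. inverse (f z))" by (rule Suc.IH[OF Ck_SucD[OF Suc.prems(1)] Suc.prems(2)])
  have c: "continuous_on \<Omega> f" using Suc(2) by simp
  have x: "((\<lambda>t. inverse (f (t, snd z))) has_vector_derivative
            - (partial_x f z * (inverse (f z) * inverse (f z)))) (at (fst z))" if "z \<in> \<Omega>" for z
    using field_vector_diff_chain_at[OF Ck_px[OF Suc(2) that], of inverse, unfolded prod.collapse, OF d]
      Suc.prems(2)[OF that] by (simp add: o_def)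
  have y: "((\<lambda>t. inverse (f (fst z, t))) has_vector_derivative
            - (partial_y f z * (inverse (f z) * inverse (f z)))) (at (snd z))" if "z \<in> \<Omega>" for z
    using field_vector_diff_chain_at[OF Ck_py[OF Suc(2) that], of inverse, unfolded prod.collapse, OF d]
      Suc.prems(2)[OF that] by (simp add: o_def)
  show ?case
    by (rule Ck_SucI[OF _ x y]) (use Suc.prems(2) c in \<open>auto intro!: continuous_intros Ck_mult Ck_uminus inv Suc.prems(1)[THEN Ck.simps(2)[THEN iffD1], THEN conjunct2, THEN conjunct2, THEN conjunct1] Suc.prems(1)[THEN Ck.simps(2)[THEN iffD1], THEN conjunct2, THEN conjunct2, THEN conjunct2]\<close>)
qed (auto intro!: continuous_intros)

lemma has_vector_derivative_of_real_iff:
  "((\<lambda>t. complex_of_real (f t)) has_vector_derivative of_real d) F \<longleftrightarrow> (f has_vector_derivative d) F"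
proof
  assume "((\<lambda>t. complex_of_real (f t)) has_vector_derivative of_real d) F"
  from bounded_linear.has_vector_derivative[OF bounded_linear_Re this]
  show "(f has_vector_derivative d) F" by simp
qed (simp add: has_vector_derivative_of_real has_real_derivative_iff_has_vector_derivative)

lemma Ck_bounded_has_px: "Ck_bounded (Suc n) \<Omega> v \<Longrightarrow> z \<in> \<Omega> \<Longrightarrow> has_px v (partial_x v z) z"
  and Ck_bounded_has_py: "Ck_bounded (Suc n) \<Omega> v \<Longrightarrow> z \<in> \<Omega> \<Longrightarrow> has_py v (partial_y v z) z"
  by (auto simp: partial_x_def partial_y_def vector_derivative_works)

lemma Ck_bounded_imp_Ck: "Ck_bounded n \<Omega> v \<Longrightarrow> Ck n (\<lambda>z. of_real (v z))"
proof (induction n arbitrary: v)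
  case (Suc n)
  show ?case
    by (rule Ck_SucI[of _ "\<lambda>z. of_real (partial_x v z)" "\<lambda>z. of_real (partial_y v z)"])
      (use Suc in \<open>auto intro!: continuous_intros has_vector_derivative_of_real_iff[THEN iffD2]
         Ck_bounded_has_px[OF Suc.prems] Ck_bounded_has_py[OF Suc.prems]\<close>)
qed (auto intro!: continuous_intros)

lemma Ck_of_real_partial:
  assumes "Ck (Suc n) (\<lambda>z. of_real (v z))" "z \<in> \<Omega>"
  shows "has_px v (partial_x v z) z" "has_py v (partial_y v z) z"
    "partial_x (\<lambda>z. complex_of_real (v z)) z = of_real (partial_x v z)"
    "partial_y (\<lambda>z. complex_of_real (v z)) z = of_real (partial_y v z)"
proof -
  have x: "has_px v (Re (partial_x (\<lambda>z. complex_of_real (v z)) z)) z"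
    using bounded_linear.has_vector_derivative[OF bounded_linear_Re Ck_px[OF assms]] by simp
  have y: "has_py v (Re (partial_y (\<lambda>z. complex_of_real (v z)) z)) z"
    using bounded_linear.has_vector_derivative[OF bounded_linear_Re Ck_py[OF assms]] by simp
  show X: "has_px v (partial_x v z) z" using x partial_x_eqI[OF x] by simp
  show Y: "has_py v (partial_y v z) z" using y partial_y_eqI[OF y] by simp
  show "partial_x (\<lambda>z. complex_of_real (v z)) z = of_real (partial_x v z)"
    using X by (intro partial_x_eqI has_vector_derivative_of_real_iff[THEN iffD2])
  show "partial_y (\<lambda>z. complex_of_real (v z)) z = of_real (partial_y v z)"
    using Y by (intro partial_y_eqI has_vector_derivative_of_real_iff[THEN iffD2])
qed

lemma Ck_partial_of_real:
  assumes "Ck (Suc n) (\<lambda>z. of_real (v z))"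
  shows "Ck n (\<lambda>z. of_real (partial_x v z))" "Ck n (\<lambda>z. of_real (partial_y v z))"
  using assms Ck_of_real_partial(3,4)[OF assms]
  by (auto intro: Ck_cong[of n "partial_x (\<lambda>z. complex_of_real (v z))"]
      Ck_cong[of n "partial_y (\<lambda>z. complex_of_real (v z))"])

text \<open>The mean value theorem is real, so the real version is applied to \<open>Re\<close> and
  \<open>Im\<close> separately.\<close>

lemma mixed_partials_commute:
  assumes "Ck 2 f" "z \<in> \<Omega>"
  shows "partial_x (partial_y f) z = partial_y (partial_x f) z"
proof -
  have f: "Ck (Suc 1) f" using assms(1) by (simp add: numeral_2_eq_2)
  then have fx: "Ck (Suc 0) (partial_x f)" and fy: "Ck (Suc 0) (partial_y f)" by auto
  have comm: "g (partial_y (partial_x f) z) = g (partial_x (partial_y f) z)"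
    if g: "bounded_linear g" for g :: "complex \<Rightarrow> real"
  proof (rule mixed_partials_commute_real[OF open_dom assms(2),
        of "\<lambda>w. g (f w)" "\<lambda>w. g (partial_x f w)" "\<lambda>w. g (partial_y f w)"
           "\<lambda>w. g (partial_y (partial_x f) w)" "\<lambda>w. g (partial_x (partial_y f) w)"])
    show "continuous_on \<Omega> (\<lambda>w. g (partial_y (partial_x f) w))"
      "continuous_on \<Omega> (\<lambda>w. g (partial_x (partial_y f) w))"
      using fx fy by (auto intro!: bounded_linear.continuous_on[OF g])
  qed (rule bounded_linear.has_vector_derivative[OF g Ck_px[OF f]]
        bounded_linear.has_vector_derivative[OF g Ck_py[OF f]]
        bounded_linear.has_vector_derivative[OF g Ck_py[OF fx]]
        bounded_linear.has_vector_derivative[OF g Ck_px[OF fy]], assumption)+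
  show ?thesis
    using comm[OF bounded_linear_Re] comm[OF bounded_linear_Im] by (simp add: complex_eq_iff)
qed

end

section \<open>First-order operators with constant coefficients\<close>

definition ddir :: "complex \<Rightarrow> complex \<Rightarrow> (plane \<Rightarrow> complex) \<Rightarrow> plane \<Rightarrow> complex" where
  "ddir c e f z = c * partial_x f z + e * partial_y f z"

text \<open>One operator covers the partial derivatives, both Wirtinger operators and the derivative
  in a stencil direction; product rule, commutation and bounds are thus proved once for all of
  them.\<close>

lemma ddir_1_0: "ddir 1 0 = partial_x" and ddir_0_1: "ddir 0 1 = partial_y"
  by (auto simp: ddir_def fun_eq_iff)

text \<open>Pascal's rule in summed form: the common induction step of the Leibniz rule and of the
  binomial theorem for operators.\<close>

lemma sum_Pascal:
  fixes F :: "nat \<Rightarrow> nat \<Rightarrow> 'a::comm_semiring_1"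
  shows "(\<Sum>k\<le>Suc n. of_nat (Suc n choose k) * F k (Suc n - k))
    = (\<Sum>k\<le>n. of_nat (n choose k) * (F (Suc k) (n - k) + F k (Suc (n - k))))"
proof -
  have "(\<Sum>k\<le>Suc n. of_nat (Suc n choose k) * F k (Suc n - k))
    = F 0 (Suc n) + (\<Sum>k\<le>n. (of_nat (n choose k) + of_nat (n choose Suc k)) * F (Suc k) (n - k))"
    by (simp only: sum.atMost_Suc_shift) simp
  also have "\<dots> = (\<Sum>k\<le>n. of_nat (n choose k) * F (Suc k) (n - k))
      + (F 0 (Suc n) + (\<Sum>k\<le>n. of_nat (n choose Suc k) * F (Suc k) (n - k)))"
    by (simp add: algebra_simps sum.distrib)
  also have "F 0 (Suc n) + (\<Sum>k\<le>n. of_nat (n choose Suc k) * F (Suc k) (n - k))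
      = (\<Sum>k\<le>Suc n. of_nat (n choose k) * F k (Suc n - k))"
    by (simp only: sum.atMost_Suc_shift) simp
  also have "\<dots> = (\<Sum>k\<le>n. of_nat (n choose k) * F k (Suc n - k))" by (simp add: binomial_eq_0)
  also have "\<dots> = (\<Sum>k\<le>n. of_nat (n choose k) * F k (Suc (n - k)))"
    by (intro sum.cong) (auto simp: Suc_diff_le)
  finally show ?thesis by (simp add: algebra_simps sum.distrib)
qed

context open_plane
begin

lemma Ck_ddir: "Ck (Suc n) f \<Longrightarrow> Ck n (ddir c e f)"
  unfolding ddir_def by (intro Ck_add Ck_mult Ck_const) auto

lemma Ck_ddir_funpow: "Ck (n + k) f \<Longrightarrow> Ck n ((ddir c e ^^ k) f)"
  by (induction k arbitrary: n) (auto intro: Ck_ddir simp del: Ck.simps)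

lemma Ck_ddir_funpow_le: "Ck m f \<Longrightarrow> n + k \<le> m \<Longrightarrow> Ck n ((ddir c e ^^ k) f)"
  using Ck_ddir_funpow Ck_mono by blast

lemma ddir_cong: "(\<And>w. w \<in> \<Omega> \<Longrightarrow> f w = g w) \<Longrightarrow> z \<in> \<Omega> \<Longrightarrow> ddir c e f z = ddir c e g z"
  unfolding ddir_def using partial_x_cong[of f g z] partial_y_cong[of f g z] by simp

lemma ddir_funpow_cong:
  "(\<And>w. w \<in> \<Omega> \<Longrightarrow> f w = g w) \<Longrightarrow> z \<in> \<Omega> \<Longrightarrow> (ddir c e ^^ k) f z = (ddir c e ^^ k) g z"
  by (induction k arbitrary: z) (auto intro: ddir_cong)

lemma ddir_add:
  assumes "Ck (Suc n) f" "Ck (Suc n) g" "z \<in> \<Omega>"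
  shows "ddir c e (\<lambda>z. f z + g z) z = ddir c e f z + ddir c e g z"
  using partial_x_eqI[OF has_vector_derivative_add[OF Ck_px Ck_px], OF assms(1,3,2,3)]
    partial_y_eqI[OF has_vector_derivative_add[OF Ck_py Ck_py], OF assms(1,3,2,3)]
  by (simp add: ddir_def algebra_simps)

lemma ddir_mult:
  assumes "Ck (Suc n) f" "Ck (Suc n) g" "z \<in> \<Omega>"
  shows "ddir c e (\<lambda>z. f z * g z) z = ddir c e f z * g z + f z * ddir c e g z"
proof -
  have "partial_x (\<lambda>z. f z * g z) z = f z * partial_x g z + partial_x f z * g z"
    using has_vector_derivative_mult[OF Ck_px[OF assms(1,3)] Ck_px[OF assms(2,3)]]
    by (intro partial_x_eqI) simp
  moreover have "partial_y (\<lambda>z. f z * g z) z = f z * partial_y g z + partial_y f z * g z"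
    using has_vector_derivative_mult[OF Ck_py[OF assms(1,3)] Ck_py[OF assms(2,3)]]
    by (intro partial_y_eqI) simp
  ultimately show ?thesis by (simp add: ddir_def algebra_simps)
qed

lemma ddir_const: "ddir c e (\<lambda>_. k) z = 0"
  by (simp add: ddir_def partial_x_def partial_y_def)

lemma ddir_cmult:
  assumes "Ck (Suc n) f" "z \<in> \<Omega>"
  shows "ddir c e (\<lambda>z. k * f z) z = k * ddir c e f z"
  using ddir_mult[OF Ck_const assms] by (simp add: ddir_const)

lemma ddir_sum:
  assumes "\<And>i. i \<in> I \<Longrightarrow> Ck (Suc n) (f i)" "z \<in> \<Omega>"
  shows "ddir c e (\<lambda>z. \<Sum>i\<in>I. f i z) z = (\<Sum>i\<in>I. ddir c e (f i) z)"
  using assms(1)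
proof (induction I rule: infinite_finite_induct)
  case (insert i I)
  have "ddir c e (\<lambda>z. f i z + (\<Sum>i\<in>I. f i z)) z = ddir c e (f i) z + ddir c e (\<lambda>z. \<Sum>i\<in>I. f i z) z"
    by (rule ddir_add[where n = n]) (use insert.prems assms(2) in \<open>auto intro: Ck_sum simp del: Ck.simps\<close>)
  with insert show ?case by simp
qed (auto simp: ddir_const)

lemma ddir_funpow_sum:
  assumes "\<And>i. i \<in> I \<Longrightarrow> Ck n (f i)" "z \<in> \<Omega>"
  shows "(ddir c e ^^ n) (\<lambda>z. \<Sum>i\<in>I. k i * f i z) z = (\<Sum>i\<in>I. k i * (ddir c e ^^ n) (f i) z)"
  using assms
proof (induction n arbitrary: z)
  case (Suc n)
  have "(ddir c e ^^ Suc n) (\<lambda>z. \<Sum>i\<in>I. k i * f i z) z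
      = ddir c e (\<lambda>z. \<Sum>i\<in>I. k i * (ddir c e ^^ n) (f i) z) z"
    unfolding funpow.simps o_def using Suc by (intro ddir_cong Suc.IH) (auto intro: Ck_SucD simp del: Ck.simps)
  also have "\<dots> = (\<Sum>i\<in>I. ddir c e (\<lambda>z. k i * (ddir c e ^^ n) (f i) z) z)"
    using Suc.prems by (intro ddir_sum[where n = 0] Ck_mult Ck_const Ck_ddir_funpow) (auto simp del: Ck.simps)
  also have "\<dots> = (\<Sum>i\<in>I. k i * ddir c e ((ddir c e ^^ n) (f i)) z)"
    using Suc.prems by (intro sum.cong refl ddir_cmult[where n = 0] Ck_ddir_funpow) (auto simp del: Ck.simps)
  finally show ?case by simp
qed auto

lemma ddir_commute:
  assumes "Ck 2 f" "z \<in> \<Omega>"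
  shows "ddir c e (ddir c' e' f) z = ddir c' e' (ddir c e f) z"
proof -
  have f: "Ck (Suc 0) (partial_x f)" "Ck (Suc 0) (partial_y f)"
    using assms(1) by (auto simp: numeral_2_eq_2)
  have "ddir c e (ddir c' e' f) z
      = c * (c' * partial_x (partial_x f) z + e' * partial_x (partial_y f) z)
        + e * (c' * partial_y (partial_x f) z + e' * partial_y (partial_y f) z)" for c e c' e'
  proof -
    have f': "Ck (Suc 0) (\<lambda>z. c' * partial_x f z)" "Ck (Suc 0) (\<lambda>z. e' * partial_y f z)"
      using f Ck_mult Ck_const by blast+
    have "ddir c e (ddir c' e' f) z
        = ddir c e (\<lambda>z. c' * partial_x f z + e' * partial_y f z) z"
      by (simp add: ddir_def[abs_def])
    also have "\<dots> = c' * ddir c e (partial_x f) z + e' * ddir c e (partial_y f) z"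
      by (simp only: ddir_add[OF f' assms(2)] ddir_cmult[OF f(1) assms(2)] ddir_cmult[OF f(2) assms(2)])
    finally show ?thesis by (simp add: ddir_def algebra_simps)
  qed
  then show ?thesis using mixed_partials_commute[OF assms] by (simp add: algebra_simps)
qed

lemma ddir_funpow_commute:
  assumes "Ck (Suc k) f" "z \<in> \<Omega>"
  shows "ddir c e ((ddir c' e' ^^ k) f) z = (ddir c' e' ^^ k) (ddir c e f) z"
  using assms
proof (induction k arbitrary: z)
  case (Suc k)
  have "ddir c e ((ddir c' e' ^^ Suc k) f) z = ddir c' e' (ddir c e ((ddir c' e' ^^ k) f)) z"
    using Suc.prems by (auto intro!: ddir_commute Ck_ddir_funpow simp del: Ck.simps)
  also have "\<dots> = ddir c' e' ((ddir c' e' ^^ k) (ddir c e f)) z"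
    using Suc by (intro ddir_cong Suc.IH) (auto intro: Ck_SucD simp del: Ck.simps)
  finally show ?case by simp
qed auto

lemma ddir_funpow_funpow_commute:
  assumes "Ck (k + l) f" "z \<in> \<Omega>"
  shows "(ddir c e ^^ k) ((ddir c' e' ^^ l) f) z = (ddir c' e' ^^ l) ((ddir c e ^^ k) f) z"
  using assms
proof (induction k arbitrary: z)
  case (Suc k)
  have "(ddir c e ^^ Suc k) ((ddir c' e' ^^ l) f) z = ddir c e ((ddir c' e' ^^ l) ((ddir c e ^^ k) f)) z"
    unfolding funpow.simps o_def using Suc by (intro ddir_cong Suc.IH) (auto intro: Ck_SucD simp del: Ck.simps)
  also have "\<dots> = (ddir c' e' ^^ l) (ddir c e ((ddir c e ^^ k) f)) z"
    using Suc.prems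
    by (intro ddir_funpow_commute Ck_ddir_funpow) (auto simp del: Ck.simps simp: add.commute)
  finally show ?case by simp
qed auto

lemma ddir_funpow_mult:
  assumes "Ck n f" "Ck n g" "z \<in> \<Omega>"
  shows "(ddir c e ^^ n) (\<lambda>z. f z * g z) z
    = (\<Sum>i\<le>n. of_nat (n choose i) * ((ddir c e ^^ (n - i)) f z * (ddir c e ^^ i) g z))"
  using assms
proof (induction n arbitrary: z)
  case (Suc n)
  let ?D = "ddir c e"
  have *: "Ck (Suc 0) ((?D ^^ (n - i)) f)" "Ck (Suc 0) ((?D ^^ i) g)" if "i \<le> n" for i
    using Suc.prems that by (auto intro!: Ck_ddir_funpow_le[of "Suc n"] simp del: Ck.simps)
  have **: "Ck (Suc 0) (\<lambda>z. of_nat (n choose i) * ((?D ^^ (n - i)) f z * (?D ^^ i) g z))"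
    if "i \<le> n" for i
    by (intro Ck_mult Ck_const * that)
  have "(?D ^^ Suc n) (\<lambda>z. f z * g z) z
      = ?D (\<lambda>z. \<Sum>i\<le>n. of_nat (n choose i) * ((?D ^^ (n - i)) f z * (?D ^^ i) g z)) z"
    unfolding funpow.simps o_def using Suc by (intro ddir_cong Suc.IH) (auto intro: Ck_SucD simp del: Ck.simps)
  also have "\<dots> = (\<Sum>i\<le>n. ?D (\<lambda>z. of_nat (n choose i) * ((?D ^^ (n - i)) f z * (?D ^^ i) g z)) z)"
    using ** Suc.prems by (intro ddir_sum[where n = 0]) auto
  also have "\<dots> = (\<Sum>i\<le>n. of_nat (n choose i) *
      ((?D ^^ (n - i)) f z * (?D ^^ Suc i) g z + (?D ^^ Suc (n - i)) f z * (?D ^^ i) g z))"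
    using Suc.prems *
    by (intro sum.cong refl)
       (simp add: ddir_cmult[where n = 0] ddir_mult[where n = 0] Ck_mult add.commute del: Ck.simps)
  also have "\<dots> = (\<Sum>i\<le>Suc n. of_nat (Suc n choose i) * ((?D ^^ (Suc n - i)) f z * (?D ^^ i) g z))"
    by (rule sum_Pascal[symmetric, where F = "\<lambda>i j. (?D ^^ j) f z * (?D ^^ i) g z"])
  finally show ?case .
qed auto

lemma ddir_funpow_funpow_mult:
  assumes "Ck (k + l) f" "Ck (k + l) g" "z \<in> \<Omega>"
  shows "(ddir c e ^^ k) ((ddir c' e' ^^ l) (\<lambda>z. f z * g z)) z
    = (\<Sum>i\<le>k. \<Sum>j\<le>l. of_nat (k choose i) * of_nat (l choose j) *
        ((ddir c e ^^ (k - i)) ((ddir c' e' ^^ (l - j)) f) z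
          * (ddir c e ^^ i) ((ddir c' e' ^^ j) g) z))"
proof -
  let ?D = "ddir c e" and ?E = "ddir c' e'"
  have l: "Ck l f" "Ck l g" using assms by (auto intro: Ck_mono)
  have *: "Ck k ((?E ^^ (l - j)) f)" "Ck k ((?E ^^ j) g)" if "j \<le> l" for j
    using assms that by (auto intro!: Ck_ddir_funpow_le[of "k + l"] simp del: Ck.simps)
  have "(?D ^^ k) ((?E ^^ l) (\<lambda>z. f z * g z)) z
    = (?D ^^ k) (\<lambda>z. \<Sum>j\<le>l. of_nat (l choose j) * ((?E ^^ (l - j)) f z * (?E ^^ j) g z)) z"
    using assms(3) l by (intro ddir_funpow_cong ddir_funpow_mult)
  also have "\<dots> = (\<Sum>j\<le>l. of_nat (l choose j) * (?D ^^ k) (\<lambda>z. (?E ^^ (l - j)) f z * (?E ^^ j) g z) z)"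
    using assms(3) * by (intro ddir_funpow_sum Ck_mult) auto
  also have "\<dots> = (\<Sum>j\<le>l. \<Sum>i\<le>k. of_nat (k choose i) * of_nat (l choose j) *
        ((?D ^^ (k - i)) ((?E ^^ (l - j)) f) z * (?D ^^ i) ((?E ^^ j) g) z))"
    using assms(3) * 
    by (intro sum.cong refl, subst ddir_funpow_mult) (auto simp: sum_distrib_left mult_ac)
  finally show ?thesis by (subst sum.swap)
qed

text \<open>The binomial theorem for two commuting operators. It later turns the derivative in a
  stencil direction into Wirtinger derivatives.\<close>

lemma ddir_lincomb_funpow:
  assumes "Ck n f" "z \<in> \<Omega>"
  shows "(ddir (s * a + t * b) (s * a' + t * b') ^^ n) f z
    = (\<Sum>k\<le>n. of_nat (n choose k) * (s ^ k * t ^ (n - k) * (ddir a a' ^^ k) ((ddir b b' ^^ (n - k)) f) z))"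
  using assms
proof (induction n arbitrary: z)
  case (Suc n)
  let ?L = "ddir (s * a + t * b) (s * a' + t * b')"
  let ?A = "ddir a a'" and ?B = "ddir b b'"
  define F where "F i j z = s ^ i * t ^ j * (?A ^^ i) ((?B ^^ j) f) z" for i j z
  have L: "?L g z = s * ?A g z + t * ?B g z" for g z
    by (simp add: ddir_def algebra_simps)
  have *: "Ck (Suc 0) ((?A ^^ k) ((?B ^^ (n - k)) f))" if "k \<le> n" for k
    using Suc.prems that by (auto intro!: Ck_ddir_funpow simp del: Ck.simps)
  have F: "?L (F k (n - k)) z = F (Suc k) (n - k) z + F k (Suc (n - k)) z" if "k \<le> n" for k
  proof -
    have "?L (F k (n - k)) z = s ^ k * t ^ (n - k) * ?L ((?A ^^ k) ((?B ^^ (n - k)) f)) z"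
      unfolding F_def using * that Suc.prems by (intro ddir_cmult)
    \<comment> \<open>Here commutation enters: the additional \<open>?B\<close> has to pass the
      powers of \<open>?A\<close>.\<close>
    moreover have "?B ((?A ^^ k) ((?B ^^ (n - k)) f)) z = (?A ^^ k) (?B ((?B ^^ (n - k)) f)) z"
      using Suc.prems that by (intro ddir_funpow_commute Ck_ddir_funpow) auto
    ultimately show ?thesis by (simp only: L) (simp add: F_def algebra_simps)
  qed
  have **: "Ck (Suc 0) (\<lambda>z. of_nat (n choose i) * F i (n - i) z)" "Ck (Suc 0) (F i (n - i))" if "i \<le> n" for i
    unfolding F_def by (intro Ck_mult Ck_const * that)+
  have "(?L ^^ Suc n) f z = ?L (\<lambda>z. \<Sum>k\<le>n. of_nat (n choose k) * F k (n - k) z) z"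
    unfolding funpow.simps o_def F_def using Suc
    by (intro ddir_cong Suc.IH) (auto intro: Ck_SucD simp del: Ck.simps)
  also have "\<dots> = (\<Sum>i\<le>n. ?L (\<lambda>z. of_nat (n choose i) * F i (n - i) z) z)"
    using ** Suc.prems by (intro ddir_sum[where n = 0]) auto
  also have "\<dots> = (\<Sum>k\<le>n. of_nat (n choose k) * (F (Suc k) (n - k) z + F k (Suc (n - k)) z))"
    using Suc.prems ** F
    by (intro sum.cong refl) (simp add: ddir_cmult[where n = 0] del: Ck.simps)
  also have "\<dots> = (\<Sum>k\<le>Suc n. of_nat (Suc n choose k) * F k (Suc n - k) z)"
    by (rule sum_Pascal[symmetric, where F = "\<lambda>i j. F i j z"])
  finally show ?case by (simp only: F_def)
qed auto

text \<open>The estimate is stated for all mixed partial derivatives of the remaining order, so that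
  it can be iterated. Each application costs a factor 2, one summand for each coordinate.\<close>

lemma ddir_bound:
  assumes "Ck (Suc n) f" "norm c \<le> 1" "norm e \<le> 1"
    and B: "\<And>i j z. i + j = Suc n \<Longrightarrow> z \<in> \<Omega> \<Longrightarrow> norm ((partial_x ^^ i) ((partial_y ^^ j) f) z) \<le> B"
    and ij: "i + j = n" and z: "z \<in> \<Omega>"
  shows "norm ((partial_x ^^ i) ((partial_y ^^ j) (ddir c e f)) z) \<le> 2 * B"
proof -
  let ?X = "ddir 1 0" and ?Y = "ddir 0 1"
  have "(?X ^^ i) ((?Y ^^ j) (ddir c e f)) z = (?X ^^ i) (ddir c e ((?Y ^^ j) f)) z"
    using assms(1) ij z
    by (intro ddir_funpow_cong ddir_funpow_commute[symmetric]) (auto intro: Ck_mono simp del: Ck.simps)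
  also have "\<dots> = ddir c e ((?X ^^ i) ((?Y ^^ j) f)) z"
    using assms(1) ij z
    by (intro ddir_funpow_commute[symmetric] Ck_ddir_funpow_le[of "Suc n"]) (auto simp del: Ck.simps)
  also have "\<dots> = c * ?X ((?X ^^ i) ((?Y ^^ j) f)) z + e * ?Y ((?X ^^ i) ((?Y ^^ j) f)) z"
    by (simp add: ddir_def)
  also have "?Y ((?X ^^ i) ((?Y ^^ j) f)) z = (?X ^^ i) (?Y ((?Y ^^ j) f)) z"
    using assms(1) ij z by (intro ddir_funpow_commute Ck_ddir_funpow_le[of "Suc n"]) (auto simp del: Ck.simps)
  finally have "(partial_x ^^ i) ((partial_y ^^ j) (ddir c e f)) z
      = c * (partial_x ^^ Suc i) ((partial_y ^^ j) f) z + e * (partial_x ^^ i) ((partial_y ^^ Suc j) f) z"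
    by (simp add: ddir_1_0 ddir_0_1)
  also have "norm \<dots> \<le> 1 * B + 1 * B"
    by (rule order.trans[OF norm_triangle_ineq], unfold norm_mult, intro add_mono mult_mono assms(2,3) B)
       (use ij z in auto)
  finally show ?thesis by simp
qed

lemma ddir_funpow_bound:
  assumes "Ck (n + k) f" "norm c \<le> 1" "norm e \<le> 1"
    and B: "\<And>i j z. i + j = n + k \<Longrightarrow> z \<in> \<Omega> \<Longrightarrow> norm ((partial_x ^^ i) ((partial_y ^^ j) f) z) \<le> B"
    and ij: "i + j = n" and z: "z \<in> \<Omega>"
  shows "norm ((partial_x ^^ i) ((partial_y ^^ j) ((ddir c e ^^ k) f)) z) \<le> 2 ^ k * B"
  using assms(1) B ij z
proof (induction k arbitrary: n i j z)
  case (Suc k)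
  have "norm ((partial_x ^^ i) ((partial_y ^^ j) (ddir c e ((ddir c e ^^ k) f))) z) \<le> 2 * (2 ^ k * B)"
    by (rule ddir_bound[OF _ assms(2,3) Suc.IH[of "Suc n"] Suc.prems(3,4)])
       (use Suc.prems in \<open>auto intro!: Ck_ddir_funpow simp del: Ck.simps\<close>)
  then show ?case by simp
qed auto

lemma ddir_funpow_funpow_bound:
  assumes "Ck (k + l) f" "norm c \<le> 1" "norm e \<le> 1" "norm c' \<le> 1" "norm e' \<le> 1"
    and B: "\<And>i j z. i + j = k + l \<Longrightarrow> z \<in> \<Omega> \<Longrightarrow> norm ((partial_x ^^ i) ((partial_y ^^ j) f) z) \<le> B"
    and z: "z \<in> \<Omega>"
  shows "norm ((ddir c e ^^ k) ((ddir c' e' ^^ l) f) z) \<le> 2 ^ (k + l) * B"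
proof -
  have "norm ((partial_x ^^ 0) ((partial_y ^^ 0) ((ddir c e ^^ k) ((ddir c' e' ^^ l) f))) z) \<le> 2 ^ k * (2 ^ l * B)"
    by (rule ddir_funpow_bound[OF _ assms(2,3) ddir_funpow_bound[OF _ assms(4,5) B]])
       (use assms in \<open>auto intro!: Ck_ddir_funpow simp del: Ck.simps\<close>)
  then show ?thesis by (simp add: power_add mult_ac)
qed

lemma Ck_cnj: "Ck n f \<Longrightarrow> Ck n (\<lambda>z. cnj (f z))"
proof (induction n arbitrary: f)
  case (Suc n)
  show ?case
    by (rule Ck_SucI[of _ "\<lambda>z. cnj (partial_x f z)" "\<lambda>z. cnj (partial_y f z)"])
      (use Suc in \<open>auto intro!: continuous_intros bounded_linear.has_vector_derivative[OF bounded_linear_cnj]\<close>)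
qed (auto intro!: continuous_intros)

lemma cnj_ddir:
  assumes "Ck (Suc n) f" "z \<in> \<Omega>"
  shows "cnj (ddir c e f z) = ddir (cnj c) (cnj e) (\<lambda>z. cnj (f z)) z"
  using partial_x_eqI[OF bounded_linear.has_vector_derivative[OF bounded_linear_cnj Ck_px[OF assms]]]
    partial_y_eqI[OF bounded_linear.has_vector_derivative[OF bounded_linear_cnj Ck_py[OF assms]]]
  by (simp add: ddir_def)

lemma cnj_ddir_funpow:
  assumes "Ck k f" "z \<in> \<Omega>"
  shows "cnj ((ddir c e ^^ k) f z) = (ddir (cnj c) (cnj e) ^^ k) (\<lambda>z. cnj (f z)) z"
  using assms
proof (induction k arbitrary: z)
  case (Suc k)
  have "cnj ((ddir c e ^^ Suc k) f z) = ddir (cnj c) (cnj e) (\<lambda>z. cnj ((ddir c e ^^ k) f z)) z"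
    using Suc.prems by (auto intro!: cnj_ddir[where n = 0] Ck_ddir_funpow simp del: Ck.simps)
  also have "\<dots> = ddir (cnj c) (cnj e) ((ddir (cnj c) (cnj e) ^^ k) (\<lambda>z. cnj (f z))) z"
    using Suc by (intro ddir_cong Suc.IH) (auto intro: Ck_SucD simp del: Ck.simps)
  finally show ?case by simp
qed auto

end

section \<open>Wirtinger derivatives\<close>

text \<open>\<open>cderiv\<close> accepts real functions only, whereas differentiating the equation
  applies the operators to functions that are already complex, such as products of
  derivatives.\<close>

definition wirt :: "nat \<Rightarrow> nat \<Rightarrow> (plane \<Rightarrow> complex) \<Rightarrow> plane \<Rightarrow> complex" where
  "wirt k l v z = (ddir 1 (- \<i>) ^^ k) ((ddir 1 \<i> ^^ l) v) z / 2 ^ (k + l)"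

lemma cderiv_eq_wirt: "cderiv k l v z = wirt k l (\<lambda>w. of_real (v w)) z"
proof -
  have "(\<lambda>g w. partial_x g w - \<i> * partial_y g w) = ddir 1 (- \<i>)"
    "(\<lambda>g w. partial_x g w + \<i> * partial_y g w) = ddir 1 \<i>"
    by (auto simp: ddir_def fun_eq_iff)
  then show ?thesis by (simp add: cderiv_def wirt_def)
qed

text \<open>Absorption: \<open>k choose i\<close> is \<open>(1 - i / (k + 1))\<close> times
  \<open>Suc k choose i\<close>, and the added term \<open>i = Suc k\<close> vanishes. Together with
  the shifted version below it raises the binomials of the Leibniz rule by one order, which creates
  the fractions in \<open>a_coeff\<close>.\<close>

lemma sum_choose_lower:
  fixes X :: "nat \<Rightarrow> complex"
  shows "(\<Sum>i\<le>k. of_nat (k choose i) * X i)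
    = (\<Sum>i\<le>Suc k. (1 - of_nat i / of_nat (Suc k)) * of_nat (Suc k choose i) * X i)"
proof -
  have *: "of_nat (k choose i) = (1 - of_nat i / of_nat (Suc k)) * (of_nat (Suc k choose i) :: complex)"
    if "i \<le> k" for i
  proof -
    have "(Suc k - i) * (Suc k choose i) = Suc k * (k choose i)"
      using binomial_absorb_comp[of "Suc k" i] by simp
    then have "of_nat (Suc k - i) * (of_nat (Suc k choose i) :: complex) = of_nat (Suc k) * of_nat (k choose i)"
      by (simp only: of_nat_mult[symmetric])
    moreover have "(of_nat (Suc k - i) :: complex) = of_nat (Suc k) - of_nat i"
      using that by (intro of_nat_diff) auto
    moreover have "(of_nat (Suc k) :: complex) \<noteq> 0" by (simp only: of_nat_eq_0_iff)
    ultimately show ?thesis by (simp add: field_simps del: of_nat_Suc)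
  qed
  have "(of_nat (Suc k) :: complex) \<noteq> 0" by (simp only: of_nat_eq_0_iff)
  then show ?thesis by (simp add: * del: of_nat_Suc)
qed

text \<open>The counterpart for the factor that carries the additional derivative; now the term
  \<open>i = 0\<close> is the added zero.\<close>

lemma sum_choose_shift:
  fixes X :: "nat \<Rightarrow> complex"
  shows "(\<Sum>i\<le>k. of_nat (k choose i) * X (Suc i))
    = (\<Sum>i\<le>Suc k. (of_nat i / of_nat (Suc k)) * of_nat (Suc k choose i) * X i)"
proof -
  have *: "of_nat (k choose i) = (of_nat (Suc i) / of_nat (Suc k)) * (of_nat (Suc k choose Suc i) :: complex)" for i
  proof -
    have "Suc i * (Suc k choose Suc i) = Suc k * (k choose i)"
      using Suc_times_binomial_eq[of k i] by (simp only: mult.commute)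
    then have "of_nat (Suc i) * (of_nat (Suc k choose Suc i) :: complex) = of_nat (Suc k) * of_nat (k choose i)"
      by (simp only: of_nat_mult[symmetric])
    moreover have "(of_nat (Suc k) :: complex) \<noteq> 0" by (simp only: of_nat_eq_0_iff)
    ultimately show ?thesis by (simp add: field_simps del: of_nat_Suc binomial_Suc_Suc)
  qed
  show ?thesis by (simp only: sum.atMost_Suc_shift *) simp
qed

text \<open>The weight is \<open>1/2 + 1/2 - 1\<close>. Therefore the undifferentiated
  \<open>\<alpha>\<close> never enters and bounds on its derivatives suffice.\<close>

lemma a_coeff_top: "0 < k \<Longrightarrow> 0 < l \<Longrightarrow> a_coeff \<alpha> b k l k l = 0"
  by (simp add: a_coeff_def)

lemma a_coeff_bottom: "a_coeff \<alpha> b k l 0 0 = 0"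
  by (simp add: a_coeff_def)

context open_plane
begin

lemma Ck_wirt: "Ck m f \<Longrightarrow> n + k + l \<le> m \<Longrightarrow> Ck n (wirt k l f)"
  unfolding wirt_def divide_inverse
  by (intro Ck_mult Ck_const Ck_ddir_funpow) (rule Ck_mono, auto)

lemma wirt_cong: "(\<And>w. w \<in> \<Omega> \<Longrightarrow> f w = g w) \<Longrightarrow> z \<in> \<Omega> \<Longrightarrow> wirt k l f z = wirt k l g z"
  unfolding wirt_def by (intro arg_cong2[where f = "(/)"] refl ddir_funpow_cong)

lemma wirt_sum:
  assumes "\<And>i. i \<in> I \<Longrightarrow> Ck (k + l) (f i)" "z \<in> \<Omega>"
  shows "wirt k l (\<lambda>z. \<Sum>i\<in>I. c i * f i z) z = (\<Sum>i\<in>I. c i * wirt k l (f i) z)"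
proof -
  have "(ddir 1 (- \<i>) ^^ k) ((ddir 1 \<i> ^^ l) (\<lambda>z. \<Sum>i\<in>I. c i * f i z)) z
      = (ddir 1 (- \<i>) ^^ k) (\<lambda>z. \<Sum>i\<in>I. c i * (ddir 1 \<i> ^^ l) (f i) z) z"
    using assms by (intro ddir_funpow_cong ddir_funpow_sum) (auto intro: Ck_mono[of "k + l"])
  also have "\<dots> = (\<Sum>i\<in>I. c i * (ddir 1 (- \<i>) ^^ k) ((ddir 1 \<i> ^^ l) (f i)) z)"
    using assms by (intro ddir_funpow_sum Ck_ddir_funpow) auto
  finally show ?thesis by (simp add: wirt_def sum_divide_distrib)
qed

lemma wirt_cmult:
  assumes "Ck (k + l) f" "z \<in> \<Omega>"
  shows "wirt k l (\<lambda>z. c * f z) z = c * wirt k l f z"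
  using wirt_sum[of "{()}" k l "\<lambda>_. f" z "\<lambda>_. c"] assms by simp

lemma wirt_add:
  assumes "Ck (k + l) f" "Ck (k + l) g" "z \<in> \<Omega>"
  shows "wirt k l (\<lambda>z. f z + g z) z = wirt k l f z + wirt k l g z"
  using wirt_sum[of UNIV k l "\<lambda>b. if b then f else g" z "\<lambda>_. 1"] assms
  by (simp add: UNIV_bool add.commute)

lemma wirt_mult:
  assumes "Ck (k + l) f" "Ck (k + l) g" "z \<in> \<Omega>"
  shows "wirt k l (\<lambda>z. f z * g z) z = (\<Sum>i\<le>k. of_nat (k choose i) * (\<Sum>j\<le>l. of_nat (l choose j) *
        (wirt (k - i) (l - j) f z * wirt i j g z)))"
proof -
  have pow: "(2::complex) ^ (k + l) = 2 ^ (k - i + (l - j)) * 2 ^ (i + j)" if "i \<le> k" "j \<le> l" for i j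
    using that by (simp add: power_add[symmetric])
  show ?thesis
    unfolding wirt_def ddir_funpow_funpow_mult[OF assms] sum_divide_distrib sum_distrib_left
    by (intro sum.cong refl) (simp add: pow)
qed

lemma wirt_wirt:
  assumes "Ck (k + l + k' + l') f" "z \<in> \<Omega>"
  shows "wirt k l (wirt k' l' f) z = wirt (k + k') (l + l') f z"
proof -
  let ?D = "ddir 1 (- \<i>)" and ?E = "ddir 1 \<i>"
  have g: "Ck (k + l) ((?D ^^ k') ((?E ^^ l') f))"
    using assms by (intro Ck_ddir_funpow) (simp add: add_ac)
  have "wirt k l (wirt k' l' f) z = wirt k l (\<lambda>z. (1 / 2 ^ (k' + l')) * (?D ^^ k') ((?E ^^ l') f) z) z"
    by (simp add: wirt_def[of k' l', abs_def])
  also have "\<dots> = (1 / 2 ^ (k' + l')) * wirt k l ((?D ^^ k') ((?E ^^ l') f)) z"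
    by (rule wirt_cmult[OF g assms(2)])
  also have "(?D ^^ k) ((?E ^^ l) ((?D ^^ k') ((?E ^^ l') f))) z
      = (?D ^^ k) ((?D ^^ k') ((?E ^^ l) ((?E ^^ l') f))) z"
    using assms
    by (intro ddir_funpow_cong ddir_funpow_funpow_commute Ck_ddir_funpow)
       (auto intro: Ck_mono simp: add_ac)
  then have "wirt k l ((?D ^^ k') ((?E ^^ l') f)) z
      = (?D ^^ (k + k')) ((?E ^^ (l + l')) f) z / 2 ^ (k + l)"
    by (simp add: wirt_def funpow_add)
  finally show ?thesis
    by (simp only:) (simp add: wirt_def[of "k + k'"] power_add mult_ac)
qed

text \<open>The factor \<open>2 ^ (k + l)\<close> from \<open>ddir_funpow_funpow_bound\<close> is
  cancelled by the normalisation, so the bound for the partial derivatives is inherited without a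
  constant.\<close>

lemma wirt_bound:
  assumes "Ck (k + l) f" "z \<in> \<Omega>"
    and "\<And>i j z. i + j = k + l \<Longrightarrow> z \<in> \<Omega> \<Longrightarrow> norm ((partial_x ^^ i) ((partial_y ^^ j) f) z) \<le> B"
  shows "norm (wirt k l f z) \<le> B"
  using ddir_funpow_funpow_bound[OF assms(1) _ _ _ _ assms(3,2), of 1 "- \<i>" 1 "\<i>"]
  by (simp add: wirt_def norm_divide norm_power field_simps)

text \<open>Conjugation exchanges the two Wirtinger operators. For real functions this is the
  symmetry that relates the axes \<open>(m, 0)\<close> and \<open>(0, n)\<close>.\<close>

lemma cnj_wirt:
  assumes "Ck (k + l) f" "z \<in> \<Omega>"
  shows "cnj (wirt k l f z) = wirt l k (\<lambda>z. cnj (f z)) z"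
proof -
  let ?D = "ddir 1 (- \<i>)" and ?E = "ddir 1 \<i>"
  have "cnj ((?D ^^ k) ((?E ^^ l) f) z) = (?E ^^ k) (\<lambda>z. cnj ((?E ^^ l) f z)) z"
    using cnj_ddir_funpow[of k "(?E ^^ l) f" z 1 "- \<i>"] assms by (auto intro: Ck_ddir_funpow)
  also have "\<dots> = (?E ^^ k) ((?D ^^ l) (\<lambda>z. cnj (f z))) z"
    using cnj_ddir_funpow[OF Ck_mono[OF assms(1)], of l _ 1 "\<i>"] assms(2)
    by (intro ddir_funpow_cong) auto
  also have "\<dots> = (?D ^^ l) ((?E ^^ k) (\<lambda>z. cnj (f z))) z"
    using assms by (intro ddir_funpow_funpow_commute Ck_cnj)
  finally show ?thesis by (simp add: wirt_def add.commute)
qed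

text \<open>The Leibniz rule is applied to the equation in Wirtinger form. With
  \<open>K = k + 1\<close> and \<open>L = l + 1\<close> the two products contribute the weights
  \<open>(1 - i/K) (j/L) / 2\<close> and \<open>(i/K) (1 - j/L) / 2\<close>; their sum is
  \<open>i/(2K) + j/(2L) - ij/(KL)\<close>, the factor in \<open>a_coeff\<close>.\<close>

lemma wirt_recursion:
  assumes v: "Ck (Suc k + Suc l) v" and \<alpha>: "Ck (Suc (k + l)) (\<lambda>z. of_real (\<alpha> z))"
    and \<phi>: "Ck (k + l) \<phi>"
    and pde: "\<And>z. z \<in> \<Omega> \<Longrightarrow> wirt 1 1 v z =
      (wirt 1 0 (\<lambda>z. of_real (\<alpha> z)) z * wirt 0 1 v z
        + wirt 0 1 (\<lambda>z. of_real (\<alpha> z)) z * wirt 1 0 v z) / 2 + \<phi> z / 4"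
    and z: "z \<in> \<Omega>"
  shows "wirt (Suc k) (Suc l) v z =
    (\<Sum>(i, j)\<in>{0..Suc k} \<times> {0..Suc l} - {(Suc k, Suc l)}. a_coeff \<alpha> z (Suc k) (Suc l) i j * wirt i j v z)
      + wirt k l \<phi> z / 4"
proof -
  let ?K = "Suc k" and ?L = "Suc l"
  let ?a = "\<lambda>z. complex_of_real (\<alpha> z)"
  have vv: "Ck (k + l) (wirt 0 1 v)" "Ck (k + l) (wirt 1 0 v)"
    "Ck (k + l) (wirt 1 0 ?a)" "Ck (k + l) (wirt 0 1 ?a)"
    by (rule Ck_wirt[OF v] Ck_wirt[OF \<alpha>], simp)+
  have "wirt ?K ?L v z = wirt k l (wirt 1 1 v) z"
    using wirt_wirt[of k l 1 1 v z] v z by simp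
  also have "\<dots> = wirt k l (\<lambda>z. (1/2) * (wirt 1 0 ?a z * wirt 0 1 v z)
      + ((1/2) * (wirt 0 1 ?a z * wirt 1 0 v z) + (1/4) * \<phi> z)) z"
    using z by (intro wirt_cong) (simp_all only: pde, simp add: field_simps)
  also have "\<dots> = (1/2) * wirt k l (\<lambda>z. wirt 1 0 ?a z * wirt 0 1 v z) z
      + ((1/2) * wirt k l (\<lambda>z. wirt 0 1 ?a z * wirt 1 0 v z) z + (1/4) * wirt k l \<phi> z)"
    using vv \<phi> z by (simp only: wirt_add wirt_cmult Ck_add Ck_mult Ck_const)
  also have "wirt k l (\<lambda>z. wirt 1 0 ?a z * wirt 0 1 v z) z
    = (\<Sum>i\<le>k. of_nat (k choose i) * (\<Sum>j\<le>l. of_nat (l choose j) *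
        (wirt (?K - i) (?L - Suc j) ?a z * wirt i (Suc j) v z)))"
    unfolding wirt_mult[OF vv(3,1) z]
  proof (intro sum.cong refl arg_cong2[where f = "(*)"])
    fix i j assume "i \<in> {..k}" "j \<in> {..l}"
    then show "wirt (k - i) (l - j) (wirt 1 0 ?a) z = wirt (?K - i) (?L - Suc j) ?a z"
      using wirt_wirt[of "k - i" "l - j" 1 0 ?a z] z Ck_mono[OF \<alpha>, of "k - i + (l - j) + 1"]
      by (simp add: Suc_diff_le del: Ck.simps)
    show "wirt i j (wirt 0 1 v) z = wirt i (Suc j) v z"
      using \<open>i \<in> {..k}\<close> \<open>j \<in> {..l}\<close> wirt_wirt[of i j 0 1 v z] z Ck_mono[OF v, of "i + j + 1"] by (simp del: Ck.simps)
  qed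
  also have "\<dots> = (\<Sum>i\<le>?K. (1 - of_nat i / of_nat ?K) * of_nat (?K choose i) *
      (\<Sum>j\<le>?L. (of_nat j / of_nat ?L) * of_nat (?L choose j) * (wirt (?K - i) (?L - j) ?a z * wirt i j v z)))"
    unfolding sum_choose_shift[where X = "\<lambda>j. wirt (?K - i) (?L - j) ?a z * wirt i j v z" for i]
    unfolding sum_choose_lower ..
  also have "wirt k l (\<lambda>z. wirt 0 1 ?a z * wirt 1 0 v z) z
    = (\<Sum>i\<le>k. of_nat (k choose i) * (\<Sum>j\<le>l. of_nat (l choose j) *
        (wirt (?K - Suc i) (?L - j) ?a z * wirt (Suc i) j v z)))"
    unfolding wirt_mult[OF vv(4,2) z]
  proof (intro sum.cong refl arg_cong2[where f = "(*)"])
    fix i j assume "i \<in> {..k}" "j \<in> {..l}"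
    then show "wirt (k - i) (l - j) (wirt 0 1 ?a) z = wirt (?K - Suc i) (?L - j) ?a z"
      using wirt_wirt[of "k - i" "l - j" 0 1 ?a z] z Ck_mono[OF \<alpha>, of "k - i + (l - j) + 1"]
      by (simp add: Suc_diff_le del: Ck.simps)
    show "wirt i j (wirt 1 0 v) z = wirt (Suc i) j v z"
      using \<open>i \<in> {..k}\<close> \<open>j \<in> {..l}\<close> wirt_wirt[of i j 1 0 v z] z Ck_mono[OF v, of "i + j + 1"] by (simp del: Ck.simps)
  qed
  also have "\<dots> = (\<Sum>i\<le>?K. (of_nat i / of_nat ?K) * of_nat (?K choose i) *
      (\<Sum>j\<le>?L. (1 - of_nat j / of_nat ?L) * of_nat (?L choose j) * (wirt (?K - i) (?L - j) ?a z * wirt i j v z)))"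
    unfolding sum_choose_lower[where X = "\<lambda>j. wirt (?K - Suc i) (?L - j) ?a z * wirt (Suc i) j v z" for i]
    unfolding sum_choose_shift[where X = "\<lambda>i. \<Sum>j\<le>?L. (1 - of_nat j / of_nat ?L) * of_nat (?L choose j) * (wirt (?K - i) (?L - j) ?a z * wirt i j v z)"] ..
  also have "(1/2) * (\<Sum>i\<le>?K. (1 - of_nat i / of_nat ?K) * of_nat (?K choose i) *
      (\<Sum>j\<le>?L. (of_nat j / of_nat ?L) * of_nat (?L choose j) * (wirt (?K - i) (?L - j) ?a z * wirt i j v z)))
    + ((1/2) * (\<Sum>i\<le>?K. (of_nat i / of_nat ?K) * of_nat (?K choose i) *
      (\<Sum>j\<le>?L. (1 - of_nat j / of_nat ?L) * of_nat (?L choose j) * (wirt (?K - i) (?L - j) ?a z * wirt i j v z)))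
      + (1/4) * wirt k l \<phi> z)
    = (\<Sum>i\<le>?K. \<Sum>j\<le>?L. a_coeff \<alpha> z ?K ?L i j * wirt i j v z) + wirt k l \<phi> z / 4"
    unfolding add.assoc[symmetric] sum_distrib_left sum.distrib[symmetric]
    by (intro arg_cong2[where f = "(+)"] sum.cong refl)
       (simp_all add: a_coeff_def cderiv_eq_wirt field_simps del: of_nat_Suc binomial_Suc_Suc mult_Suc mult_Suc_right)
  also have "(\<Sum>i\<le>?K. \<Sum>j\<le>?L. a_coeff \<alpha> z ?K ?L i j * wirt i j v z)
    = (\<Sum>(i, j)\<in>{0..?K} \<times> {0..?L}. a_coeff \<alpha> z ?K ?L i j * wirt i j v z)"
    unfolding atMost_atLeast0 by (rule sum.cartesian_product)
  \<comment> \<open>The left-hand side of the recursion would reappear at \<open>(?K, ?L)\<close>,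
    but its weight is zero.\<close>
  also have "\<dots> = (\<Sum>(i, j)\<in>{0..?K} \<times> {0..?L} - {(?K, ?L)}. a_coeff \<alpha> z ?K ?L i j * wirt i j v z)"
    by (rule sum.mono_neutral_right) (auto simp: a_coeff_top)
  finally show ?thesis .
qed

end

section \<open>Coefficients of the derivatives reduced to the axes\<close>

lemma A_coeff_axis: "k * l = 0 \<Longrightarrow> A_coeff \<alpha> b m n k l = (if k = m \<and> l = n then 1 else 0)"
  by (subst A_coeff.simps) auto

lemma F_coeff_axis: "k * l = 0 \<Longrightarrow> F_coeff \<alpha> \<phi> b k l = 0"
  by (subst F_coeff.simps) auto

lemma A_coeff_eq_0: "\<not> (m \<le> k \<and> n \<le> l) \<Longrightarrow> A_coeff \<alpha> b m n k l = 0"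
  by (subst A_coeff.simps) auto

text \<open>The summation range no longer depends on \<open>m\<close> and \<open>n\<close>, so the
  coefficients satisfy literally the same recursion as the derivatives of \<open>u\<close>.\<close>

lemma A_coeff_step:
  assumes "0 < k" "0 < l"
  shows "A_coeff \<alpha> b m n k l =
    (\<Sum>(i, j)\<in>{0..k} \<times> {0..l} - {(k, l)}. a_coeff \<alpha> b k l i j * A_coeff \<alpha> b m n i j)"
proof -
  have "A_coeff \<alpha> b m n k l =
    (\<Sum>(i, j)\<in>{m..k} \<times> {n..l} - {(k, l)}. a_coeff \<alpha> b k l i j * A_coeff \<alpha> b m n i j)"
    using assms by (subst A_coeff.simps) auto
  also have "\<dots> = (\<Sum>(i, j)\<in>{0..k} \<times> {0..l} - {(k, l)}. a_coeff \<alpha> b k l i j * A_coeff \<alpha> b m n i j)"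
    by (rule sum.mono_neutral_left) (auto, (metis A_coeff_eq_0)+)
  finally show ?thesis .
qed

lemma F_coeff_step:
  assumes "0 < k" "0 < l"
  shows "F_coeff \<alpha> \<phi> b k l =
    (\<Sum>(i, j)\<in>{0..k} \<times> {0..l} - {(k, l)}. a_coeff \<alpha> b k l i j * F_coeff \<alpha> \<phi> b i j)
      + cderiv (k - 1) (l - 1) \<phi> b / 4"
  using assms by (subst F_coeff.simps) auto

text \<open>The equation contains only derivatives of \<open>u\<close>: all weights with lower
  indices \<open>0, 0\<close> vanish by \<open>a_coeff_bottom\<close>, so nothing propagates from
  the start value at \<open>(0, 0)\<close>.\<close>

lemma A_coeff_0_0: "(k, l) \<noteq> (0, 0) \<Longrightarrow> A_coeff \<alpha> b 0 0 k l = 0"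
proof (induction "k + l" arbitrary: k l rule: less_induct)
  case less
  show ?case
  proof (cases "k * l = 0")
    case True
    then show ?thesis using less.prems by (auto simp: A_coeff_axis)
  next
    case False
    then have kl: "0 < k" "0 < l" by auto
    show ?thesis
      unfolding A_coeff_step[OF kl]
    proof (rule sum.neutral, rule ballI)
      fix x assume "x \<in> {0..k} \<times> {0..l} - {(k, l)}"
      then obtain i j where x: "x = (i, j)" "i + j < k + l" by (cases x) fastforce
      show "(case x of (i, j) \<Rightarrow> a_coeff \<alpha> b k l i j * A_coeff \<alpha> b 0 0 i j) = 0"
      proof (cases "(i, j) = (0, 0)")
        case False
        then show ?thesis using less.hyps[OF x(2)] x(1) by simp
      qed (simp add: x a_coeff_bottom)
    qed
  qed
qed

lemma cnj_a_coeff: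
  assumes "cnj (cderiv (k - m) (l - n) \<alpha> b) = cderiv (l - n) (k - m) \<alpha> b"
  shows "cnj (a_coeff \<alpha> b k l m n) = a_coeff \<alpha> b l k n m"
  by (simp add: a_coeff_def assms algebra_simps)

text \<open>The hypothesis expresses that \<open>\<alpha>\<close> is real. The weights in
  \<open>a_coeff\<close> are symmetric under exchanging both index pairs, so the whole recursion
  is.\<close>

lemma cnj_A_coeff:
  assumes "\<And>i j. i + j \<le> N \<Longrightarrow> cnj (cderiv i j \<alpha> b) = cderiv j i \<alpha> b" "k + l \<le> N"
  shows "cnj (A_coeff \<alpha> b m n k l) = A_coeff \<alpha> b n m l k"
  using assms(2)
proof (induction "k + l" arbitrary: k l rule: less_induct)
  case less
  show ?case
  proof (cases "k * l = 0")
    case True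
    then show ?thesis by (auto simp: A_coeff_axis)
  next
    case False
    then have kl: "0 < k" "0 < l" by auto
    have "cnj (A_coeff \<alpha> b m n k l) =
      (\<Sum>(i, j)\<in>{0..k} \<times> {0..l} - {(k, l)}. a_coeff \<alpha> b l k j i * A_coeff \<alpha> b n m j i)"
      unfolding A_coeff_step[OF kl] cnj_sum
    proof (rule sum.cong[OF refl])
      fix x assume "x \<in> {0..k} \<times> {0..l} - {(k, l)}"
      then obtain i j where x: "x = (i, j)" "i + j < k + l" "i \<le> k" "j \<le> l"
        by (cases x) fastforce
      have "cnj (a_coeff \<alpha> b k l i j) = a_coeff \<alpha> b l k j i"
        by (rule cnj_a_coeff, rule assms(1)) (use less.prems in auto)
      then show "cnj (case x of (i, j) \<Rightarrow> a_coeff \<alpha> b k l i j * A_coeff \<alpha> b m n i j)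
        = (case x of (i, j) \<Rightarrow> a_coeff \<alpha> b l k j i * A_coeff \<alpha> b n m j i)"
        using less.hyps[OF x(2)] less.prems x by simp
    qed
    also have "\<dots> = (\<Sum>(i, j)\<in>{0..l} \<times> {0..k} - {(l, k)}. a_coeff \<alpha> b l k i j * A_coeff \<alpha> b n m i j)"
      by (rule sum.reindex_bij_witness[of _ prod.swap prod.swap]) auto
    finally show ?thesis using A_coeff_step[OF kl(2,1)] by metis
  qed
qed

text \<open>Both sides obey the same recursion and agree on the axes, where \<open>A_coeff\<close>
  is a Kronecker delta and \<open>F_coeff\<close> is zero.\<close>

lemma expand_axis_derivatives:
  fixes U :: "nat \<Rightarrow> nat \<Rightarrow> complex"
  assumes rec: "\<And>k l. k + l + 2 \<le> N \<Longrightarrow> U (Suc k) (Suc l) =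
      (\<Sum>(i, j)\<in>{0..Suc k} \<times> {0..Suc l} - {(Suc k, Suc l)}. a_coeff \<alpha> b (Suc k) (Suc l) i j * U i j)
        + cderiv k l \<phi> b / 4"
    and "k + l \<le> N"
  shows "U k l = (\<Sum>(m, n)\<in>{(m, n). m * n = 0 \<and> m + n \<le> N}. A_coeff \<alpha> b m n k l * U m n)
    + F_coeff \<alpha> \<phi> b k l"
  using assms(2)
proof (induction "k + l" arbitrary: k l rule: less_induct)
  case less
  let ?S = "{(m, n). m * n = 0 \<and> m + n \<le> N}"
  have "?S \<subseteq> {..N} \<times> {..N}" by auto
  then have S: "finite ?S" by (rule finite_subset) auto
  show ?case
  proof (cases "k * l = 0")
    case True
    have "(\<Sum>(m, n)\<in>?S. A_coeff \<alpha> b m n k l * U m n) = (\<Sum>x\<in>?S. if x = (k, l) then U k l else 0)"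
      using True by (intro sum.cong) (auto simp: A_coeff_axis split: if_splits)
    also have "\<dots> = U k l" using True less.prems S by simp
    finally show ?thesis using True by (simp add: F_coeff_axis)
  next
    case False
    then obtain k' l' where kl: "k = Suc k'" "l = Suc l'" by (metis mult_0 mult_0_right not0_implies_Suc)
    let ?I = "{0..k} \<times> {0..l} - {(k, l)}"
    have "U k l = (\<Sum>(i, j)\<in>?I. a_coeff \<alpha> b k l i j * U i j) + cderiv k' l' \<phi> b / 4"
      using rec[of k' l'] less.prems kl by simp
    also have "(\<Sum>(i, j)\<in>?I. a_coeff \<alpha> b k l i j * U i j)
      = (\<Sum>(i, j)\<in>?I. a_coeff \<alpha> b k l i j *
          ((\<Sum>(m, n)\<in>?S. A_coeff \<alpha> b m n i j * U m n) + F_coeff \<alpha> \<phi> b i j))"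
    proof (rule sum.cong[OF refl])
      fix x assume "x \<in> ?I"
      then obtain i j where x: "x = (i, j)" "i + j < k + l" by (cases x) fastforce
      from less.hyps[OF x(2)] less.prems x
      show "(case x of (i, j) \<Rightarrow> a_coeff \<alpha> b k l i j * U i j) = (case x of (i, j) \<Rightarrow> a_coeff \<alpha> b k l i j *
          ((\<Sum>(m, n)\<in>?S. A_coeff \<alpha> b m n i j * U m n) + F_coeff \<alpha> \<phi> b i j))" by simp
    qed
    also have "\<dots> = (\<Sum>(i, j)\<in>?I. \<Sum>(m, n)\<in>?S. a_coeff \<alpha> b k l i j * A_coeff \<alpha> b m n i j * U m n)
        + (\<Sum>(i, j)\<in>?I. a_coeff \<alpha> b k l i j * F_coeff \<alpha> \<phi> b i j)"
      by (simp add: algebra_simps sum.distrib sum_distrib_left split_def)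
    also have "(\<Sum>(i, j)\<in>?I. \<Sum>(m, n)\<in>?S. a_coeff \<alpha> b k l i j * A_coeff \<alpha> b m n i j * U m n)
      = (\<Sum>(m, n)\<in>?S. A_coeff \<alpha> b m n k l * U m n)"
      using False by (simp add: A_coeff_step split_def sum_distrib_right)
        (subst sum.swap, simp)
    finally show ?thesis using False kl by (simp add: F_coeff_step)
  qed
qed

text \<open>The fraction is at most 2 and the product of the binomials at most \<open>2 ^ 7\<close>,
  hence 256. Excluding \<open>(k, l)\<close> ensures that \<open>\<alpha>\<close> is differentiated
  at least once.\<close>

lemma norm_a_coeff_le:
  assumes "1 \<le> B" "\<And>i j. 1 \<le> i + j \<Longrightarrow> i + j \<le> 7 \<Longrightarrow> norm (cderiv i j \<alpha> b) \<le> B"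
    and "0 < k" "0 < l" "k + l \<le> 7" "i \<le> k" "j \<le> l" "(i, j) \<noteq> (k, l)"
  shows "norm (a_coeff \<alpha> b k l i j) \<le> 256 * B"
proof -
  have s: "real i / real k \<le> 1" "real j / real l \<le> 1" "0 \<le> real i / real k" "0 \<le> real j / real l"
    using assms by auto
  have "(of_nat i / (2 * of_nat k) + of_nat j / (2 * of_nat l) - of_nat (i * j) / of_nat (k * l) :: complex)
    = of_real ((real i / real k) / 2 + (real j / real l) / 2 - (real i / real k) * (real j / real l))"
    by (simp add: mult.commute)
  moreover have "\<bar>(real i / real k) / 2 + (real j / real l) / 2 - (real i / real k) * (real j / real l)\<bar> \<le> 2"
  proof -
    have "\<bar>x / 2 + y / 2 - x * y\<bar> \<le> 2" if "x \<le> 1" "y \<le> 1" "0 \<le> x" "0 \<le> y" for x y :: real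
      using that mult_le_one[OF that(1,4,2)] mult_nonneg_nonneg[OF that(3,4)] by linarith
    from this[OF s] show ?thesis .
  qed
  ultimately have 1: "norm (of_nat i / (2 * of_nat k) + of_nat j / (2 * of_nat l)
      - of_nat (i * j) / of_nat (k * l) :: complex) \<le> 2"
    by (metis norm_of_real)
  have "(k choose i) * (l choose j) \<le> 2 ^ k * 2 ^ l"
    by (intro mult_mono binomial_le_pow2) auto
  also have "\<dots> \<le> (2::nat) ^ 7"
    unfolding power_add[symmetric] using assms by (intro power_increasing) auto
  finally have "(k choose i) * (l choose j) \<le> 128" by simp
  from of_nat_mono[OF this, where 'a = real]
  have 2: "real (k choose i) * real (l choose j) \<le> 128" by simp
  have "norm (cderiv (k - i) (l - j) \<alpha> b) \<le> B"
    using assms by (intro assms(2)) auto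
  moreover have "norm (a_coeff \<alpha> b k l i j) =
    norm (of_nat i / (2 * of_nat k) + of_nat j / (2 * of_nat l) - of_nat (i * j) / of_nat (k * l) :: complex)
      * (real (k choose i) * real (l choose j)) * norm (cderiv (k - i) (l - j) \<alpha> b)"
    unfolding a_coeff_def norm_mult norm_of_nat by (simp only: mult.assoc)
  ultimately have "norm (a_coeff \<alpha> b k l i j) \<le> 2 * (real (k choose i) * real (l choose j)) * B"
    using 1 by (simp only:) (intro mult_mono, auto)
  also have "\<dots> \<le> 2 * 128 * B" using 2 assms(1) by (intro mult_mono) auto
  finally show ?thesis by simp
qed

text \<open>At most 64 terms, each with a factor \<open>256 * B\<close>, give
  \<open>16384 * B\<close> for every order gained.\<close>

lemma norm_A_coeff_le:
  assumes "1 \<le> B" "\<And>i j. 1 \<le> i + j \<Longrightarrow> i + j \<le> 7 \<Longrightarrow> norm (cderiv i j \<alpha> b) \<le> B"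
    and "k + l \<le> 7"
  shows "norm (A_coeff \<alpha> b m n k l) \<le> (16384 * B) ^ (k + l)"
  using assms(3)
proof (induction "k + l" arbitrary: k l rule: less_induct)
  case less
  have B: "1 \<le> 16384 * B" using assms(1) by simp
  show ?case
  proof (cases "k * l = 0")
    case True
    then show ?thesis using one_le_power[OF B, of "k + l"] by (auto simp: A_coeff_axis)
  next
    case False
    then have kl: "0 < k" "0 < l" by auto
    let ?I = "{0..k} \<times> {0..l} - {(k, l)}"
    have "norm (A_coeff \<alpha> b m n k l) \<le> (\<Sum>(i, j)\<in>?I. 256 * B * (16384 * B) ^ (k + l - 1))"
      unfolding A_coeff_step[OF kl]
    proof (rule order.trans[OF norm_sum sum_mono])
      fix x assume "x \<in> ?I"
      then obtain i j where x: "x = (i, j)" and lt: "i + j < k + l" and ij: "i \<le> k" "j \<le> l" "(i, j) \<noteq> (k, l)"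
        by (cases x) fastforce
      then have "norm (A_coeff \<alpha> b m n i j) \<le> (16384 * B) ^ (i + j)"
        using less by auto
      also have "\<dots> \<le> (16384 * B) ^ (k + l - 1)"
        using B lt by (intro power_increasing) auto
      finally show "norm (case x of (i, j) \<Rightarrow> a_coeff \<alpha> b k l i j * A_coeff \<alpha> b m n i j)
          \<le> (case x of (i, j) \<Rightarrow> 256 * B * (16384 * B) ^ (k + l - 1))"
        unfolding x prod.case norm_mult using norm_a_coeff_le[OF assms(1,2) kl less.prems, of i j] ij assms(1)
        by (intro mult_mono) auto
    qed
    also have "\<dots> = real (card ?I) * (256 * B * (16384 * B) ^ (k + l - 1))" by simp
    also have "\<dots> \<le> 64 * (256 * B * (16384 * B) ^ (k + l - 1))"
    proof (intro mult_right_mono)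
      have "card ?I \<le> card ({0..k} \<times> {0..l})" by (intro card_mono) auto
      also have "\<dots> = (k + 1) * (l + 1)" by simp
      also have "\<dots> \<le> 8 * 8" using less.prems by (intro mult_mono) auto
      finally have "card ?I \<le> 64" by simp
      then show "real (card ?I) \<le> 64" by linarith
    qed (use assms(1) in auto)
    also have "\<dots> = (16384 * B) ^ Suc (k + l - 1)" by simp
    finally show ?thesis using kl by simp
  qed
qed

section \<open>The logarithmic coefficient and the equation in Wirtinger form\<close>

context open_plane
begin

lemma log_coeff_has_px:
  assumes "has_px a d z" "a z > 0"
  shows "has_px (log_coeff a) (- (d / a z)) z"
  using assms unfolding log_coeff_def[abs_def] has_real_derivative_iff_has_vector_derivative[symmetric]
  by (auto intro!: derivative_eq_intros)

lemma log_coeff_has_py: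
  assumes "has_py a d z" "a z > 0"
  shows "has_py (log_coeff a) (- (d / a z)) z"
  using assms unfolding log_coeff_def[abs_def] has_real_derivative_iff_has_vector_derivative[symmetric]
  by (auto intro!: derivative_eq_intros)

lemma Ck_log_coeff:
  assumes "Ck n (\<lambda>z. of_real (a z))" "\<And>z. z \<in> \<Omega> \<Longrightarrow> a z > 0"
  shows "Ck n (\<lambda>z. of_real (log_coeff a z))"
proof -
  have "continuous_on \<Omega> (\<lambda>z. Re (of_real (a z)))"
    by (intro continuous_on_Re Ck_continuous[OF assms(1)])
  then have "continuous_on \<Omega> a" by simp
  then have cont: "continuous_on \<Omega> (\<lambda>z. complex_of_real (log_coeff a z))"
    unfolding log_coeff_def using assms(2) by (auto intro!: continuous_intros simp: less_imp_neq[symmetric])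
  show ?thesis
  proof (cases n)
    case (Suc m)
    note a = assms(1)[unfolded Suc]
    have inv: "Ck m (\<lambda>z. inverse (complex_of_real (a z)))"
      using Ck_SucD[OF a] assms(2) by (intro Ck_inverse) (auto simp: less_imp_neq[symmetric])
    have p: "Ck m (\<lambda>z. complex_of_real (partial_x a z))" "Ck m (\<lambda>z. complex_of_real (partial_y a z))"
      by (rule Ck_partial_of_real[OF a])+
    have "Ck m (\<lambda>z. of_real (- (partial_x a z / a z)))" "Ck m (\<lambda>z. of_real (- (partial_y a z / a z)))"
      using Ck_uminus[OF Ck_mult[OF p(1) inv]] Ck_uminus[OF Ck_mult[OF p(2) inv]]
      by (simp_all add: divide_inverse)
    then show ?thesis
      unfolding Suc using cont Ck_of_real_partial(1,2)[OF a] assms(2)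
      by (intro Ck_SucI[of _ "\<lambda>z. of_real (- (partial_x a z / a z))" "\<lambda>z. of_real (- (partial_y a z / a z))"])
         (auto intro!: has_vector_derivative_of_real_iff[THEN iffD2] log_coeff_has_px log_coeff_has_py
           simp del: of_real_minus of_real_divide)
  qed (use cont in auto)
qed

lemma Ck_scaled_source:
  assumes "Ck n (\<lambda>z. of_real (a z))" "Ck n (\<lambda>z. of_real (f z))" "\<And>z. z \<in> \<Omega> \<Longrightarrow> a z > 0"
  shows "Ck n (\<lambda>z. of_real (scaled_source a f z))"
proof -
  have "Ck n (\<lambda>z. - (of_real (f z) * inverse (complex_of_real (a z))))"
    using assms by (intro Ck_uminus Ck_mult Ck_inverse) (auto simp: less_imp_neq[symmetric])
  then show ?thesis by (simp add: scaled_source_def divide_inverse)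
qed

text \<open>Dividing the expanded divergence by \<open>a\<close> gives the Laplacian of
  \<open>u\<close> as the product of the gradients of \<open>\<alpha>\<close> and \<open>u\<close>
  plus the scaled source. The Laplacian is four times the mixed Wirtinger derivative, and the
  product of gradients is twice the symmetric sum of products of Wirtinger derivatives.\<close>

lemma wirt_1_1_of_pde:
  assumes a: "Ck (Suc 0) (\<lambda>z. of_real (a z))" and u: "Ck 2 (\<lambda>z. of_real (u z))"
    and pos: "\<And>z. z \<in> \<Omega> \<Longrightarrow> a z > 0" and pde: "solves_pde \<Omega> a f u" and z: "z \<in> \<Omega>"
  shows "wirt 1 1 (\<lambda>z. of_real (u z)) z =
      (wirt 1 0 (\<lambda>z. of_real (log_coeff a z)) z * wirt 0 1 (\<lambda>z. of_real (u z)) z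
        + wirt 0 1 (\<lambda>z. of_real (log_coeff a z)) z * wirt 1 0 (\<lambda>z. of_real (u z)) z) / 2
      + of_real (scaled_source a f z) / 4"
proof -
  let ?u = "\<lambda>z. complex_of_real (u z)"
  have u1: "Ck (Suc 1) ?u" using u by (simp add: numeral_2_eq_2)
  have up: "Ck (Suc 0) (\<lambda>z. complex_of_real (partial_x u z))" "Ck (Suc 0) (\<lambda>z. complex_of_real (partial_y u z))"
    using Ck_partial_of_real[OF u1] by (simp_all only: One_nat_def)
  note az = Ck_of_real_partial[OF a z] and uz = Ck_of_real_partial[OF u1 z]
    and uxz = Ck_of_real_partial[OF up(1) z] and uyz = Ck_of_real_partial[OF up(2) z]
  have x: "partial_x (\<lambda>w. a w * partial_x u w) z = a z * partial_x (partial_x u) z + partial_x a z * partial_x u z"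
    using has_vector_derivative_mult[OF az(1) uxz(1)] by (intro partial_x_eqI) simp
  have y: "partial_y (\<lambda>w. a w * partial_y u w) z = a z * partial_y (partial_y u) z + partial_y a z * partial_y u z"
    using has_vector_derivative_mult[OF az(2) uyz(2)] by (intro partial_y_eqI) simp
  have lap: "partial_x (partial_x u) z + partial_y (partial_y u) z
    = - (f z / a z) - partial_x a z / a z * partial_x u z - partial_y a z / a z * partial_y u z"
  proof -
    have "- (a z * partial_x (partial_x u) z + partial_x a z * partial_x u z
      + (a z * partial_y (partial_y u) z + partial_y a z * partial_y u z)) = f z"
      using bspec[OF pde[unfolded solves_pde_def] z] unfolding x y .
    then have "partial_x (partial_x u) z + partial_y (partial_y u) z
      = (- f z - partial_x a z * partial_x u z - partial_y a z * partial_y u z) / a z"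
      using pos[OF z] by (simp add: eq_divide_eq algebra_simps)
    then show ?thesis by (simp add: diff_divide_distrib)
  qed
  have xx: "partial_x (partial_x ?u) z = of_real (partial_x (partial_x u) z)"
    using partial_x_cong[OF Ck_of_real_partial(3)[OF u1] z] uxz(3) by simp
  have yy: "partial_y (partial_y ?u) z = of_real (partial_y (partial_y u) z)"
    using partial_y_cong[OF Ck_of_real_partial(4)[OF u1] z] uyz(4) by simp
  have "ddir 1 (- \<i>) (ddir 1 \<i> ?u) z = ddir 1 (- \<i>) (partial_x ?u) z + \<i> * ddir 1 (- \<i>) (partial_y ?u) z"
  proof -
    have "Ck (Suc 0) (partial_x ?u)" "Ck (Suc 0) (partial_y ?u)" using u1 by auto
    then show ?thesis
      using ddir_add[of 0 "partial_x ?u" "\<lambda>z. \<i> * partial_y ?u z" z 1 "- \<i>"]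
        ddir_cmult[of 0 "partial_y ?u" z 1 "- \<i>" "\<i>"] z
      by (simp add: ddir_def[of 1 "\<i>", abs_def] Ck_mult Ck_const del: Ck.simps)
  qed
  also have "\<dots> = partial_x (partial_x ?u) z + partial_y (partial_y ?u) z"
    using mixed_partials_commute[OF u z] by (simp add: ddir_def algebra_simps)
  also have "\<dots> = of_real (partial_x (partial_x u) z + partial_y (partial_y u) z)"
    by (simp add: xx yy)
  finally have w11: "wirt 1 1 ?u z = of_real (partial_x (partial_x u) z + partial_y (partial_y u) z) / 4"
    by (simp add: wirt_def)
  have lx: "partial_x (\<lambda>z. complex_of_real (log_coeff a z)) z = of_real (- (partial_x a z / a z))"
    by (intro partial_x_eqI has_vector_derivative_of_real_iff[THEN iffD2] log_coeff_has_px az pos z)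
  have ly: "partial_y (\<lambda>z. complex_of_real (log_coeff a z)) z = of_real (- (partial_y a z / a z))"
    by (intro partial_y_eqI has_vector_derivative_of_real_iff[THEN iffD2] log_coeff_has_py az pos z)
  \<comment> \<open>\<open>A\<close> and \<open>B\<close> stand for the partial derivatives of
    \<open>a\<close> divided by \<open>a\<close>, that is, for those of \<open>ln a\<close>; hence
    the minus signs.\<close>
  have eq: "complex_of_real (- F - A * X - B * Y) / 4
    = ((- of_real A + \<i> * of_real B) / 2 * ((of_real X + \<i> * of_real Y) / 2)
      + (- of_real A - \<i> * of_real B) / 2 * ((of_real X - \<i> * of_real Y) / 2)) / 2 - of_real F / 4"
    for A B X Y F :: real
    by (simp add: complex_eq_iff field_simps)
  show ?thesis
    unfolding w11 lap
    using eq[of "f z / a z" "partial_x a z / a z" "partial_x u z" "partial_y a z / a z" "partial_y u z"]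
    by (simp add: wirt_def ddir_def lx ly uz scaled_source_def)
qed

end

section \<open>Moments on the stencil and the linear system\<close>

lemma stencil_eq: "stencil = {-1, 0, 1} \<times> {-1, 0, 1}"
proof -
  have "{-1..1} \<inter> \<int> = {-1, 0, 1 :: real}"
  proof (intro equalityI subsetI)
    fix x :: real assume "x \<in> {-1..1} \<inter> \<int>"
    then obtain n :: int where n: "x = of_int n" "-1 \<le> n" "n \<le> 1"
      by (auto elim!: Ints_cases)
    then have "n = -1 \<or> n = 0 \<or> n = 1" by auto
    then show "x \<in> {-1, 0, 1}" using n by auto
  qed auto
  then show ?thesis by (simp add: stencil_def)
qed

lemma finite_stencil: "finite stencil"
  by (simp add: stencil_eq)

lemma card_stencil: "card stencil = 9"
  by (simp add: stencil_eq card_cartesian_product)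

lemma sum_stencil: "(\<Sum>p\<in>stencil. f p) =
    f (-1, -1) + f (-1, 0) + f (-1, 1) + f (0, -1) + f (0, 0) + f (0, 1) + f (1, -1) + f (1, 0) + f (1, 1)"
  for f :: "plane \<Rightarrow> 'a::comm_monoid_add"
  by (simp add: stencil_eq sum.cartesian_product[symmetric] add_ac)

definition moment :: "nat \<Rightarrow> nat \<Rightarrow> (plane \<Rightarrow> real) \<Rightarrow> complex" where
  "moment k l w = (\<Sum>p\<in>stencil. Complex (fst p) (snd p) ^ k * Complex (fst p) (- snd p) ^ l * of_real (w p))"

text \<open>Up to scaling, the compact nine-point discretisation of the negative Laplacian
  (Mehrstellen stencil).\<close>

definition base_weight :: "plane \<Rightarrow> real" where
  "base_weight p = (if p = (0, 0) then 20 else if fst p * snd p = 0 then -4 else -1)"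

text \<open>On the stencil, \<open>z ^ 4 = \<bar>z\<bar> ^ 4\<close> at the edge midpoints and \<open>z ^ 4 = - \<bar>z\<bar> ^ 4\<close>
  at the corners, so the sums over the edges and over the corners of \<open>z * w z\<close> are determined by
  the first and the third moment.\<close>

definition moment_weight :: "complex \<Rightarrow> complex \<Rightarrow> complex \<Rightarrow> real \<Rightarrow> plane \<Rightarrow> real" where
  "moment_weight s1 s2 s3 s4 p =
    (if p = (0, 0) then - s4
     else if fst p * snd p = 0 then
       (Re (2 * s1 + cnj s3) * fst p + Im (2 * s1 + cnj s3) * snd p) / 6
         + Re s2 * (fst p ^ 2 - snd p ^ 2) / 4 + s4 / 4
     else (Re (s1 - cnj s3) * fst p + Im (s1 - cnj s3) * snd p) / 12 + Im s2 * fst p * snd p / 8)"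

text \<open>Let \<open>E\<close> and \<open>K\<close> be the sums of \<open>z * w\<close> over the
  edge midpoints and the corners. Then \<open>s1 = E + K\<close>, \<open>cnj s3 = E - 2 K\<close>
  and the fifth moment is \<open>E - 4 K\<close>, which gives its formula. The real part of
  \<open>s2\<close> lives on the edges and its imaginary part on the corners, where
  \<open>z ^ 4 = -4\<close>; this gives the sixth moment. The central weight only restores the
  vanishing sum.\<close>

lemma moment_moment_weight:
  "moment 0 0 (moment_weight s1 s2 s3 s4) = 0"
  "moment 1 0 (moment_weight s1 s2 s3 s4) = s1"
  "moment 2 0 (moment_weight s1 s2 s3 s4) = s2"
  "moment 3 0 (moment_weight s1 s2 s3 s4) = s3"
  "moment 4 0 (moment_weight s1 s2 s3 s4) = of_real s4"
  "moment 5 0 (moment_weight s1 s2 s3 s4) = (- 2 * s1 + 5 * cnj s3) / 3"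
  "moment 6 0 (moment_weight s1 s2 s3 s4) = Complex (Re s2) (- 4 * Im s2)"
  "moment 4 1 (moment_weight s1 0 0 0) = - 2 / 3 * cnj s1"
  by (simp_all add: moment_def sum_stencil moment_weight_def complex_eq_iff eval_nat_numeral field_simps)

text \<open>The weights are invariant under multiplication by \<open>\<i>\<close>, so moment
  \<open>(k, l)\<close> vanishes unless 4 divides \<open>k - l\<close>. Of the moments left, those
  of orders \<open>(0, 0)\<close> and \<open>(4, 0)\<close> cancel between centre, edges and
  corners; \<open>(1, 1)\<close> and \<open>(5, 1)\<close> survive.\<close>

lemma moment_base_weight:
  "m \<le> 7 \<Longrightarrow> moment m 0 base_weight = 0"
  "moment 1 1 base_weight = -24" "moment 2 1 base_weight = 0" "moment 3 1 base_weight = 0"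
  "moment 4 1 base_weight = 0" "moment 5 1 base_weight = 16" "moment 6 1 base_weight = 0"
  "moment 4 2 base_weight = 0"
proof -
  assume "m \<le> 7"
  then have "m \<in> {0,1,2,3,4,5,6,7}" by auto
  then show "moment m 0 base_weight = 0"
    by (auto simp: moment_def sum_stencil base_weight_def complex_eq_iff eval_nat_numeral)
qed (simp_all add: moment_def sum_stencil base_weight_def complex_eq_iff eval_nat_numeral)

lemma abs_moment_weight_le:
  assumes "p \<in> stencil"
  shows "\<bar>moment_weight s1 s2 s3 s4 p\<bar> \<le> 2 * (norm s1 + norm s2 + norm s3 + \<bar>s4\<bar>)"
proof -
  have b: "Re z \<le> norm z" "- norm z \<le> Re z" "Im z \<le> norm z" "- norm z \<le> Im z" for z
    using abs_Re_le_cmod[of z] abs_Im_le_cmod[of z] by linarith+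
  define S where "S = \<bar>s4\<bar>"
  have S: "s4 \<le> S" "- s4 \<le> S" by (auto simp: S_def)
  note b = S b[of s1] b[of s2] b[of s3] norm_ge_zero[of s1] norm_ge_zero[of s2] norm_ge_zero[of s3]
  have "p \<in> {(-1, -1), (-1, 0), (-1, 1), (0, -1), (0, 0), (0, 1), (1, -1), (1, 0), (1, 1)}"
    using assms by (auto simp: stencil_eq)
  then consider "p = (-1, -1)" | "p = (-1, 0)" | "p = (-1, 1)" | "p = (0, -1)" | "p = (0, 0)"
    | "p = (0, 1)" | "p = (1, -1)" | "p = (1, 0)" | "p = (1, 1)"
    by blast
  then show ?thesis
    unfolding S_def[symmetric]
    by (cases; intro abs_leI; use b norm_ge_zero in \<open>simp add: moment_weight_def field_simps\<close>)
qed

text \<open>The share of weights \<open>w\<close> in the equation for the derivative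
  \<open>(m, 0)\<close> when they stand \<open>r\<close> levels below the current one. In these
  terms the system is a convolution over the levels.\<close>

definition A_sum :: "(plane \<Rightarrow> real) \<Rightarrow> plane \<Rightarrow> nat \<Rightarrow> nat \<Rightarrow> (plane \<Rightarrow> real) \<Rightarrow> complex" where
  "A_sum \<alpha> b m r w = (\<Sum>p\<in>stencil. A_poly \<alpha> b (m + r) m 0 p * of_real (w p))"

lemma A_poly_alt: "A_poly \<alpha> b (m + r) m 0 p =
    (\<Sum>i\<le>r. N_mono (m + i) (r - i) p * A_coeff \<alpha> b m 0 (m + i) (r - i))"
  unfolding A_poly_def
  by (rule sum.reindex_bij_witness[of _ "\<lambda>i. m + i" "\<lambda>j. j - m"]) (auto simp: add.commute)

text \<open>Weights enter the system only through their moments, including mixed ones as soon as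
  \<open>r > 0\<close>.\<close>

lemma A_sum_eq: "A_sum \<alpha> b m r w =
    (\<Sum>i\<le>r. A_coeff \<alpha> b m 0 (m + i) (r - i) / (fact (m + i) * fact (r - i)) * moment (m + i) (r - i) w)"
proof -
  have "A_sum \<alpha> b m r w = (\<Sum>p\<in>stencil. \<Sum>i\<le>r. N_mono (m + i) (r - i) p * A_coeff \<alpha> b m 0 (m + i) (r - i) * of_real (w p))"
    by (simp add: A_sum_def A_poly_alt sum_distrib_right)
  also have "\<dots> = (\<Sum>i\<le>r. \<Sum>p\<in>stencil. N_mono (m + i) (r - i) p * A_coeff \<alpha> b m 0 (m + i) (r - i) * of_real (w p))"
    by (rule sum.swap)
  finally show ?thesis
    by (simp add: moment_def N_mono_def sum_distrib_left mult_ac)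
qed

lemma A_sum_0: "A_sum \<alpha> b m 0 w = moment m 0 w / fact m"
  by (simp add: A_sum_eq A_coeff_axis)

text \<open>The equations with \<open>m = 0\<close> have no contribution from earlier levels, so
  they say that each level sums to zero.\<close>

lemma A_sum_0_left:
  assumes "0 < r"
  shows "A_sum \<alpha> b 0 r w = 0"
proof -
  have "A_coeff \<alpha> b 0 0 (0 + i) (r - i) = 0" for i
    by (rule A_coeff_0_0) (use assms in auto)
  then show ?thesis by (simp add: A_sum_eq)
qed

lemma A_coeff_m_1: "0 < m \<Longrightarrow> A_coeff \<alpha> b m 0 m (Suc 0) = cderiv 0 1 \<alpha> b / 2"
proof -
  assume m: "0 < m"
  have "{m..m} \<times> {0..Suc 0} - {(m, Suc 0)} = {(m, 0)}" by auto
  then show ?thesis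
    using m by (subst A_coeff.simps) (simp add: A_coeff_axis a_coeff_def)
qed

lemma A_sum_1: "0 < m \<Longrightarrow> A_sum \<alpha> b m (Suc 0) w = cderiv 0 1 \<alpha> b / 2 / fact m * moment m 1 w"
  by (simp add: A_sum_eq A_coeff_m_1 A_coeff_axis)

text \<open>For \<open>m = 4\<close> and \<open>r = 2\<close> this coefficient is the one multiplied
  by a nonzero moment of the base weights, namely \<open>(5, 1)\<close>.\<close>

lemma A_coeff_4_5_1: "A_coeff \<alpha> b 4 0 5 1 = 2 * cderiv 1 1 \<alpha> b + cderiv 1 0 \<alpha> b * cderiv 0 1 \<alpha> b / 4"
proof -
  have "({4..5} \<times> {0..1} - {(5, 1)} :: (nat \<times> nat) set) = {(4, 0), (5, 0), (4, 1)}"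
    by auto
  moreover have "5 choose 4 = (5::nat)" by (simp add: eval_nat_numeral)
  ultimately show ?thesis
    by (subst A_coeff.simps) (simp add: A_coeff_axis A_coeff_m_1 a_coeff_def binomial_eq_0)
qed

lemma A_poly_uminus: "A_poly \<alpha> b k m 0 (- p) = (-1) ^ k * A_poly \<alpha> b k m 0 p"
proof -
  have "N_mono j l (- p) = (-1) ^ (j + l) * N_mono j l p" for j l
  proof -
    have "Complex (- fst p) (- snd p) = - Complex (fst p) (snd p)"
      "Complex (- fst p) (snd p) = - Complex (fst p) (- snd p)" by (simp_all add: complex_eq_iff)
    then show ?thesis
      by (simp add: N_mono_def power_add power_minus[of "Complex (fst p) (snd p)"]
          power_minus[of "Complex (fst p) (- snd p)"])
  qed
  then show ?thesis by (simp add: A_poly_def sum_distrib_left mult_ac)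
qed

text \<open>\<open>A_poly\<close> is homogeneous of degree \<open>m + r\<close> in the point, so
  reflecting the stencil turns the sum into its negative.\<close>

lemma A_sum_parity:
  assumes "\<And>p. p \<in> stencil \<Longrightarrow> w (- p) = \<sigma> * w p" "(-1) ^ (m + r) * \<sigma> = -1"
  shows "A_sum \<alpha> b m r w = 0"
proof -
  have "A_sum \<alpha> b m r w = (\<Sum>p\<in>stencil. A_poly \<alpha> b (m + r) m 0 (- p) * of_real (w (- p)))"
    unfolding A_sum_def by (simp add: sum_stencil add_ac)
  also have "\<dots> = (\<Sum>p\<in>stencil. of_real ((-1) ^ (m + r) * \<sigma>) * (A_poly \<alpha> b (m + r) m 0 p * of_real (w p)))"
    using assms(1) by (intro sum.cong) (auto simp: A_poly_uminus)
  also have "\<dots> = - A_sum \<alpha> b m r w"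
    unfolding assms(2) A_sum_def by (simp add: sum_negf)
  finally show ?thesis by simp
qed

text \<open>Each level takes the particular solution \<open>moment_weight\<close> without any
  multiple of the kernel, which preserves parity. \<open>Re\<close> discards the imaginary part of
  the fourth moment, and the equations with \<open>m = 5, 6\<close> are not imposed;
  \<open>moment_sys_weight\<close> shows that they hold anyway. The cut-off
  \<open>m + j \<le> 7\<close> marks the equations present for \<open>M = 6\<close>.\<close>

function sys_weight :: "(plane \<Rightarrow> real) \<Rightarrow> plane \<Rightarrow> nat \<Rightarrow> plane \<Rightarrow> real" where
  "sys_weight \<alpha> b j =
    (if j = 0 then base_weight
     else let s = (\<lambda>m. if m + j \<le> 7 then - fact m * (\<Sum>k<j. A_sum \<alpha> b m (j - k) (sys_weight \<alpha> b k)) else 0)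
       in moment_weight (s 1) (s 2) (s 3) (Re (s 4)))"
  by pat_completeness auto
termination
  by (relation "Wellfounded.measure (\<lambda>(\<alpha>, b, j). j)") auto

declare sys_weight.simps [simp del]

definition sys_rhs :: "(plane \<Rightarrow> real) \<Rightarrow> plane \<Rightarrow> nat \<Rightarrow> nat \<Rightarrow> complex" where
  "sys_rhs \<alpha> b j m =
    (if m + j \<le> 7 then - fact m * (\<Sum>k<j. A_sum \<alpha> b m (j - k) (sys_weight \<alpha> b k)) else 0)"

lemma sys_weight_0: "sys_weight \<alpha> b 0 = base_weight"
  by (subst sys_weight.simps) simp

lemma sys_weight_eq: "0 < j \<Longrightarrow> sys_weight \<alpha> b j =
    moment_weight (sys_rhs \<alpha> b j 1) (sys_rhs \<alpha> b j 2) (sys_rhs \<alpha> b j 3) (Re (sys_rhs \<alpha> b j 4))"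
  by (subst sys_weight.simps) (simp add: sys_rhs_def Let_def)

lemma sys_rhs_0: "sys_rhs \<alpha> b j 0 = 0"
  by (simp add: sys_rhs_def A_sum_0_left)

lemma sys_rhs_1:
  "0 < m \<Longrightarrow> m \<le> 6 \<Longrightarrow> sys_rhs \<alpha> b 1 m = - cderiv 0 1 \<alpha> b / 2 * moment m 1 base_weight"
  by (simp add: sys_rhs_def A_sum_1 sys_weight_0)

text \<open>The moments \<open>(2, 1)\<close>, \<open>(3, 1)\<close> and \<open>(4, 1)\<close> of
  the base weights vanish, and \<open>(1, 1)\<close> is -24, whence the factor 12.\<close>

lemma sys_weight_1: "sys_weight \<alpha> b 1 = moment_weight (12 * cderiv 0 1 \<alpha> b) 0 0 0"
  by (simp only: sys_weight_eq zero_less_one sys_rhs_1 moment_base_weight) (simp add: sys_rhs_1 moment_base_weight)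

lemma base_weight_uminus: "base_weight (- p) = 1 * base_weight p"
  by (cases p) (auto simp: base_weight_def zero_prod_def)

lemma sys_weight_1_uminus: "sys_weight \<alpha> b 1 (- p) = - 1 * sys_weight \<alpha> b 1 p"
  by (cases p) (auto simp: sys_weight_1[unfolded One_nat_def] moment_weight_def field_simps)

lemma sys_rhs_2_odd: "odd m \<Longrightarrow> sys_rhs \<alpha> b 2 m = 0"
  using A_sum_parity[where w = base_weight and \<sigma> = 1, OF base_weight_uminus, of m 2 \<alpha> b] A_sum_parity[where w = "sys_weight \<alpha> b 1" and \<sigma> = "- 1", OF sys_weight_1_uminus, of m 1 \<alpha> b]
  by (simp add: sys_rhs_def numeral_2_eq_2 sys_weight_0)

lemma sys_weight_2_uminus: "sys_weight \<alpha> b 2 (- p) = 1 * sys_weight \<alpha> b 2 p"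
  by (cases p) (auto simp: sys_weight_eq sys_rhs_2_odd moment_weight_def field_simps)

text \<open>Level \<open>k\<close> has parity \<open>k\<close> for \<open>k \<le> 2\<close> and
  meets a polynomial of degree \<open>7 - k\<close>, so every summand is odd and vanishes.\<close>

lemma sys_rhs_3_4: "sys_rhs \<alpha> b 3 4 = 0"
  using A_sum_parity[where w = base_weight and \<sigma> = 1, OF base_weight_uminus, of 4 3 \<alpha> b] A_sum_parity[where w = "sys_weight \<alpha> b 1" and \<sigma> = "- 1", OF sys_weight_1_uminus, of 4 2 \<alpha> b]
    A_sum_parity[where w = "sys_weight \<alpha> b 2" and \<sigma> = 1, OF sys_weight_2_uminus, of 4 1 \<alpha> b]
  by (simp add: sys_rhs_def eval_nat_numeral sys_weight_0)

text \<open>Only two kinds of terms occur: the mixed derivative of \<open>\<alpha>\<close>, a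
  quarter of its Laplacian, and a first derivative times its conjugate. Both are real.\<close>

lemma sys_rhs_2_4:
  assumes "\<And>i j. i + j \<le> 2 \<Longrightarrow> cnj (cderiv i j \<alpha> b) = cderiv j i \<alpha> b"
  shows "of_real (Re (sys_rhs \<alpha> b 2 4)) = sys_rhs \<alpha> b 2 4"
proof -
  let ?g = "cderiv 0 1 \<alpha> b"
  have g: "cderiv 1 0 \<alpha> b = cnj ?g" and h: "cnj (cderiv 1 1 \<alpha> b) = cderiv 1 1 \<alpha> b"
    using assms[of 0 1] assms[of 1 1] by auto
  have A2: "A_sum \<alpha> b 4 2 base_weight = A_coeff \<alpha> b 4 0 5 1 / 120 * 16"
    by (simp add: A_sum_eq moment_base_weight A_coeff_axis numeral_2_eq_2 fact_numeral)
       (simp add: moment_base_weight[unfolded One_nat_def numeral_2_eq_2] fact_numeral)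
  have "sys_rhs \<alpha> b 2 4 = - 24 * (A_sum \<alpha> b 4 2 base_weight + A_sum \<alpha> b 4 1 (sys_weight \<alpha> b 1))"
    by (simp add: sys_rhs_def lessThan_Suc sys_weight_0 numeral_2_eq_2 fact_numeral)
  also have "A_sum \<alpha> b 4 1 (sys_weight \<alpha> b 1) = ?g / 2 / 24 * (- 8 * cnj ?g)"
    by (simp only: One_nat_def A_sum_1 zero_less_numeral)
       (simp add: sys_weight_1[unfolded One_nat_def] moment_moment_weight(8)[unfolded One_nat_def] fact_numeral)
  finally have "cnj (sys_rhs \<alpha> b 2 4) = sys_rhs \<alpha> b 2 4"
    by (simp add: A2 A_coeff_4_5_1 g h mult_ac del: One_nat_def)
  then show ?thesis by (simp add: complex_eq_iff)
qed

text \<open>For \<open>m \<le> 3\<close> this is the construction. Compatibility matters for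
  \<open>m = 4\<close>, \<open>j \<le> 3\<close>, where the right-hand side must be real, for
  \<open>m = 5\<close>, \<open>j \<le> 2\<close>, and for \<open>m = 6\<close>,
  \<open>j = 1\<close>. At \<open>j = 1\<close>, \<open>m = 5\<close> both sides are -8 times
  \<open>cderiv 0 1 \<alpha> b\<close>: once as \<open>- 2 / 3\<close> of the first moment, once as
  \<open>- 1 / 2\<close> times the moment 16. At \<open>j = 2\<close>, \<open>m = 5\<close> both
  sides vanish by parity.\<close>

lemma moment_sys_weight:
  assumes cnj: "\<And>i j. i + j \<le> 2 \<Longrightarrow> cnj (cderiv i j \<alpha> b) = cderiv j i \<alpha> b"
    and j: "0 < j" and m: "m + j \<le> 7"
  shows "moment m 0 (sys_weight \<alpha> b j) = sys_rhs \<alpha> b j m"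
proof -
  have "m = 0 \<or> m = 1 \<or> m = 2 \<or> m = 3 \<or> m = 4 \<and> (j = 1 \<or> j = 2 \<or> j = 3)
    \<or> m = 5 \<and> (j = 1 \<or> j = 2) \<or> m = 6 \<and> j = 1"
    using j m by presburger
  then show ?thesis
    by (elim disjE conjE)
      (simp_all add: sys_weight_eq[OF j] moment_moment_weight[unfolded One_nat_def] sys_rhs_0,
       simp_all add: sys_weight_eq moment_moment_weight sys_rhs_1[unfolded One_nat_def] sys_rhs_3_4
         moment_base_weight[unfolded One_nat_def] sys_rhs_2_4 cnj sys_rhs_2_odd complex_eq_iff)
qed

text \<open>Convolution with the powers of \<open>K\<close>: solutions of the system are preserved, and a large \<open>K\<close>
  lets the multiples of the zeroth weight determine all signs.\<close>

primrec boost :: "real \<Rightarrow> (nat \<Rightarrow> plane \<Rightarrow> real) \<Rightarrow> nat \<Rightarrow> plane \<Rightarrow> real" where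
  "boost K d 0 = d 0"
| "boost K d (Suc j) = (\<lambda>p. K * boost K d j p + d (Suc j) p)"

lemma A_sum_lincomb: "A_sum \<alpha> b m r (\<lambda>p. K * w p + v p) = of_real K * A_sum \<alpha> b m r w + A_sum \<alpha> b m r v"
  by (simp add: A_sum_def algebra_simps sum.distrib sum_distrib_left)

lemma convolution_sys_weight:
  assumes "\<And>i j. i + j \<le> 2 \<Longrightarrow> cnj (cderiv i j \<alpha> b) = cderiv j i \<alpha> b" "m + j \<le> 7"
  shows "(\<Sum>k\<le>j. A_sum \<alpha> b m (j - k) (sys_weight \<alpha> b k)) = 0"
proof (cases "j = 0")
  case True
  then show ?thesis using assms(2) by (simp add: sys_weight_0 A_sum_0 moment_base_weight)
next
  case False
  then show ?thesis
    using moment_sys_weight[OF assms(1), of j m] assms(2)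
    by (simp add: sys_rhs_def lessThan_Suc_atMost[symmetric] A_sum_0)
qed

lemma convolution_boost:
  assumes "\<And>j. m + j \<le> 7 \<Longrightarrow> (\<Sum>k\<le>j. A_sum \<alpha> b m (j - k) (d k)) = 0" "m + j \<le> 7"
  shows "(\<Sum>k\<le>j. A_sum \<alpha> b m (j - k) (boost K d k)) = 0"
  using assms(2)
proof (induction j)
  case (Suc j)
  have "(\<Sum>k\<le>Suc j. A_sum \<alpha> b m (Suc j - k) (boost K d k))
    = of_real K * (\<Sum>k\<le>j. A_sum \<alpha> b m (j - k) (boost K d k))
      + (\<Sum>k\<le>Suc j. A_sum \<alpha> b m (Suc j - k) (d k))"
    unfolding sum.atMost_Suc_shift
    by (simp add: A_sum_lincomb sum.distrib sum_distrib_left)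
  then show ?case using Suc assms(1)[of "Suc j"] by simp
qed (use assms(1)[of 0] in simp)

text \<open>As a homogeneous convolution the system is stable under multiplying the generating
  series of the levels by a power series, which is what \<open>boost\<close> uses.\<close>

lemma full_system_iff:
  "full_system \<alpha> b 6 c \<longleftrightarrow>
    (\<forall>j m. m + j \<le> 7 \<longrightarrow> (\<Sum>k\<le>j. A_sum \<alpha> b m (j - k) (\<lambda>p. c p k)) = 0)"
proof -
  have 1: "(\<Sum>p\<in>stencil. A_poly \<alpha> b m m 0 p * of_real (c p j)) = A_sum \<alpha> b m 0 (\<lambda>p. c p j)" for m j
    by (simp add: A_sum_def)
  have 2: "(\<Sum>k<j. \<Sum>p\<in>stencil. A_poly \<alpha> b (m + j - k) m 0 p * of_real (c p k))
    = (\<Sum>k<j. A_sum \<alpha> b m (j - k) (\<lambda>p. c p k))" for m j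
    by (intro sum.cong refl) (simp add: A_sum_def)
  have "(\<Sum>k\<le>j. A_sum \<alpha> b m (j - k) (\<lambda>p. c p k))
    = (\<Sum>k<j. A_sum \<alpha> b m (j - k) (\<lambda>p. c p k)) + A_sum \<alpha> b m 0 (\<lambda>p. c p j)" for m j
    by (simp add: lessThan_Suc_atMost[symmetric])
  then show ?thesis
    unfolding full_system_def system_part_def 1 2
    by (auto simp: eq_neg_iff_add_eq_0 add.commute)
qed

section \<open>Bounds and signs of the solution\<close>

lemma norm_N_mono_le:
  assumes "p \<in> stencil"
  shows "norm (N_mono k l p) \<le> 2 ^ (k + l)"
proof -
  have c: "\<bar>fst p\<bar> \<le> 1" "\<bar>snd p\<bar> \<le> 1" using assms by (auto simp: stencil_eq)
  have n: "norm (Complex (fst p) (snd p)) \<le> 2" "norm (Complex (fst p) (- snd p)) \<le> 2"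
    using cmod_le[of "Complex (fst p) (snd p)"] cmod_le[of "Complex (fst p) (- snd p)"] c by auto
  have "norm (N_mono k l p) \<le> norm (Complex (fst p) (snd p)) ^ k * norm (Complex (fst p) (- snd p)) ^ l / 1"
    unfolding N_mono_def norm_divide norm_mult norm_power norm_fact
    by (intro divide_left_mono) (auto simp: mult_ge1_I)
  also have "\<dots> \<le> 2 ^ k * 2 ^ l" using n by (simp add: mult_mono power_mono)
  finally show ?thesis by (simp add: power_add)
qed

text \<open>At most 8 summands with \<open>N_mono\<close> bounded by \<open>2 ^ 7\<close> give the
  factor 1024.\<close>

definition A_bd :: "real \<Rightarrow> real" where
  "A_bd B = 1024 * (16384 * B) ^ 7"

lemma A_bd_ge_1: "1 \<le> B \<Longrightarrow> 1 \<le> A_bd B"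
  using one_le_power[of "16384 * B" 7] by (simp add: A_bd_def)

lemma norm_A_poly_le:
  assumes "1 \<le> B" "\<And>i j. 1 \<le> i + j \<Longrightarrow> i + j \<le> 7 \<Longrightarrow> norm (cderiv i j \<alpha> b) \<le> B"
    and "k \<le> 7" "p \<in> stencil"
  shows "norm (A_poly \<alpha> b k m n p) \<le> A_bd B"
proof -
  let ?J = "{j. m \<le> j \<and> j + n \<le> k}"
  have J: "?J \<subseteq> {..7}" using assms(3) by auto
  then have f: "finite ?J" by (rule finite_subset) auto
  have "norm (A_poly \<alpha> b k m n p) \<le> (\<Sum>j\<in>?J. 128 * (16384 * B) ^ 7)"
    unfolding A_poly_def
  proof (rule order.trans[OF norm_sum sum_mono])
    fix j assume "j \<in> ?J"
    then have jk: "j + (k - j) = k" by simp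
    have "norm (N_mono j (k - j) p) \<le> 2 ^ 7"
      using norm_N_mono_le[OF assms(4), of j "k - j"] power_increasing[of k 7 "2::real"] assms(3)
      unfolding jk by linarith
    moreover have "norm (A_coeff \<alpha> b m n j (k - j)) \<le> (16384 * B) ^ 7"
      using norm_A_coeff_le[OF assms(1,2), of j "k - j" m n] power_increasing[of k 7 "16384 * B"] assms(1,3)
      unfolding jk by simp
    ultimately show "norm (N_mono j (k - j) p * A_coeff \<alpha> b m n j (k - j)) \<le> 128 * (16384 * B) ^ 7"
      unfolding norm_mult by (intro mult_mono) auto
  qed
  also have "\<dots> = real (card ?J) * (128 * (16384 * B) ^ 7)" by simp
  also have "\<dots> \<le> 8 * (128 * (16384 * B) ^ 7)"
    using card_mono[OF _ J] assms(1) by (intro mult_right_mono) auto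
  finally show ?thesis by (simp add: A_bd_def)
qed

lemma norm_A_sum_le:
  assumes "1 \<le> B" "\<And>i j. 1 \<le> i + j \<Longrightarrow> i + j \<le> 7 \<Longrightarrow> norm (cderiv i j \<alpha> b) \<le> B"
    and "m + r \<le> 7" "\<And>p. p \<in> stencil \<Longrightarrow> \<bar>w p\<bar> \<le> W"
  shows "norm (A_sum \<alpha> b m r w) \<le> 9 * (A_bd B * W)"
proof -
  have "norm (A_sum \<alpha> b m r w) \<le> (\<Sum>p\<in>stencil. A_bd B * W)"
    unfolding A_sum_def
  proof (rule order.trans[OF norm_sum sum_mono])
    fix p assume "p \<in> stencil"
    then show "norm (A_poly \<alpha> b (m + r) m 0 p * of_real (w p)) \<le> A_bd B * W"
      using norm_A_poly_le[OF assms(1,2), of "m + r" p m 0] assms(3) assms(4)[of p] A_bd_ge_1[OF assms(1)]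
      by (auto simp: norm_mult intro!: mult_mono)
  qed
  then show ?thesis by (simp add: card_stencil)
qed

text \<open>Here 20 is the largest base weight and 2540160 is \<open>8 * 5040 * 7 * 9\<close>: four
  moments with the factor 2 of \<open>abs_moment_weight_le\<close>, the factorial of 7, at most 7
  earlier levels and 9 stencil points.\<close>

definition sys_bd :: "real \<Rightarrow> real" where
  "sys_bd B = 20 * (2540160 * A_bd B) ^ 7"

lemma abs_sys_weight_le:
  assumes B: "1 \<le> B" "\<And>i j. 1 \<le> i + j \<Longrightarrow> i + j \<le> 7 \<Longrightarrow> norm (cderiv i j \<alpha> b) \<le> B"
    and "j \<le> 7" "p \<in> stencil"
  shows "\<bar>sys_weight \<alpha> b j p\<bar> \<le> 20 * (2540160 * A_bd B) ^ j"
  using assms(3,4)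
proof (induction j arbitrary: p rule: less_induct)
  case (less j)
  let ?Q = "2540160 * A_bd B"
  have Q: "1 \<le> ?Q" using A_bd_ge_1[OF B(1)] by simp
  show ?case
  proof (cases "j = 0")
    case True
    then show ?thesis by (auto simp: sys_weight_0 base_weight_def)
  next
    case False
    let ?W = "20 * ?Q ^ (j - 1)"
    have W: "\<bar>sys_weight \<alpha> b k q\<bar> \<le> ?W" if "k < j" "q \<in> stencil" for k q
    proof -
      have "?Q ^ k \<le> ?Q ^ (j - 1)" using that(1) Q by (intro power_increasing) auto
      then show ?thesis using less.IH[OF that(1) _ that(2)] less.prems(1) that(1) by simp
    qed
    have W0: "0 \<le> ?W" using Q by simp
    have s: "norm (sys_rhs \<alpha> b j m) \<le> 5040 * (7 * (9 * (A_bd B * ?W)))" for m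
    proof (cases "m + j \<le> 7")
      case True
      have "norm (\<Sum>k<j. A_sum \<alpha> b m (j - k) (sys_weight \<alpha> b k)) \<le> (\<Sum>k<j. 9 * (A_bd B * ?W))"
        by (intro order.trans[OF norm_sum sum_mono] norm_A_sum_le[OF B] W) (use True in auto)
      also have "\<dots> = real j * (9 * (A_bd B * ?W))" by simp
      also have "\<dots> \<le> 7 * (9 * (A_bd B * ?W))"
        using less.prems(1) W0 A_bd_ge_1[OF B(1)] by (intro mult_right_mono) auto
      finally have 1: "norm (\<Sum>k<j. A_sum \<alpha> b m (j - k) (sys_weight \<alpha> b k)) \<le> 7 * (9 * (A_bd B * ?W))" .
      have 2: "(fact m :: real) \<le> 5040"
        using fact_mono[of m 7, where 'a = real] True by (simp add: fact_numeral)
      have "norm (sys_rhs \<alpha> b j m) = fact m * norm (\<Sum>k<j. A_sum \<alpha> b m (j - k) (sys_weight \<alpha> b k))"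
        using True by (simp add: sys_rhs_def norm_mult)
      then show ?thesis
        by (simp only:) (intro mult_mono 1 2, auto)
    next
      case False
      then show ?thesis using W0 A_bd_ge_1[OF B(1)] by (simp add: sys_rhs_def)
    qed
    have "\<bar>sys_weight \<alpha> b j p\<bar> \<le> 2 * (norm (sys_rhs \<alpha> b j 1) + norm (sys_rhs \<alpha> b j 2)
        + norm (sys_rhs \<alpha> b j 3) + \<bar>Re (sys_rhs \<alpha> b j 4)\<bar>)"
      unfolding sys_weight_eq[OF False[unfolded neq0_conv]]
      by (rule abs_moment_weight_le[OF less.prems(2)])
    also have "\<dots> \<le> 8 * (5040 * (7 * (9 * (A_bd B * ?W))))"
    proof -
      have "2 * (x1 + x2 + x3 + y) \<le> 8 * X" if "x1 \<le> X" "x2 \<le> X" "x3 \<le> X" "x4 \<le> X" "y \<le> x4"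
        for x1 x2 x3 x4 y X :: real
        using that unfolding distrib_left by linarith
      from this[OF s s s s abs_Re_le_cmod] show ?thesis .
    qed
    also have "\<dots> = 20 * ?Q ^ Suc (j - 1)" by simp
    finally show ?thesis using False by simp
  qed
qed

lemma abs_sys_weight_le_sys_bd:
  assumes B: "1 \<le> B" "\<And>i j. 1 \<le> i + j \<Longrightarrow> i + j \<le> 7 \<Longrightarrow> norm (cderiv i j \<alpha> b) \<le> B"
    and "j \<le> 7" "p \<in> stencil"
  shows "\<bar>sys_weight \<alpha> b j p\<bar> \<le> sys_bd B"
  using abs_sys_weight_le[OF assms] power_increasing[of j 7 "2540160 * A_bd B"] A_bd_ge_1[OF B(1)] assms(3)
  by (auto simp: sys_bd_def)

text \<open>With the multiplier \<open>1 + D\<close> a level of modulus at least 1 outweighs the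
  next correction: \<open>(1 + D) * 1 - D = 1\<close>. So the sign and the distance 1 from zero
  persist from level to level.\<close>

lemma boost_bounds:
  assumes "\<And>j. j \<le> N \<Longrightarrow> \<bar>d j p\<bar> \<le> D" "0 \<le> D" "j \<le> N"
  shows "1 \<le> d 0 p \<Longrightarrow> 1 \<le> boost (1 + D) d j p"
    and "d 0 p \<le> - 1 \<Longrightarrow> boost (1 + D) d j p \<le> - 1"
    and "\<bar>boost (1 + D) d j p\<bar> \<le> D * (2 * (1 + D)) ^ j"
proof -
  show "1 \<le> boost (1 + D) d j p" if "1 \<le> d 0 p"
    using assms(3)
  proof (induction j)
    case (Suc j)
    then have "(1 + D) * 1 \<le> (1 + D) * boost (1 + D) d j p"
      using assms(2) by (intro mult_left_mono) auto
    moreover have "\<bar>d (Suc j) p\<bar> \<le> D" using assms(1) Suc by blast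
    ultimately show ?case by simp
  qed (use that in simp)
  show "boost (1 + D) d j p \<le> - 1" if "d 0 p \<le> - 1"
    using assms(3)
  proof (induction j)
    case (Suc j)
    then have "(1 + D) * boost (1 + D) d j p \<le> (1 + D) * - 1"
      using assms(2) by (intro mult_left_mono) auto
    moreover have "\<bar>d (Suc j) p\<bar> \<le> D" using assms(1) Suc by blast
    ultimately show ?case by simp
  qed (use that in simp)
  show "\<bar>boost (1 + D) d j p\<bar> \<le> D * (2 * (1 + D)) ^ j"
    using assms(3)
  proof (induction j)
    case 0
    then show ?case using assms(1)[of 0] by simp
  next
    case (Suc j)
    have 1: "1 \<le> (2 * (1 + D)) ^ j" using assms(2) by (intro one_le_power) simp
    have "\<bar>boost (1 + D) d (Suc j) p\<bar> \<le> (1 + D) * \<bar>boost (1 + D) d j p\<bar> + \<bar>d (Suc j) p\<bar>"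
      using assms(2) by (simp add: abs_mult order.trans[OF abs_triangle_ineq])
    also have "\<dots> \<le> (1 + D) * (D * (2 * (1 + D)) ^ j) + (1 + D) * (D * (2 * (1 + D)) ^ j)"
    proof (intro add_mono mult_left_mono)
      have "D * 1 \<le> D * (2 * (1 + D)) ^ j" using 1 assms(2) by (intro mult_left_mono)
      also have "\<dots> \<le> (1 + D) * (D * (2 * (1 + D)) ^ j)"
        using mult_nonneg_nonneg[OF assms(2) order.trans[OF zero_le_one 1]] assms(2)
        by (simp add: distrib_right mult_nonneg_nonneg)
      finally show "\<bar>d (Suc j) p\<bar> \<le> (1 + D) * (D * (2 * (1 + D)) ^ j)"
        using assms(1)[OF Suc.prems] by simp
    qed (use Suc assms(2) in auto)
    also have "\<dots> = D * (2 * (1 + D)) ^ Suc j" by (simp add: algebra_simps)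
    finally show ?case .
  qed
qed

definition coeff_bd :: "real \<Rightarrow> real" where
  "coeff_bd B = sys_bd B * (2 * (1 + sys_bd B)) ^ 7"

lemma sys_bd_ge_1: "1 \<le> B \<Longrightarrow> 1 \<le> sys_bd B"
  using one_le_power[of "2540160 * A_bd B" 7] A_bd_ge_1[of B] by (simp add: sys_bd_def)

lemma exists_full_system_solution:
  assumes B: "1 \<le> B" "\<And>i j. 1 \<le> i + j \<Longrightarrow> i + j \<le> 7 \<Longrightarrow> norm (cderiv i j \<alpha> b) \<le> B"
    and cnj: "\<And>i j. i + j \<le> 2 \<Longrightarrow> cnj (cderiv i j \<alpha> b) = cderiv j i \<alpha> b"
  obtains c where "full_system \<alpha> b 6 c"
    and "\<And>p j. p \<in> stencil \<Longrightarrow> j \<le> 7 \<Longrightarrow> \<bar>c p j\<bar> \<le> coeff_bd B"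
    and "\<And>j. j \<le> 7 \<Longrightarrow> c (0, 0) j > 0"
    and "\<And>p j. p \<in> stencil - {(0, 0)} \<Longrightarrow> j \<le> 7 \<Longrightarrow> c p j < 0"
    and "\<And>j. j \<le> 7 \<Longrightarrow> (\<Sum>p\<in>stencil. c p j) = 0"
proof -
  let ?D = "sys_bd B"
  define c where "c p j = boost (1 + ?D) (sys_weight \<alpha> b) j p" for p j
  have D: "\<And>j p. j \<le> 7 \<Longrightarrow> p \<in> stencil \<Longrightarrow> \<bar>sys_weight \<alpha> b j p\<bar> \<le> ?D"
    by (rule abs_sys_weight_le_sys_bd[OF B])
  have D1: "1 \<le> ?D" by (rule sys_bd_ge_1[OF B(1)])
  have sys: "full_system \<alpha> b 6 c"
    unfolding full_system_iff c_def
    using convolution_boost[OF convolution_sys_weight[OF cnj]] by blast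
  \<comment> \<open>In the equation with \<open>m = 0\<close> all earlier levels drop out, which
    leaves the sum over the stencil.\<close>
  have sum: "(\<Sum>p\<in>stencil. c p j) = 0" if "j \<le> 7" for j
  proof -
    have "A_sum \<alpha> b 0 (j - k) (\<lambda>p. c p k) = 0" if "k < j" for k
      using that by (intro A_sum_0_left) auto
    then have "A_sum \<alpha> b 0 0 (\<lambda>p. c p j) = (\<Sum>k\<le>j. A_sum \<alpha> b 0 (j - k) (\<lambda>p. c p k))"
      by (simp add: lessThan_Suc_atMost[symmetric])
    also have "\<dots> = 0" using sys that unfolding full_system_iff by simp
    finally have "of_real (\<Sum>p\<in>stencil. c p j) = (0::complex)"
      by (simp add: A_sum_0 moment_def)
    then show ?thesis by (simp only: of_real_eq_0_iff)
  qed
  show ?thesis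
  proof (rule that[of c])
    fix p :: plane and j :: nat assume p: "p \<in> stencil" and j: "j \<le> 7"
    have "\<bar>c p j\<bar> \<le> ?D * (2 * (1 + ?D)) ^ j"
      unfolding c_def using boost_bounds(3)[of 7 "sys_weight \<alpha> b" p ?D j] D p j D1 by auto
    also have "\<dots> \<le> coeff_bd B"
      unfolding coeff_bd_def using D1 j by (intro mult_left_mono power_increasing) auto
    finally show "\<bar>c p j\<bar> \<le> coeff_bd B" .
  next
    fix j :: nat assume "j \<le> 7"
    then show "c (0, 0) j > 0"
      unfolding c_def using boost_bounds(1)[of 7 "sys_weight \<alpha> b" "(0, 0)" ?D j] D D1
      by (simp add: sys_weight_0 base_weight_def stencil_eq)
  next
    fix p :: plane and j :: nat assume "p \<in> stencil - {(0, 0)}" "j \<le> 7"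
    moreover from this have "sys_weight \<alpha> b 0 p \<le> - 1" by (simp add: sys_weight_0 base_weight_def)
    ultimately have "c p j \<le> - 1"
      unfolding c_def using D D1 by (intro boost_bounds(2)[of 7]) auto
    then show "c p j < 0" by simp
  qed (fact sys, use sum in auto)
qed

section \<open>Taylor expansion and consistency\<close>

text \<open>In place of a Vandermonde determinant: \<open>Q\<close> has degree at most 8 and
  vanishes at the other eight points, so combining the moments with its coefficients isolates the
  weight at \<open>p\<close>.\<close>

lemma moments_vanish_imp_zero:
  assumes "\<And>m. m \<le> 8 \<Longrightarrow> moment m 0 w = 0" "p \<in> stencil"
  shows "w p = 0"
proof -
  define z where "z = (\<lambda>p::plane. Complex (fst p) (snd p))"
  have inj: "z p = z q \<longleftrightarrow> p = q" for p q by (auto simp: z_def prod_eq_iff)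
  define Q where "Q = (\<Prod>q\<in>stencil - {p}. [:- z q, 1:])"
  have "degree Q \<le> (\<Sum>q\<in>stencil - {p}. 1)"
    unfolding Q_def by (rule order.trans[OF degree_prod_sum_le]) (simp_all add: finite_stencil o_def)
  also have "\<dots> = 8" using assms(2) by (simp add: card_stencil finite_stencil)
  finally have deg: "degree Q \<le> 8" .
  have "0 = (\<Sum>i\<le>degree Q. coeff Q i * moment i 0 w)"
    using deg by (intro sum.neutral[symmetric]) (auto simp: assms(1))
  also have "\<dots> = (\<Sum>i\<le>degree Q. \<Sum>q\<in>stencil. coeff Q i * z q ^ i * of_real (w q))"
    by (simp add: moment_def sum_distrib_left z_def mult_ac)
  also have "\<dots> = (\<Sum>q\<in>stencil. poly Q (z q) * of_real (w q))"
    by (subst sum.swap) (simp add: poly_altdef sum_distrib_right)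
  also have "\<dots> = (\<Sum>q\<in>stencil. if q = p then poly Q (z p) * of_real (w p) else 0)"
    using finite_stencil by (intro sum.cong) (auto simp: Q_def poly_prod)
  also have "\<dots> = poly Q (z p) * of_real (w p)"
    using assms(2) finite_stencil by simp
  finally have "poly Q (z p) * of_real (w p) = 0" by simp
  moreover have "poly Q (z p) \<noteq> 0"
    using finite_stencil inj by (auto simp: Q_def poly_prod)
  ultimately show ?thesis by simp
qed

text \<open>At level zero the polynomials are \<open>z ^ m / fact m\<close> for every
  \<open>\<alpha>\<close>, so solvability is a question about the nine points alone.\<close>

lemma system_part_0_iff:
  "system_part \<alpha> b M 0 c \<longleftrightarrow> (\<forall>m \<le> M + 1. moment m 0 (\<lambda>p. c p 0) = 0)"
proof -
  have "(\<Sum>p\<in>stencil. A_poly \<alpha> b m m 0 p * of_real (c p 0)) = moment m 0 (\<lambda>p. c p 0) / fact m" for m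
    using A_sum_0[of \<alpha> b m "\<lambda>p. c p 0"] by (simp add: A_sum_def)
  then show ?thesis by (simp add: system_part_def)
qed

lemma system_part_0_solvable_iff:
  "(\<exists>c. system_part \<alpha> b M 0 c \<and> (\<exists>p\<in>stencil. c p 0 \<noteq> 0)) \<longleftrightarrow> M \<le> 6"
proof
  assume "\<exists>c. system_part \<alpha> b M 0 c \<and> (\<exists>p\<in>stencil. c p 0 \<noteq> 0)"
  then obtain c p where sys: "system_part \<alpha> b M 0 c" and p: "p \<in> stencil" "c p 0 \<noteq> 0"
    by blast
  have c: "\<forall>m \<le> M + 1. moment m 0 (\<lambda>p. c p 0) = 0"
    using sys by (simp only: system_part_0_iff)
  show "M \<le> 6"
  proof (rule ccontr)
    assume "\<not> M \<le> 6"
    then have "c p 0 = 0" using moments_vanish_imp_zero[of "\<lambda>p. c p 0" p] c p(1) by simp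
    with p show False by simp
  qed
next
  assume M: "M \<le> 6"
  have "system_part \<alpha> b M 0 (\<lambda>p _. base_weight p)"
    using M by (simp add: system_part_0_iff moment_base_weight)
  moreover have "(0, 0) \<in> stencil" "base_weight (0, 0) \<noteq> 0"
    by (simp_all add: stencil_eq base_weight_def)
  ultimately show "\<exists>c. system_part \<alpha> b M 0 c \<and> (\<exists>p\<in>stencil. c p 0 \<noteq> 0)" by blast
qed

lemma A_poly_atMost:
  "A_poly \<alpha> b q m n p = (\<Sum>k\<le>q. N_mono k (q - k) p * A_coeff \<alpha> b m n k (q - k))"
  unfolding A_poly_def
proof (rule sum.mono_neutral_left)
  show "\<forall>k\<in>{..q} - {j. m \<le> j \<and> j + n \<le> q}. N_mono k (q - k) p * A_coeff \<alpha> b m n k (q - k) = 0"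
  proof
    fix k assume "k \<in> {..q} - {j. m \<le> j \<and> j + n \<le> q}"
    then have "\<not> (m \<le> k \<and> n \<le> q - k)" by auto
    from A_coeff_eq_0[OF this] show "N_mono k (q - k) p * A_coeff \<alpha> b m n k (q - k) = 0" by simp
  qed
qed auto

lemma cnj_A_poly:
  assumes "\<And>i j. i + j \<le> N \<Longrightarrow> cnj (cderiv i j \<alpha> b) = cderiv j i \<alpha> b" "q \<le> N"
  shows "cnj (A_poly \<alpha> b q m n p) = A_poly \<alpha> b q n m p"
proof -
  have N: "cnj (N_mono k l p) = N_mono l k p" for k l
  proof -
    have "cnj (Complex (fst p) (snd p)) = Complex (fst p) (- snd p)"
      "cnj (Complex (fst p) (- snd p)) = Complex (fst p) (snd p)" by (simp_all add: complex_eq_iff)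
    then show ?thesis by (simp add: N_mono_def mult.commute)
  qed
  have "cnj (A_poly \<alpha> b q m n p) = (\<Sum>k\<le>q. N_mono (q - k) k p * A_coeff \<alpha> b n m (q - k) k)"
    unfolding A_poly_atMost cnj_sum
    using assms(2) by (intro sum.cong refl) (simp add: N cnj_A_coeff[of N] assms(1))
  also have "\<dots> = A_poly \<alpha> b q n m p"
    unfolding A_poly_atMost
    by (rule sum.reindex_bij_witness[of _ "\<lambda>k. q - k" "\<lambda>k. q - k"]) auto
  finally show ?thesis .
qed

lemma A_poly_eq_0: "q < m + n \<Longrightarrow> A_poly \<alpha> b q m n p = 0"
  unfolding A_poly_def by (rule sum.neutral) auto

lemma A_poly_0_0: "A_poly \<alpha> b q 0 0 p = (if q = 0 then 1 else 0)"
proof (cases "q = 0")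
  case False
  have "A_coeff \<alpha> b 0 0 k (q - k) = 0" if "k \<le> q" for k
    by (rule A_coeff_0_0) (use False that in auto)
  then show ?thesis using False by (auto simp: A_poly_atMost intro!: sum.neutral)
qed (simp add: A_poly_atMost N_mono_def A_coeff_axis)

section \<open>Taylor expansion in Wirtinger derivatives\<close>

context open_plane
begin

text \<open>The chain rule along a line needs the total derivative, which is obtained from the
  partial derivatives by continuity of one of them on a product neighbourhood.\<close>

lemma has_vector_derivative_line:
  assumes "Ck (Suc n) f" "z + t *\<^sub>R p \<in> \<Omega>"
  shows "((\<lambda>t. f (z + t *\<^sub>R p)) has_vector_derivative
    ddir (of_real (fst p)) (of_real (snd p)) f (z + t *\<^sub>R p)) (at t)"
proof -
  obtain x y where xy: "z + t *\<^sub>R p = (x, y)" by (cases "z + t *\<^sub>R p")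
  obtain A B where AB: "open A" "open B" "(x, y) \<in> A \<times> B" "A \<times> B \<subseteq> \<Omega>"
    using open_prod_elim[OF open_dom assms(2)] xy by metis
  \<comment> \<open>The criterion for partial derivatives asks for a convex second factor, hence the
    ball.\<close>
  then obtain e where e: "0 < e" "ball y e \<subseteq> B" by (auto elim: openE)
  let ?Y = "ball y e"
  have sub: "A \<times> ?Y \<subseteq> \<Omega>" using AB e by blast
  have cont: "continuous_on (A \<times> ?Y) (partial_y f)"
    using assms(1) sub by (auto intro: Ck_continuous[THEN continuous_on_subset])
  have cont': "continuous_on (A \<times> ?Y) (\<lambda>(x, y). blinfun_scaleR_left (partial_y f (x, y)))"
    using cont by (auto simp: split_beta intro!: continuous_intros)
  have "((\<lambda>(x, y). f (x, y)) has_derivative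
      (\<lambda>(tx, ty). tx *\<^sub>R partial_x f (x, y) + blinfun_scaleR_left (partial_y f (x, y)) ty))
      (at (x, y) within A \<times> ?Y)"
  proof (rule has_derivative_partialsI)
    show "((\<lambda>x. f (x, y)) has_derivative (\<lambda>tx. tx *\<^sub>R partial_x f (x, y))) (at x within A)"
      using Ck_px[OF assms(1), of "(x, y)"] assms(2) xy
      by (auto simp: has_vector_derivative_def intro: has_derivative_at_withinI)
    show "((\<lambda>y. f (x, y)) has_derivative blinfun_apply (blinfun_scaleR_left (partial_y f (x, y))))
        (at y within ?Y)" if "x \<in> A" "y \<in> ?Y" for x y
    proof -
      have "(x, y) \<in> \<Omega>" using that sub by auto
      from Ck_py[OF assms(1) this] show ?thesis
        by (simp add: has_vector_derivative_def blinfun_scaleR_left.rep_eq has_derivative_at_withinI)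
    qed
    show "continuous (at (x, y) within A \<times> ?Y) (\<lambda>(x, y). blinfun_scaleR_left (partial_y f (x, y)))"
      by (rule cont'[unfolded continuous_on_eq_continuous_within, rule_format]) (use AB e in auto)
  qed (use e in auto)
  moreover have "at (x, y) within A \<times> ?Y = at (x, y)"
    using AB e by (intro at_within_open) (auto intro: open_Times)
  ultimately have f: "(f has_derivative (\<lambda>q. fst q *\<^sub>R partial_x f (x, y) + snd q *\<^sub>R partial_y f (x, y)))
      (at (z + t *\<^sub>R p))"
    by (simp add: case_prod_unfold xy blinfun_scaleR_left.rep_eq)
  have "((\<lambda>t. z + t *\<^sub>R p) has_derivative (\<lambda>s. s *\<^sub>R p)) (at t)"
    by (auto intro!: derivative_eq_intros)
  from has_derivative_compose[OF this f] show ?thesis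
    by (simp add: has_vector_derivative_def ddir_def xy scaleR_conv_of_real algebra_simps)
qed

lemma ddir_funpow_eq_wirt:
  assumes "Ck n f" "z \<in> \<Omega>"
  shows "(ddir (of_real (fst p)) (of_real (snd p)) ^^ n) f z
    = fact n * (\<Sum>k\<le>n. N_mono k (n - k) p * wirt k (n - k) f z)"
proof -
  \<comment> \<open>The halves compensate that \<open>ddir 1 (- \<i>)\<close> and
    \<open>ddir 1 \<i>\<close> are twice the Wirtinger operators.\<close>
  let ?s = "Complex (fst p) (snd p) / 2" and ?t = "Complex (fst p) (- snd p) / 2"
  have c: "complex_of_real (fst p) = ?s * 1 + ?t * 1"
    "complex_of_real (snd p) = ?s * (- \<i>) + ?t * \<i>"
    by (simp_all add: complex_eq_iff)
  have "(ddir (of_real (fst p)) (of_real (snd p)) ^^ n) f z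
    = (\<Sum>k\<le>n. of_nat (n choose k) * (?s ^ k * ?t ^ (n - k)
        * (ddir 1 (- \<i>) ^^ k) ((ddir 1 \<i> ^^ (n - k)) f) z))"
    unfolding c by (rule ddir_lincomb_funpow[OF assms])
  also have "\<dots> = (\<Sum>k\<le>n. fact n * (N_mono k (n - k) p * wirt k (n - k) f z))"
  proof (intro sum.cong refl)
    fix k assume "k \<in> {..n}"
    then obtain l where l: "n = k + l" by (auto simp: le_iff_add)
    show "of_nat (n choose k) * (?s ^ k * ?t ^ (n - k) * (ddir 1 (- \<i>) ^^ k) ((ddir 1 \<i> ^^ (n - k)) f) z)
        = fact n * (N_mono k (n - k) p * wirt k (n - k) f z)"
      unfolding l by (simp add: N_mono_def wirt_def binomial_fact power_divide power_add)
  qed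
  finally show ?thesis by (simp add: sum_distrib_left)
qed

text \<open>One-variable Taylor formula with integral remainder on the segment towards
  \<open>p\<close>. The top derivative has \<open>n + 2\<close> Wirtinger terms, each at most
  \<open>2 ^ Suc n * B\<close>, and \<open>fact (Suc n) / fact n\<close> leaves
  \<open>n + 1\<close>.\<close>

lemma taylor_wirt:
  assumes f: "Ck (Suc n) f" and h: "0 < h" and p: "p \<in> stencil"
    and line: "\<And>t. 0 \<le> t \<Longrightarrow> t \<le> h \<Longrightarrow> z + t *\<^sub>R p \<in> \<Omega>"
    and B: "\<And>k l w. k + l = Suc n \<Longrightarrow> w \<in> \<Omega> \<Longrightarrow> norm (wirt k l f w) \<le> B"
  shows "norm (f (z + h *\<^sub>R p) - (\<Sum>q\<le>n. h ^ q *\<^sub>R (\<Sum>k\<le>q. N_mono k (q - k) p * wirt k (q - k) f z)))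
    \<le> real (n + 2) * real (n + 1) * 2 ^ Suc n * B * h ^ Suc n"
proof -
  let ?D = "ddir (of_real (fst p)) (of_real (snd p))"
  define Df where "Df i t = (?D ^^ i) f (z + t *\<^sub>R p)" for i t
  have 1: "(Df m has_vector_derivative Df (Suc m) t) (at t within {0..h})"
    if "m < Suc n" "0 \<le> t" "t \<le> h" for m t
  proof -
    have "Ck (Suc 0) ((?D ^^ m) f)" by (rule Ck_ddir_funpow_le[OF f]) (use that in simp)
    from has_vector_derivative_line[OF this line[OF that(2,3)]] show ?thesis
      unfolding Df_def by (auto intro: has_vector_derivative_at_within)
  qed
  let ?i = "\<lambda>x. ((h - x) ^ (Suc n - 1) / fact (Suc n - 1)) *\<^sub>R Df (Suc n) x"
  have int: "(?i has_integral f (z + h *\<^sub>R p) - (\<Sum>q<Suc n. ((h - 0) ^ q / fact q) *\<^sub>R Df q 0)) {0..h}"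
    by (rule Taylor_has_integral[of "Suc n" Df "\<lambda>t. f (z + t *\<^sub>R p)"])
       (use 1 h in \<open>auto simp: Df_def\<close>)
  have z: "z \<in> \<Omega>" using line[of 0] h by simp
  then have "norm (wirt (Suc n) 0 f z) \<le> B" by (intro B) auto
  then have B0: "0 \<le> B" by (rule order.trans[OF norm_ge_zero])
  have 2: "norm (?i x) \<le> h ^ n / fact n * (fact (Suc n) * (real (n + 2) * (2 ^ Suc n * B)))"
    if x: "x \<in> {0..h}" for x
  proof -
    have xO: "z + x *\<^sub>R p \<in> \<Omega>" using x line by auto
    have "norm (\<Sum>k\<le>Suc n. N_mono k (Suc n - k) p * wirt k (Suc n - k) f (z + x *\<^sub>R p))
      \<le> (\<Sum>k\<le>Suc n. 2 ^ Suc n * B)"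
    proof (rule order.trans[OF norm_sum sum_mono])
      fix k assume k: "k \<in> {..Suc n}"
      then show "norm (N_mono k (Suc n - k) p * wirt k (Suc n - k) f (z + x *\<^sub>R p)) \<le> 2 ^ Suc n * B"
        unfolding norm_mult using norm_N_mono_le[OF p, of k "Suc n - k"] B[of k "Suc n - k", OF _ xO]
        by (intro mult_mono) auto
    qed
    then have "norm (Df (Suc n) x) \<le> fact (Suc n) * (real (n + 2) * (2 ^ Suc n * B))"
      unfolding Df_def ddir_funpow_eq_wirt[OF f xO] norm_mult norm_fact
      by (intro mult_left_mono) (simp_all add: add.commute)
    then show ?thesis
      unfolding norm_scaleR using x by (intro mult_mono) (auto intro!: divide_right_mono power_mono)
  qed
  have "norm (f (z + h *\<^sub>R p) - (\<Sum>q<Suc n. ((h - 0) ^ q / fact q) *\<^sub>R Df q 0))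
    \<le> h ^ n / fact n * (fact (Suc n) * (real (n + 2) * (2 ^ Suc n * B))) * measure lborel (cbox 0 h)"
    by (rule has_integral_bound[where f = ?i]) (use int 2 h B0 in auto)
  also have "\<dots> = real (n + 2) * real (n + 1) * 2 ^ Suc n * B * h ^ Suc n"
    using h by (simp add: field_simps)
  also have "(\<Sum>q<Suc n. ((h - 0) ^ q / fact q) *\<^sub>R Df q 0)
    = (\<Sum>q\<le>n. h ^ q *\<^sub>R (\<Sum>k\<le>q. N_mono k (q - k) p * wirt k (q - k) f z))"
    unfolding lessThan_Suc_atMost
  proof (intro sum.cong refl)
    fix q assume "q \<in> {..n}"
    then have "Ck q f" using f by (auto intro: Ck_mono simp del: Ck.simps)
    then show "((h - 0) ^ q / fact q) *\<^sub>R Df q 0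
      = h ^ q *\<^sub>R (\<Sum>k\<le>q. N_mono k (q - k) p * wirt k (q - k) f z)"
      using ddir_funpow_eq_wirt[of q f z p] z by (simp add: Df_def scaleR_conv_of_real)
  qed
  finally show ?thesis .
qed

text \<open>\<open>deriv_bound\<close> speaks of iterated derivatives of real functions, while the
  calculus above is complex; this passes the embedding through the iteration.\<close>

lemma Ck_partial_x_funpow_of_real:
  assumes "Ck (n + i) (\<lambda>z. of_real (v z))"
  shows "Ck n (\<lambda>z. of_real ((partial_x ^^ i) v z))"
    and "z \<in> \<Omega> \<Longrightarrow> (partial_x ^^ i) (\<lambda>z. complex_of_real (v z)) z = of_real ((partial_x ^^ i) v z)"
proof -
  have "Ck n (\<lambda>z. of_real ((partial_x ^^ i) v z)) \<and>
    (\<forall>z\<in>\<Omega>. (partial_x ^^ i) (\<lambda>z. complex_of_real (v z)) z = of_real ((partial_x ^^ i) v z))"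
    using assms
  proof (induction i arbitrary: n)
    case (Suc i)
    then have IH: "Ck (Suc n) (\<lambda>z. of_real ((partial_x ^^ i) v z))"
      "\<And>z. z \<in> \<Omega> \<Longrightarrow> (partial_x ^^ i) (\<lambda>z. complex_of_real (v z)) z = of_real ((partial_x ^^ i) v z)"
      using Suc.IH[of "Suc n"] by (auto simp del: Ck.simps)
    show ?case
      using Ck_partial_of_real(1)[OF IH(1)] Ck_of_real_partial(3)[OF IH(1)] partial_x_cong[OF IH(2)]
      by simp
  qed simp
  then show "Ck n (\<lambda>z. of_real ((partial_x ^^ i) v z))"
    and "z \<in> \<Omega> \<Longrightarrow> (partial_x ^^ i) (\<lambda>z. complex_of_real (v z)) z = of_real ((partial_x ^^ i) v z)"
    by auto
qed

lemma Ck_partial_y_funpow_of_real: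
  assumes "Ck (n + i) (\<lambda>z. of_real (v z))"
  shows "Ck n (\<lambda>z. of_real ((partial_y ^^ i) v z))"
    and "z \<in> \<Omega> \<Longrightarrow> (partial_y ^^ i) (\<lambda>z. complex_of_real (v z)) z = of_real ((partial_y ^^ i) v z)"
proof -
  have "Ck n (\<lambda>z. of_real ((partial_y ^^ i) v z)) \<and>
    (\<forall>z\<in>\<Omega>. (partial_y ^^ i) (\<lambda>z. complex_of_real (v z)) z = of_real ((partial_y ^^ i) v z))"
    using assms
  proof (induction i arbitrary: n)
    case (Suc i)
    then have IH: "Ck (Suc n) (\<lambda>z. of_real ((partial_y ^^ i) v z))"
      "\<And>z. z \<in> \<Omega> \<Longrightarrow> (partial_y ^^ i) (\<lambda>z. complex_of_real (v z)) z = of_real ((partial_y ^^ i) v z)"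
      using Suc.IH[of "Suc n"] by (auto simp del: Ck.simps)
    show ?case
      using Ck_partial_of_real(2)[OF IH(1)] Ck_of_real_partial(4)[OF IH(1)] partial_y_cong[OF IH(2)]
      by simp
  qed simp
  then show "Ck n (\<lambda>z. of_real ((partial_y ^^ i) v z))"
    and "z \<in> \<Omega> \<Longrightarrow> (partial_y ^^ i) (\<lambda>z. complex_of_real (v z)) z = of_real ((partial_y ^^ i) v z)"
    by auto
qed

lemma norm_wirt_le_deriv_bound:
  assumes v: "Ck N (\<lambda>z. of_real (v z))" and B: "deriv_bound N \<Omega> v B"
    and kl: "1 \<le> k + l" "k + l \<le> N" and z: "z \<in> \<Omega>"
  shows "norm (wirt k l (\<lambda>z. of_real (v z)) z) \<le> B"
proof (rule wirt_bound)
  fix i j z assume ij: "i + j = k + l" and z: "z \<in> \<Omega>"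
  have j: "Ck i (\<lambda>z. of_real ((partial_y ^^ j) v z))"
    "\<And>w. w \<in> \<Omega> \<Longrightarrow> (partial_y ^^ j) (\<lambda>z. complex_of_real (v z)) w = of_real ((partial_y ^^ j) v w)"
    using Ck_partial_y_funpow_of_real[of i j v] Ck_mono[OF v, of "i + j"] ij kl by auto
  have "(partial_x ^^ i) ((partial_y ^^ j) (\<lambda>z. complex_of_real (v z))) z
    = (partial_x ^^ i) (\<lambda>z. complex_of_real ((partial_y ^^ j) v z)) z"
    using ddir_funpow_cong[OF j(2) z, where c = 1 and e = 0 and k = i] by (simp add: ddir_1_0)
  also have "\<dots> = of_real ((partial_x ^^ i) ((partial_y ^^ j) v) z)"
    using Ck_partial_x_funpow_of_real(2)[of 0 i] j(1) z by simp
  finally show "norm ((partial_x ^^ i) ((partial_y ^^ j) (\<lambda>z. complex_of_real (v z))) z) \<le> B"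
    using B ij kl z by (simp add: deriv_bound_def)
qed (use assms Ck_mono in auto)

end

text \<open>The factor of the Wirtinger derivative \<open>(m, n)\<close> of \<open>u\<close> at the
  base point after the expansion of the whole scheme.\<close>

definition axis_coeff :: "(plane \<Rightarrow> real) \<Rightarrow> plane \<Rightarrow> (plane \<Rightarrow> nat \<Rightarrow> real) \<Rightarrow> real \<Rightarrow> nat \<Rightarrow> nat \<Rightarrow> complex" where
  "axis_coeff \<alpha> b c h m n =
    (\<Sum>p\<in>stencil. of_real (scheme_coeff 6 c p h) * (\<Sum>q\<le>7. of_real h ^ q * A_poly \<alpha> b q m n p))"

lemma scheme_coeff_6: "scheme_coeff 6 c p h = (\<Sum>j\<le>7. c p j * h ^ j)"
  by (simp add: scheme_coeff_def)

text \<open>An exact zero is required, because no bound for the values of \<open>u\<close> is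
  available.\<close>

lemma axis_coeff_0_0:
  assumes "\<And>j. j \<le> 7 \<Longrightarrow> (\<Sum>p\<in>stencil. c p j) = 0"
  shows "axis_coeff \<alpha> b c h 0 0 = 0"
proof -
  have "(\<Sum>q\<le>7. of_real h ^ q * A_poly \<alpha> b q 0 0 p) = 1" for p
    by (simp add: A_poly_0_0 if_distrib cong: if_cong)
  then have "axis_coeff \<alpha> b c h 0 0 = of_real (\<Sum>p\<in>stencil. scheme_coeff 6 c p h)"
    by (simp add: axis_coeff_def)
  also have "(\<Sum>p\<in>stencil. scheme_coeff 6 c p h) = (\<Sum>j\<le>7. h ^ j * (\<Sum>p\<in>stencil. c p j))"
    unfolding scheme_coeff_6 sum_distrib_left by (subst sum.swap) (simp add: mult.commute)
  finally show ?thesis using assms by simp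
qed

lemma cnj_axis_coeff:
  assumes "\<And>i j. i + j \<le> 7 \<Longrightarrow> cnj (cderiv i j \<alpha> b) = cderiv j i \<alpha> b"
  shows "cnj (axis_coeff \<alpha> b c h m n) = axis_coeff \<alpha> b c h n m"
  unfolding axis_coeff_def cnj_sum complex_cnj_mult complex_cnj_power complex_cnj_complex_of_real
  by (intro sum.cong refl arg_cong2[where f = "(*)"] cnj_A_poly[of 7]) (use assms in auto)

text \<open>Sorted by the total power \<open>j + q\<close> of \<open>h\<close>, the terms up to
  order 7 cancel by the system. The remaining orders are 8 to 14, so at most six powers of
  \<open>h\<close> are left over beside \<open>h ^ 8\<close>.\<close>

lemma norm_axis_coeff_le:
  assumes B: "1 \<le> B" "\<And>i j. 1 \<le> i + j \<Longrightarrow> i + j \<le> 7 \<Longrightarrow> norm (cderiv i j \<alpha> b) \<le> B"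
    and sys: "full_system \<alpha> b 6 c"
    and C: "\<And>p j. p \<in> stencil \<Longrightarrow> j \<le> 7 \<Longrightarrow> \<bar>c p j\<bar> \<le> C"
    and h: "0 < h" "h \<le> H"
  shows "norm (axis_coeff \<alpha> b c h m 0) \<le> 64 * ((1 + \<bar>H\<bar>) ^ 6 * (9 * (A_bd B * C))) * h ^ 8"
proof -
  define T where "T j q = (\<Sum>p\<in>stencil. A_poly \<alpha> b q m 0 p * of_real (c p j))" for j q
  let ?x = "\<lambda>(j, q). of_real h ^ (j + q) * T j q"
  let ?S = "{..7::nat} \<times> {..7::nat}" and ?L = "{(j, q). j + q \<le> (7::nat)}"
  have C0: "0 \<le> C" using C[of "(0, 0)" 0] by (simp add: stencil_eq)
  have "axis_coeff \<alpha> b c h m 0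
    = (\<Sum>p\<in>stencil. \<Sum>j\<le>7. \<Sum>q\<le>7. of_real h ^ (j + q) * (A_poly \<alpha> b q m 0 p * of_real (c p j)))"
    by (simp add: axis_coeff_def scheme_coeff_6 sum_product power_add mult_ac)
  also have "\<dots> = (\<Sum>j\<le>7. \<Sum>q\<le>7. of_real h ^ (j + q) * T j q)"
    unfolding T_def sum_distrib_left
    by (subst sum.swap, intro sum.cong refl, rule sum.swap)
  also have "\<dots> = (\<Sum>x\<in>?S. ?x x)"
    by (rule sum.cartesian_product)
  also have "\<dots> = (\<Sum>x\<in>?S - ?L. ?x x) + (\<Sum>x\<in>?L. ?x x)"
    by (rule sum.subset_diff) auto
  also have "(\<Sum>x\<in>?L. ?x x) = (\<Sum>t\<le>7. \<Sum>j\<le>t. of_real h ^ (j + (t - j)) * T j (t - j))"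
    by (rule sum.triangle_reindex_eq)
  also have "\<dots> = 0"
  proof (rule sum.neutral, rule ballI)
    fix t :: nat assume t: "t \<in> {..7}"
    have T0: "T j q = 0" if "q < m" for j q
      using that by (simp add: T_def A_poly_eq_0)
    have "(\<Sum>j\<le>t. of_real h ^ (j + (t - j)) * T j (t - j)) = of_real h ^ t * (\<Sum>j\<le>t. T j (t - j))"
      by (simp add: sum_distrib_left)
    also have "(\<Sum>j\<le>t. T j (t - j)) = 0"
    proof (cases "t < m")
      case True
      then show ?thesis by (intro sum.neutral) (auto intro: T0)
    next
      case False
      then obtain J where J: "t = m + J" by (auto simp: not_less le_iff_add)
      \<comment> \<open>Terms with \<open>t - j < m\<close> vanish, which leaves exactly the
        convolution of length \<open>J = t - m\<close>.\<close>
      have "(\<Sum>j\<le>t. T j (t - j)) = (\<Sum>j\<le>J. T j (t - j))"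
        by (rule sum.mono_neutral_right) (auto simp: J intro!: T0)
      also have "\<dots> = (\<Sum>j\<le>J. A_sum \<alpha> b m (J - j) (\<lambda>p. c p j))"
        by (intro sum.cong refl) (simp add: T_def A_sum_def J)
      also have "\<dots> = 0" using sys t J unfolding full_system_iff by simp
      finally show ?thesis .
    qed
    finally show "(\<Sum>j\<le>t. of_real h ^ (j + (t - j)) * T j (t - j)) = 0" by simp
  qed
  finally have eq: "axis_coeff \<alpha> b c h m 0 = (\<Sum>x\<in>?S - ?L. ?x x)" by simp
  have "norm (\<Sum>x\<in>?S - ?L. ?x x) \<le> (\<Sum>x\<in>?S - ?L. h ^ 8 * ((1 + \<bar>H\<bar>) ^ 6 * (9 * (A_bd B * C))))"
  proof (rule order.trans[OF norm_sum sum_mono])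
    fix x assume "x \<in> ?S - ?L"
    then obtain j q where x: "x = (j, q)" "j \<le> 7" "q \<le> 7" "7 < j + q" by (cases x) auto
    have "norm (T j q) \<le> (\<Sum>p\<in>stencil. A_bd B * C)"
      unfolding T_def
    proof (rule order.trans[OF norm_sum sum_mono])
      fix p assume "p \<in> stencil"
      then show "norm (A_poly \<alpha> b q m 0 p * of_real (c p j)) \<le> A_bd B * C"
        using norm_A_poly_le[OF B x(3), of p m 0] C[of p j] x(2) A_bd_ge_1[OF B(1)]
        by (auto simp: norm_mult intro!: mult_mono)
    qed
    then have T: "norm (T j q) \<le> 9 * (A_bd B * C)" by (simp add: card_stencil)
    have "h ^ (j + q - 8) \<le> (1 + \<bar>H\<bar>) ^ (j + q - 8)"
      using h by (intro power_mono) auto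
    also have "\<dots> \<le> (1 + \<bar>H\<bar>) ^ 6"
      using x by (intro power_increasing) auto
    finally have "h ^ 8 * h ^ (j + q - 8) \<le> h ^ 8 * (1 + \<bar>H\<bar>) ^ 6"
      using h by (intro mult_left_mono) auto
    moreover have "8 + (j + q - 8) = j + q" using x by simp
    ultimately have "h ^ (j + q) \<le> h ^ 8 * (1 + \<bar>H\<bar>) ^ 6"
      by (metis power_add)
    then have "norm (?x x) \<le> h ^ 8 * (1 + \<bar>H\<bar>) ^ 6 * (9 * (A_bd B * C))"
      using T h x(1) by (auto simp: norm_mult norm_power intro!: mult_mono)
    then show "norm (?x x) \<le> h ^ 8 * ((1 + \<bar>H\<bar>) ^ 6 * (9 * (A_bd B * C)))"
      by (simp only: mult.assoc)
  qed
  also have "\<dots> = real (card (?S - ?L)) * (h ^ 8 * ((1 + \<bar>H\<bar>) ^ 6 * (9 * (A_bd B * C))))"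
    by simp
  also have "\<dots> \<le> 64 * (h ^ 8 * ((1 + \<bar>H\<bar>) ^ 6 * (9 * (A_bd B * C))))"
  proof (rule mult_right_mono)
    have "card (?S - ?L) \<le> card ?S" by (intro card_mono) auto
    then have "card (?S - ?L) \<le> 64" by simp
    then show "real (card (?S - ?L)) \<le> 64" by linarith
  qed (use h C0 A_bd_ge_1[OF B(1)] in auto)
  finally show ?thesis unfolding eq by (simp add: mult_ac)
qed

text \<open>Inserting the reduction to the axes into the Taylor polynomial separates it into the
  source polynomial and one factor for each axis derivative.\<close>

lemma sum_expand_axis_derivatives:
  fixes U :: "nat \<Rightarrow> nat \<Rightarrow> complex"
  assumes U: "\<And>k l. k + l \<le> 7 \<Longrightarrow> U k l =
    (\<Sum>(m, n)\<in>S. A_coeff \<alpha> b m n k l * U m n) + F_coeff \<alpha> \<phi> b k l"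
  shows "(\<Sum>q\<le>7. h ^ q *\<^sub>R (\<Sum>k\<le>q. N_mono k (q - k) p * U k (q - k)))
    = F_poly 6 \<alpha> \<phi> b h p + (\<Sum>(m, n)\<in>S. U m n * (\<Sum>q\<le>7. of_real h ^ q * A_poly \<alpha> b q m n p))"
proof -
  have "h ^ q *\<^sub>R (\<Sum>k\<le>q. N_mono k (q - k) p * U k (q - k))
    = (\<Sum>k\<le>q. N_mono k (q - k) p * F_coeff \<alpha> \<phi> b k (q - k) * of_real h ^ (k + (q - k)))
      + (\<Sum>(m, n)\<in>S. U m n * (of_real h ^ q * A_poly \<alpha> b q m n p))" if q: "q \<le> 7" for q
  proof -
    have "h ^ q *\<^sub>R (\<Sum>k\<le>q. N_mono k (q - k) p * U k (q - k))
      = (\<Sum>k\<le>q. of_real h ^ q * (N_mono k (q - k) p *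
          ((\<Sum>(m, n)\<in>S. A_coeff \<alpha> b m n k (q - k) * U m n) + F_coeff \<alpha> \<phi> b k (q - k))))"
      unfolding scaleR_conv_of_real of_real_power sum_distrib_left
    proof (intro sum.cong refl)
      fix k assume "k \<in> {..q}"
      then have "k + (q - k) \<le> 7" using q by simp
      from U[OF this] show "of_real h ^ q * (N_mono k (q - k) p * U k (q - k))
        = of_real h ^ q * (N_mono k (q - k) p *
          ((\<Sum>(m, n)\<in>S. A_coeff \<alpha> b m n k (q - k) * U m n) + F_coeff \<alpha> \<phi> b k (q - k)))"
        by simp
    qed
    also have "\<dots> = (\<Sum>k\<le>q. N_mono k (q - k) p * F_coeff \<alpha> \<phi> b k (q - k) * of_real h ^ (k + (q - k)))
      + (\<Sum>k\<le>q. \<Sum>(m, n)\<in>S. U m n * (of_real h ^ q * (N_mono k (q - k) p * A_coeff \<alpha> b m n k (q - k))))"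
      by (simp add: sum.distrib[symmetric] sum_distrib_left split_def algebra_simps)
    also have "(\<Sum>k\<le>q. \<Sum>(m, n)\<in>S. U m n * (of_real h ^ q * (N_mono k (q - k) p * A_coeff \<alpha> b m n k (q - k))))
      = (\<Sum>(m, n)\<in>S. U m n * (of_real h ^ q * A_poly \<alpha> b q m n p))"
      by (subst sum.swap) (simp add: A_poly_atMost sum_distrib_left split_def)
    finally show ?thesis .
  qed
  then have "(\<Sum>q\<le>7. h ^ q *\<^sub>R (\<Sum>k\<le>q. N_mono k (q - k) p * U k (q - k)))
    = (\<Sum>q\<le>7. \<Sum>k\<le>q. N_mono k (q - k) p * F_coeff \<alpha> \<phi> b k (q - k) * of_real h ^ (k + (q - k)))
      + (\<Sum>q\<le>7. \<Sum>(m, n)\<in>S. U m n * (of_real h ^ q * A_poly \<alpha> b q m n p))"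
    by (simp add: sum.distrib[symmetric])
  also have "(\<Sum>q\<le>7. \<Sum>k\<le>q. N_mono k (q - k) p * F_coeff \<alpha> \<phi> b k (q - k) * of_real h ^ (k + (q - k)))
    = F_poly 6 \<alpha> \<phi> b h p"
    unfolding F_poly_def
    using sum.triangle_reindex_eq[of "\<lambda>k l. N_mono k l p * F_coeff \<alpha> \<phi> b k l * of_real h ^ (k + l)" 7]
    by simp
  also have "(\<Sum>q\<le>7. \<Sum>(m, n)\<in>S. U m n * (of_real h ^ q * A_poly \<alpha> b q m n p))
    = (\<Sum>(m, n)\<in>S. U m n * (\<Sum>q\<le>7. of_real h ^ q * A_poly \<alpha> b q m n p))"
    by (subst sum.swap) (simp add: sum_distrib_left split_def)
  finally show ?thesis .
qed

text \<open>The first summand collects nine Taylor remainders, where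
  \<open>18432 = 9 * 8 * 2 ^ 8\<close> comes from \<open>taylor_wirt\<close> with
  \<open>n = 7\<close>; the second one at most 64 axis derivatives. The base
  \<open>1 + \<bar>H\<bar>\<close> is at least 1, so its powers increase for every
  \<open>H\<close>.\<close>

definition error_bd :: "real \<Rightarrow> real \<Rightarrow> real \<Rightarrow> real \<Rightarrow> real" where
  "error_bd B C Bu H = 9 * (8 * (C * (1 + \<bar>H\<bar>) ^ 7) * (18432 * Bu))
    + 64 * (Bu * (64 * ((1 + \<bar>H\<bar>) ^ 6 * (9 * (A_bd B * C)))))"

lemma abs_scheme_coeff_le:
  assumes "\<And>j. j \<le> 7 \<Longrightarrow> \<bar>c p j\<bar> \<le> C" "0 < h" "h \<le> H"
  shows "\<bar>scheme_coeff 6 c p h\<bar> \<le> 8 * (C * (1 + \<bar>H\<bar>) ^ 7)"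
proof -
  have "\<bar>scheme_coeff 6 c p h\<bar> \<le> (\<Sum>j\<le>7::nat. C * (1 + \<bar>H\<bar>) ^ 7)"
    unfolding scheme_coeff_6
  proof (rule order.trans[OF sum_abs sum_mono])
    fix j :: nat assume j: "j \<in> {..7}"
    have "h ^ j \<le> (1 + \<bar>H\<bar>) ^ j" using assms by (intro power_mono) auto
    also have "\<dots> \<le> (1 + \<bar>H\<bar>) ^ 7" using j by (intro power_increasing) auto
    finally show "\<bar>c p j * h ^ j\<bar> \<le> C * (1 + \<bar>H\<bar>) ^ 7"
      unfolding abs_mult using assms j by (intro mult_mono) (auto intro: order.trans[OF abs_ge_zero assms(1)])
  qed
  then show ?thesis by simp
qed

section \<open>Consistency error of the scheme\<close>

context open_plane
begin

lemma cderiv_bound_and_cnj: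
  assumes "Ck 7 (\<lambda>z. of_real (\<alpha> z))" "z \<in> \<Omega>"
  shows "deriv_bound 7 \<Omega> \<alpha> B \<Longrightarrow> 1 \<le> i + j \<Longrightarrow> i + j \<le> 7 \<Longrightarrow> norm (cderiv i j \<alpha> z) \<le> B"
    and "i + j \<le> 7 \<Longrightarrow> cnj (cderiv i j \<alpha> z) = cderiv j i \<alpha> z"
proof -
  show "norm (cderiv i j \<alpha> z) \<le> B" if "deriv_bound 7 \<Omega> \<alpha> B" "1 \<le> i + j" "i + j \<le> 7"
    unfolding cderiv_eq_wirt using assms that by (intro norm_wirt_le_deriv_bound[of 7])
  show "cnj (cderiv i j \<alpha> z) = cderiv j i \<alpha> z" if "i + j \<le> 7"
    unfolding cderiv_eq_wirt using cnj_wirt[OF Ck_mono[OF assms(1) that] assms(2)] by simp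
qed

lemma consistency_error:
  assumes pos: "\<And>z. z \<in> \<Omega> \<Longrightarrow> a z > 0"
    and a: "Ck 7 (\<lambda>z. of_real (a z))" and f: "Ck 5 (\<lambda>z. of_real (f z))" and u: "Ck 8 (\<lambda>z. of_real (u z))"
    and pde: "solves_pde \<Omega> a f u" and b: "b \<in> \<Omega>"
    and box: "\<And>q. q \<in> {-h..h} \<times> {-h..h} \<Longrightarrow> b + q \<in> \<Omega>"
    and h: "0 < h" "h \<le> H"
    and B: "1 \<le> B" "\<And>i j. 1 \<le> i + j \<Longrightarrow> i + j \<le> 7 \<Longrightarrow> norm (cderiv i j (log_coeff a) b) \<le> B"
    and Bu: "deriv_bound 8 \<Omega> u Bu"
    and sys: "full_system (log_coeff a) b 6 c"
    and C: "\<And>p j. p \<in> stencil \<Longrightarrow> j \<le> 7 \<Longrightarrow> \<bar>c p j\<bar> \<le> C"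
    and sum0: "\<And>j. j \<le> 7 \<Longrightarrow> (\<Sum>p\<in>stencil. c p j) = 0"
  shows "norm (complex_of_real (\<Sum>p\<in>stencil. scheme_coeff 6 c p h * u (b + h *\<^sub>R p))
      - (\<Sum>p\<in>stencil. of_real (scheme_coeff 6 c p h)
           * F_poly 6 (log_coeff a) (scaled_source a f) b h p))
    \<le> error_bd B C Bu H * h ^ 8"
proof -
  let ?\<alpha> = "log_coeff a" and ?\<phi> = "scaled_source a f"
  let ?u = "\<lambda>z. complex_of_real (u z)"
  let ?U = "\<lambda>k l. wirt k l ?u b"
  let ?S = "{(m, n). m * n = 0 \<and> m + n \<le> (7::nat)}"
  let ?C = "\<lambda>p. complex_of_real (scheme_coeff 6 c p h)"
  have \<alpha>: "Ck 7 (\<lambda>z. of_real (?\<alpha> z))" using Ck_log_coeff[OF a pos] .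
  have \<phi>: "Ck 5 (\<lambda>z. of_real (?\<phi> z))"
    using Ck_scaled_source[OF Ck_mono[OF a] f pos] by simp
  have wU: "norm (wirt k l ?u w) \<le> Bu" if "1 \<le> k + l" "k + l \<le> 8" "w \<in> \<Omega>" for k l w
    using norm_wirt_le_deriv_bound[OF u Bu that] .
  have Bu0: "0 \<le> Bu" using wU[of 1 0 b] b order.trans[OF norm_ge_zero] by fastforce
  have C0: "0 \<le> C" using C[of "(0, 0)" 0] by (simp add: stencil_eq)
  have A0: "1 \<le> A_bd B" by (rule A_bd_ge_1[OF B(1)])
  have pde': "wirt 1 1 ?u z =
      (wirt 1 0 (\<lambda>z. of_real (?\<alpha> z)) z * wirt 0 1 ?u z
        + wirt 0 1 (\<lambda>z. of_real (?\<alpha> z)) z * wirt 1 0 ?u z) / 2 + of_real (?\<phi> z) / 4" if "z \<in> \<Omega>" for z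
    by (rule wirt_1_1_of_pde[OF Ck_mono[OF a] Ck_mono[OF u] pos pde that]) auto
  have rec: "?U (Suc k) (Suc l) =
      (\<Sum>(i, j)\<in>{0..Suc k} \<times> {0..Suc l} - {(Suc k, Suc l)}. a_coeff ?\<alpha> b (Suc k) (Suc l) i j * ?U i j)
        + cderiv k l ?\<phi> b / 4" if "k + l + 2 \<le> 7" for k l
    unfolding cderiv_eq_wirt
    by (rule wirt_recursion[OF Ck_mono[OF u] Ck_mono[OF \<alpha>] Ck_mono[OF \<phi>] pde' b]) (use that in auto)
  have U: "?U k l = (\<Sum>(m, n)\<in>?S. A_coeff ?\<alpha> b m n k l * ?U m n) + F_coeff ?\<alpha> ?\<phi> b k l"
    if "k + l \<le> 7" for k l
    by (rule expand_axis_derivatives[OF rec that])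
  \<comment> \<open>\<open>E p\<close> is the Taylor remainder at \<open>p\<close>, with the Taylor
    polynomial already written through the source and the axis derivatives.\<close>
  define E where "E p = ?u (b + h *\<^sub>R p) - F_poly 6 ?\<alpha> ?\<phi> b h p
    - (\<Sum>(m, n)\<in>?S. ?U m n * (\<Sum>q\<le>7. of_real h ^ q * A_poly ?\<alpha> b q m n p))" for p
  have E: "norm (E p) \<le> 18432 * Bu * h ^ 8" if p: "p \<in> stencil" for p
  proof -
    have line: "b + t *\<^sub>R p \<in> \<Omega>" if "0 \<le> t" "t \<le> h" for t
    proof (rule box)
      have "p \<in> {-1, 0, 1} \<times> {-1, 0, 1}" using p by (simp only: stencil_eq)
      then show "t *\<^sub>R p \<in> {-h..h} \<times> {-h..h}" using that by (cases p) auto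
    qed
    have "norm (?u (b + h *\<^sub>R p) - (\<Sum>q\<le>7. h ^ q *\<^sub>R (\<Sum>k\<le>q. N_mono k (q - k) p * ?U k (q - k))))
      \<le> real (7 + 2) * real (7 + 1) * 2 ^ Suc 7 * Bu * h ^ Suc 7"
      by (rule taylor_wirt[OF _ h(1) p line]) (use u wU in \<open>auto simp del: Ck.simps\<close>)
    moreover have "E p = ?u (b + h *\<^sub>R p) - (\<Sum>q\<le>7. h ^ q *\<^sub>R (\<Sum>k\<le>q. N_mono k (q - k) p * ?U k (q - k)))"
    proof -
      have "(\<Sum>q\<le>7. h ^ q *\<^sub>R (\<Sum>k\<le>q. N_mono k (q - k) p * ?U k (q - k)))
        = F_poly 6 ?\<alpha> ?\<phi> b h p
          + (\<Sum>(m, n)\<in>?S. ?U m n * (\<Sum>q\<le>7. of_real h ^ q * A_poly ?\<alpha> b q m n p))"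
        by (rule sum_expand_axis_derivatives[where U = ?U and S = ?S, OF U])
      then show ?thesis by (simp only: E_def diff_diff_add)
    qed
    ultimately show ?thesis by simp
  qed
  have "complex_of_real (\<Sum>p\<in>stencil. scheme_coeff 6 c p h * u (b + h *\<^sub>R p))
      - (\<Sum>p\<in>stencil. ?C p * F_poly 6 ?\<alpha> ?\<phi> b h p)
    = (\<Sum>p\<in>stencil. ?C p * E p)
      + (\<Sum>p\<in>stencil. ?C p * (\<Sum>(m, n)\<in>?S. ?U m n * (\<Sum>q\<le>7. of_real h ^ q * A_poly ?\<alpha> b q m n p)))"
    by (simp add: E_def algebra_simps sum.distrib sum_subtractf)
  also have "(\<Sum>p\<in>stencil. ?C p * (\<Sum>(m, n)\<in>?S. ?U m n * (\<Sum>q\<le>7. of_real h ^ q * A_poly ?\<alpha> b q m n p)))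
    = (\<Sum>(m, n)\<in>?S. ?U m n * axis_coeff ?\<alpha> b c h m n)"
  proof -
    have "(\<Sum>p\<in>stencil. ?C p * (\<Sum>(m, n)\<in>?S. ?U m n * (\<Sum>q\<le>7. of_real h ^ q * A_poly ?\<alpha> b q m n p)))
      = (\<Sum>p\<in>stencil. \<Sum>x\<in>?S. ?U (fst x) (snd x) *
          (?C p * (\<Sum>q\<le>7. of_real h ^ q * A_poly ?\<alpha> b q (fst x) (snd x) p)))"
      by (simp add: sum_distrib_left split_def mult_ac)
    also have "\<dots> = (\<Sum>x\<in>?S. \<Sum>p\<in>stencil. ?U (fst x) (snd x) *
          (?C p * (\<Sum>q\<le>7. of_real h ^ q * A_poly ?\<alpha> b q (fst x) (snd x) p)))"
      by (rule sum.swap)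
    finally show ?thesis by (simp add: axis_coeff_def sum_distrib_left[symmetric] split_def)
  qed
  finally have eq: "complex_of_real (\<Sum>p\<in>stencil. scheme_coeff 6 c p h * u (b + h *\<^sub>R p))
      - (\<Sum>p\<in>stencil. ?C p * F_poly 6 ?\<alpha> ?\<phi> b h p)
    = (\<Sum>p\<in>stencil. ?C p * E p) + (\<Sum>(m, n)\<in>?S. ?U m n * axis_coeff ?\<alpha> b c h m n)" .
  have 1: "norm (\<Sum>p\<in>stencil. ?C p * E p) \<le> (\<Sum>p\<in>stencil. 8 * (C * (1 + \<bar>H\<bar>) ^ 7) * (18432 * Bu * h ^ 8))"
  proof (rule order.trans[OF norm_sum sum_mono])
    fix p assume p: "p \<in> stencil"
    have "norm (?C p) \<le> 8 * (C * (1 + \<bar>H\<bar>) ^ 7)"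
      using abs_scheme_coeff_le[of c p C h H] C[OF p] h by simp
    then show "norm (?C p * E p) \<le> 8 * (C * (1 + \<bar>H\<bar>) ^ 7) * (18432 * Bu * h ^ 8)"
      unfolding norm_mult by (intro mult_mono E p) (use C0 in auto)
  qed
  let ?G = "64 * ((1 + \<bar>H\<bar>) ^ 6 * (9 * (A_bd B * C))) * h ^ 8"
  have G0: "0 \<le> ?G" using A0 C0 h by simp
  have axis0: "norm (axis_coeff ?\<alpha> b c h m 0) \<le> ?G" for m
    by (rule norm_axis_coeff_le[OF B sys C h])
  have 2: "norm (\<Sum>(m, n)\<in>?S. ?U m n * axis_coeff ?\<alpha> b c h m n) \<le> (\<Sum>x\<in>?S. Bu * ?G)"
  proof (rule order.trans[OF norm_sum sum_mono])
    fix x assume "x \<in> ?S"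
    then obtain m n where x: "x = (m, n)" "m = 0 \<or> n = 0" "m + n \<le> 7" by (cases x) auto
    have "norm (?U m n * axis_coeff ?\<alpha> b c h m n) \<le> Bu * ?G"
    proof (cases "m = 0 \<and> n = 0")
      case True
      then show ?thesis using axis_coeff_0_0[OF sum0] Bu0 G0 by simp
    next
      case False
      have "norm (axis_coeff ?\<alpha> b c h m n) \<le> ?G"
      proof (cases "n = 0")
        \<comment> \<open>Only the axis \<open>(m, 0)\<close> is estimated directly; the other one
          has the same norm by conjugation.\<close>
        case False
        then have "m = 0" using x by simp
        then have "norm (axis_coeff ?\<alpha> b c h m n) = norm (cnj (axis_coeff ?\<alpha> b c h n 0))"
          using cnj_axis_coeff[of ?\<alpha> b c h n 0] cderiv_bound_and_cnj(2)[OF \<alpha> b] by simp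
        then show ?thesis using axis0[of n] by simp
      qed (use axis0 in simp)
      moreover have "norm (?U m n) \<le> Bu" using False x b by (intro wU) auto
      ultimately show ?thesis unfolding norm_mult using Bu0 by (intro mult_mono) auto
    qed
    then show "norm (case x of (m, n) \<Rightarrow> ?U m n * axis_coeff ?\<alpha> b c h m n) \<le> Bu * ?G" using x(1) by simp
  qed
  have "?S \<subseteq> {..7} \<times> {..7}" by auto
  from card_mono[OF _ this] have "card ?S \<le> 64" by simp
  then have "real (card ?S) \<le> 64" by linarith
  then have "real (card ?S) * (Bu * ?G) \<le> 64 * (Bu * ?G)"
    by (rule mult_right_mono[OF _ mult_nonneg_nonneg[OF Bu0 G0]])
  then have 3: "(\<Sum>x\<in>?S. Bu * ?G) \<le> 64 * (Bu * ?G)" by simp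
  have nine: "(\<Sum>p\<in>stencil. x) = 9 * x" for x :: real by (simp add: card_stencil)
  have "norm ((\<Sum>p\<in>stencil. ?C p * E p) + (\<Sum>(m, n)\<in>?S. ?U m n * axis_coeff ?\<alpha> b c h m n))
    \<le> 9 * (8 * (C * (1 + \<bar>H\<bar>) ^ 7) * (18432 * Bu * h ^ 8)) + 64 * (Bu * ?G)"
    by (rule order.trans[OF norm_triangle_ineq add_mono[OF 1[unfolded nine] order.trans[OF 2 3]]])
  also have "\<dots> = error_bd B C Bu H * h ^ 8"
    by (simp add: error_bd_def algebra_simps)
  finally show ?thesis unfolding eq .
qed

end

theorem proposition3p2:
  shows
    "(\<forall>M \<Omega> a f u h cs. 1 \<le> M \<and> setting M \<Omega> a f u h cs \<longrightarrow>
        ((\<exists>c. system_part (log_coeff a) cs M 0 c \<and> (\<exists>p\<in>stencil. c p 0 \<noteq> 0)) \<longleftrightarrow> M \<le> 6))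
     \<and>
     (\<exists>(Kc :: real \<Rightarrow> real) (Ke :: real \<Rightarrow> real \<Rightarrow> real \<Rightarrow> real).
        \<forall>\<Omega> a cs Ba.
          (\<exists>f u h. setting 6 \<Omega> a f u h cs) \<and> deriv_bound 7 \<Omega> (log_coeff a) Ba \<longrightarrow>
          (\<exists>c.
             full_system (log_coeff a) cs 6 c \<and>
             (\<exists>p\<in>stencil. c p 0 \<noteq> 0) \<and>
             (\<forall>p\<in>stencil. \<forall>j\<le>7. \<bar>c p j\<bar> \<le> Kc Ba) \<and>
             (\<forall>f u h Bu H.
                setting 6 \<Omega> a f u h cs \<and> deriv_bound 8 \<Omega> u Bu \<and> h \<le> H \<longrightarrow>
                norm (complex_of_real (\<Sum>p\<in>stencil. scheme_coeff 6 c p h * u (cs + h *\<^sub>R p))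
                      - (\<Sum>p\<in>stencil. of_real (scheme_coeff 6 c p h)
                           * F_poly 6 (log_coeff a) (scaled_source a f) cs h p))
                \<le> Ke Ba Bu H * h ^ 8) \<and>
             c (0, 0) 0 > 0 \<and>
             (\<forall>p\<in>stencil - {(0, 0)}. c p 0 < 0) \<and>
             (\<forall>j. 1 \<le> j \<and> j \<le> 7 \<longrightarrow>
                c (0, 0) j \<ge> 0 \<and> (\<forall>p\<in>stencil - {(0, 0)}. c p j \<le> 0)) \<and>
             (\<forall>h>0. scheme_coeff 6 c (0, 0) h > 0 \<and>
                (\<forall>p\<in>stencil - {(0, 0)}. scheme_coeff 6 c p h < 0)) \<and>
             (\<forall>j\<le>7. (\<Sum>p\<in>stencil. c p j) = 0)))"
proof (intro conjI)
  show "\<forall>M \<Omega> a f u h cs. 1 \<le> M \<and> setting M \<Omega> a f u h cs \<longrightarrow>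
        ((\<exists>c. system_part (log_coeff a) cs M 0 c \<and> (\<exists>p\<in>stencil. c p 0 \<noteq> 0)) \<longleftrightarrow> M \<le> 6)"
    by (simp add: system_part_0_solvable_iff)
  \<comment> \<open>The estimates use powers of \<open>B\<close> and need \<open>B \<ge> 1\<close>,
    whereas \<open>Ba\<close> may be smaller, for instance for constant \<open>a\<close>.\<close>
  let ?B = "\<lambda>Ba::real. max 1 Ba"
  let ?Kc = "\<lambda>Ba. coeff_bd (?B Ba)" and ?Ke = "\<lambda>Ba Bu H. error_bd (?B Ba) (coeff_bd (?B Ba)) Bu H"
  show "\<exists>(Kc :: real \<Rightarrow> real) (Ke :: real \<Rightarrow> real \<Rightarrow> real \<Rightarrow> real).
        \<forall>\<Omega> a cs Ba.
          (\<exists>f u h. setting 6 \<Omega> a f u h cs) \<and> deriv_bound 7 \<Omega> (log_coeff a) Ba \<longrightarrow>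
          (\<exists>c.
             full_system (log_coeff a) cs 6 c \<and>
             (\<exists>p\<in>stencil. c p 0 \<noteq> 0) \<and>
             (\<forall>p\<in>stencil. \<forall>j\<le>7. \<bar>c p j\<bar> \<le> Kc Ba) \<and>
             (\<forall>f u h Bu H.
                setting 6 \<Omega> a f u h cs \<and> deriv_bound 8 \<Omega> u Bu \<and> h \<le> H \<longrightarrow>
                norm (complex_of_real (\<Sum>p\<in>stencil. scheme_coeff 6 c p h * u (cs + h *\<^sub>R p))
                      - (\<Sum>p\<in>stencil. of_real (scheme_coeff 6 c p h)
                           * F_poly 6 (log_coeff a) (scaled_source a f) cs h p))
                \<le> Ke Ba Bu H * h ^ 8) \<and>
             c (0, 0) 0 > 0 \<and>
             (\<forall>p\<in>stencil - {(0, 0)}. c p 0 < 0) \<and>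
             (\<forall>j. 1 \<le> j \<and> j \<le> 7 \<longrightarrow>
                c (0, 0) j \<ge> 0 \<and> (\<forall>p\<in>stencil - {(0, 0)}. c p j \<le> 0)) \<and>
             (\<forall>h>0. scheme_coeff 6 c (0, 0) h > 0 \<and>
                (\<forall>p\<in>stencil - {(0, 0)}. scheme_coeff 6 c p h < 0)) \<and>
             (\<forall>j\<le>7. (\<Sum>p\<in>stencil. c p j) = 0))"
  proof (rule exI[of _ ?Kc], rule exI[of _ ?Ke], intro allI impI)
    fix \<Omega> a cs Ba
    assume *: "(\<exists>f u h. setting 6 \<Omega> a f u h cs) \<and> deriv_bound 7 \<Omega> (log_coeff a) Ba"
    \<comment> \<open>This instance only supplies the facts about the domain, \<open>a\<close> and
      \<open>cs\<close>. The weights are fixed before \<open>f\<close>, \<open>u\<close> and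
      \<open>h\<close>, so the same weights serve all of them.\<close>
    then obtain f0 u0 h0 where set: "setting 6 \<Omega> a f0 u0 h0 cs" by blast
    then interpret open_plane \<Omega> by unfold_locales (simp add: setting_def)
    have pos: "a z > 0" if "z \<in> \<Omega>" for z using set that by (simp add: setting_def)
    have cs: "cs \<in> \<Omega>" using set by (simp add: setting_def)
    have "Ck_bounded 7 \<Omega> a" using set by (simp add: setting_def)
    then have a: "Ck 7 (\<lambda>z. of_real (a z))" by (rule Ck_bounded_imp_Ck)
    have \<alpha>: "Ck 7 (\<lambda>z. of_real (log_coeff a z))" by (rule Ck_log_coeff[OF a pos])
    have B: "1 \<le> ?B Ba"
      "\<And>i j. 1 \<le> i + j \<Longrightarrow> i + j \<le> 7 \<Longrightarrow> norm (cderiv i j (log_coeff a) cs) \<le> ?B Ba"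
      using cderiv_bound_and_cnj(1)[OF \<alpha> cs conjunct2[OF *]] by (auto simp: le_max_iff_disj)
    obtain c where sys: "full_system (log_coeff a) cs 6 c"
      and C: "\<And>p j. p \<in> stencil \<Longrightarrow> j \<le> 7 \<Longrightarrow> \<bar>c p j\<bar> \<le> ?Kc Ba"
      and c0: "\<And>j. j \<le> 7 \<Longrightarrow> c (0, 0) j > 0"
      and cp: "\<And>p j. p \<in> stencil - {(0, 0)} \<Longrightarrow> j \<le> 7 \<Longrightarrow> c p j < 0"
      and sum0: "\<And>j. j \<le> 7 \<Longrightarrow> (\<Sum>p\<in>stencil. c p j) = 0"
      using exists_full_system_solution[OF B cderiv_bound_and_cnj(2)[OF \<alpha> cs]] by auto
    have err: "norm (complex_of_real (\<Sum>p\<in>stencil. scheme_coeff 6 c p h * u (cs + h *\<^sub>R p))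
                      - (\<Sum>p\<in>stencil. of_real (scheme_coeff 6 c p h)
                           * F_poly 6 (log_coeff a) (scaled_source a f) cs h p))
                \<le> ?Ke Ba Bu H * h ^ 8"
      if s: "setting 6 \<Omega> a f u h cs" and Bu: "deriv_bound 8 \<Omega> u Bu" and H: "h \<le> H" for f u h Bu H
    proof (rule consistency_error[OF pos a _ _ _ cs _ _ H B Bu sys C sum0])
      have "Ck_bounded 5 \<Omega> f" "Ck_bounded 8 \<Omega> u" using s by (simp_all add: setting_def)
      then show "Ck 5 (\<lambda>z. of_real (f z))" "Ck 8 (\<lambda>z. of_real (u z))"
        by (auto intro!: Ck_bounded_imp_Ck simp del: Ck.simps Ck_bounded.simps)
      show "solves_pde \<Omega> a f u" "0 < h" using s by (simp_all add: setting_def)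
      show "cs + q \<in> \<Omega>" if "q \<in> {-h..h} \<times> {-h..h}" for q
        using s that unfolding setting_def by blast
    qed
    have pos_h: "scheme_coeff 6 c (0, 0) h > 0" if "h > 0" for h
      unfolding scheme_coeff_6 using that c0 by (intro sum_pos) auto
    have neg_h: "scheme_coeff 6 c p h < 0" if "h > 0" "p \<in> stencil - {(0, 0)}" for h p
    proof -
      have "0 < (\<Sum>j\<le>7. - (c p j * h ^ j))"
        using that cp by (intro sum_pos) (auto simp: mult_neg_pos)
      then show ?thesis by (simp add: scheme_coeff_6 sum_negf)
    qed
    have "(0, 0) \<in> stencil" by (simp add: stencil_eq)
    then have nz: "\<exists>p\<in>stencil. c p 0 \<noteq> 0" using c0[of 0] by force
    show "\<exists>c.
             full_system (log_coeff a) cs 6 c \<and>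
             (\<exists>p\<in>stencil. c p 0 \<noteq> 0) \<and>
             (\<forall>p\<in>stencil. \<forall>j\<le>7. \<bar>c p j\<bar> \<le> ?Kc Ba) \<and>
             (\<forall>f u h Bu H.
                setting 6 \<Omega> a f u h cs \<and> deriv_bound 8 \<Omega> u Bu \<and> h \<le> H \<longrightarrow>
                norm (complex_of_real (\<Sum>p\<in>stencil. scheme_coeff 6 c p h * u (cs + h *\<^sub>R p))
                      - (\<Sum>p\<in>stencil. of_real (scheme_coeff 6 c p h)
                           * F_poly 6 (log_coeff a) (scaled_source a f) cs h p))
                \<le> ?Ke Ba Bu H * h ^ 8) \<and>
             c (0, 0) 0 > 0 \<and>
             (\<forall>p\<in>stencil - {(0, 0)}. c p 0 < 0) \<and>
             (\<forall>j. 1 \<le> j \<and> j \<le> 7 \<longrightarrow>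
                c (0, 0) j \<ge> 0 \<and> (\<forall>p\<in>stencil - {(0, 0)}. c p j \<le> 0)) \<and>
             (\<forall>h>0. scheme_coeff 6 c (0, 0) h > 0 \<and>
                (\<forall>p\<in>stencil - {(0, 0)}. scheme_coeff 6 c p h < 0)) \<and>
             (\<forall>j\<le>7. (\<Sum>p\<in>stencil. c p j) = 0)"
      by (rule exI[of _ c], intro conjI allI ballI impI sys nz C err c0 cp pos_h neg_h sum0)
         (use less_imp_le[OF c0] less_imp_le[OF cp] in auto)
  qed
qed

end
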